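(* Let $x$ be a critical point of the Lagrangian system $\mathcal F(x)=\int_0^T L(t,x,\dot x)\,dt$, where $L\in C^2([0,T]\times\mathbf R^{2n},\mathbf R)$ satisfies the Legendre convexity condition, and let $\Lambda_0$ be any Lagrangian subspace of $(\mathbf C^{2n}\oplus\mathbf C^{2n},-\omega\oplus\omega)$. Then $$m^-(\Lambda_D)\le m^-(\Lambda_0)\le m^-(\Lambda_D)+\nu(\Lambda_0),$$ where $\nu(\Lambda_0)=\dim V(\Lambda_0)$ and $V(\Lambda_0)=(\Lambda_0+\Lambda_D)\cap\Lambda_N$.
   Context: **Lagrangian system.** $\mathcal F$ is considered on $W^{1,2}([0,T],\mathbf R^n)$. The Legendre convexity condition is $(D^2_{vv}L(t,u,v)w,w)>0$ for all $t\in[0,T]$, $(u,v)\in\mathbf R^n\oplus\mathbf R^n$, $w\in\mathbf R^n\setminus\{0\}$. A critical (stationary) point is a solution $x$ of the Euler-Lagrange equation $\frac{d}{dt}\frac{\partial L}{\partial\dot x}(t,x,\dot x)-\frac{\partial L}{\partial x}(t,x,\dot x)=0$. Along $x$ put $P(t)=\frac{\partial^2L}{\partial\dot x^2}$, $Q(t)=\frac{\partial^2L}{\partial x\partial\dot x}$ (entries $Q_{ij}=\partial^2L/\partial\dot x_i\partial x_j$), $R(t)=\frac{\partial^2L}{\partial x^2}$. The linearization along $x$ is given by $\mathcal A\xi=-\frac{d}{dt}(P\dot \xi+Q\xi)+Q^T\dot \xi+R\xi$. **Symplectic notation.** $\langle\cdot,\cdot\rangle$ is the standard Hermitian inner product,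 $J=\begin{bmatrix}0&-I_n\\ I_n&0\end{bmatrix}$, $\omega(a,b)=\langle Ja,b\rangle$ on $\mathbf C^{2n}$. A complex subspace of a complex symplectic space is Lagrangian if the symplectic form vanishes on it and it has half the dimension. **Boundary conditions and Morse index.** For a function $\xi$ put $y=P\dot\xi+Q\xi$ and $z=(y,\xi)^T\in\mathbf C^{2n}$. For a Lagrangian subspace $\Lambda_0$ of $(\mathbf C^{2n}\oplus\mathbf C^{2n},-\omega\oplus\omega)$, $\mathcal A$ is regarded as a self-adjoint operator on $L^2([0,T],\mathbf C^n)$ with domain $E_{\Lambda_0}(0,T)=\{\xi\in W^{2,2}([0,T],\mathbf C^n): (z(0),z(T))\in\Lambda_0\}$. The Morse index $m^-(\Lambda_0)$ is the total number of negative eigenvalues of this operator. In $\mathbf C^{2n}$ put $\Lambda^n_D=\mathbf C^n\oplus\{0\}$ and $\Lambda^n_N=\{0\}\oplus\mathbf C^n$; then $\Lambda_D=\Lambda_D^n\oplus\Lambda_D^n$ (Dirichlet: $\xi(0)=\xi(T)=0$) and $\Lambda_N=\Lambda_N^n\oplus\Lambda_N^n$ (Neumann: $y(0)=y(T)=0$).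
   Formalization: For L only C², P and Q may not be differentiable, so A is ill-defined on W^{2,2}; the domain is taken as ξ in C¹ with Pξ'+Qξ in W^{1,2} and (z(0),z(T)) in Λ_0, which is E_{Λ_0} whenever A is defined there. Critical points are classical C¹ solutions. *)

theory Defs
  imports "HOL-Analysis.Analysis" "HOL-Library.Function_Algebras"
begin

section \<open>The Lagrangian and its critical points\<close>

text \<open>
  On sets such as \<open>{0..T} \<times> UNIV\<close> derivatives within the set are unique; at \<open>t = 0\<close> and \<open>t = T\<close>
  they are one-sided in time.
\<close>

definition C2_on :: "'a::real_normed_vector set \<Rightarrow> ('a \<Rightarrow> real) \<Rightarrow> bool" where
  "C2_on S f \<longleftrightarrow>
     (\<exists>(f' :: 'a \<Rightarrow> 'a \<Rightarrow>\<^sub>L real) (f'' :: 'a \<Rightarrow> 'a \<Rightarrow>\<^sub>L ('a \<Rightarrow>\<^sub>L real)).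
        (\<forall>p\<in>S. (f has_derivative blinfun_apply (f' p)) (at p within S)) \<and>
        (\<forall>p\<in>S. (f' has_derivative blinfun_apply (f'' p)) (at p within S)) \<and>
        continuous_on S f'')"

type_synonym 'n lagr = "real \<Rightarrow> real^'n \<Rightarrow> real^'n \<Rightarrow> real"

definition grad :: "(real^'n::finite \<Rightarrow> real) \<Rightarrow> real^'n \<Rightarrow> real^'n" where
  "grad f u = (\<chi> i. frechet_derivative f (at u) (axis i 1))"

definition L_u :: "'n::finite lagr \<Rightarrow> real \<Rightarrow> real^'n \<Rightarrow> real^'n \<Rightarrow> real^'n" where
  "L_u L t u v = grad (\<lambda>u'. L t u' v) u"

definition L_v :: "'n::finite lagr \<Rightarrow> real \<Rightarrow> real^'n \<Rightarrow> real^'n \<Rightarrow> real^'n" where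
  "L_v L t u v = grad (\<lambda>v'. L t u v') v"

text \<open>
  The \<open>(i, j)\<close> entries are \<open>\<partial>\<^sup>2L/\<partial>v\<^sub>i\<partial>v\<^sub>j\<close>, \<open>\<partial>\<^sup>2L/\<partial>v\<^sub>i\<partial>u\<^sub>j\<close> and
  \<open>\<partial>\<^sup>2L/\<partial>u\<^sub>i\<partial>u\<^sub>j\<close> respectively.
\<close>

definition L_vv :: "'n::finite lagr \<Rightarrow> real \<Rightarrow> real^'n \<Rightarrow> real^'n \<Rightarrow> real^'n^'n" where
  "L_vv L t u v = jacobian (\<lambda>v'. L_v L t u v') (at v)"

definition L_vu :: "'n::finite lagr \<Rightarrow> real \<Rightarrow> real^'n \<Rightarrow> real^'n \<Rightarrow> real^'n^'n" where
  "L_vu L t u v = jacobian (\<lambda>u'. L_v L t u' v) (at u)"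

definition L_uu :: "'n::finite lagr \<Rightarrow> real \<Rightarrow> real^'n \<Rightarrow> real^'n \<Rightarrow> real^'n^'n" where
  "L_uu L t u v = jacobian (\<lambda>u'. L_u L t u' v) (at u)"

definition legendre_convex :: "real \<Rightarrow> 'n::finite lagr \<Rightarrow> bool" where
  "legendre_convex T L \<longleftrightarrow>
     (\<forall>t\<in>{0..T}. \<forall>u v w. w \<noteq> 0 \<longrightarrow> (L_vv L t u v *v w) \<bullet> w > 0)"

definition dot :: "real \<Rightarrow> (real \<Rightarrow> 'a::real_normed_vector) \<Rightarrow> real \<Rightarrow> 'a" where
  "dot T f t = vector_derivative f (at t within {0..T})"

definition C1_path :: "real \<Rightarrow> (real \<Rightarrow> 'a::real_normed_vector) \<Rightarrow> bool" where
  "C1_path T f \<longleftrightarrow> f differentiable_on {0..T} \<and> continuous_on {0..T} (dot T f)"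

definition critical_point :: "real \<Rightarrow> 'n::finite lagr \<Rightarrow> (real \<Rightarrow> real^'n) \<Rightarrow> bool" where
  "critical_point T L x \<longleftrightarrow>
     C1_path T x \<and>
     (\<forall>t\<in>{0..T}. ((\<lambda>s. L_v L s (x s) (dot T x s))
        has_vector_derivative L_u L t (x t) (dot T x t)) (at t within {0..T}))"


section \<open>Symplectic linear algebra\<close>

text \<open>
  A point of \<open>\<complex>\<^sup>2\<^sup>n\<close> is a pair \<open>(y, \<xi>)\<close> of vectors in \<open>\<complex>\<^sup>n\<close>.  The locales below supply
  \<open>subspace\<close>, \<open>span\<close> and \<open>dim\<close> over the complex numbers; the constants of the same names without
  qualifier refer to the real structure.
\<close>

type_synonym 'n c2n = "(complex^'n) \<times> (complex^'n)"
type_synonym 'n c4n = "'n c2n \<times> 'n c2n"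

interpretation c2n: finite_dimensional_vector_space_prod
  "(*s) :: complex \<Rightarrow> complex^'n \<Rightarrow> complex^'n::finite"
  "(*s) :: complex \<Rightarrow> complex^'n \<Rightarrow> complex^'n::finite" cart_basis cart_basis
  by unfold_locales

interpretation c4n: finite_dimensional_vector_space_prod
  "c2n.scale :: complex \<Rightarrow> 'n c2n \<Rightarrow> 'n::finite c2n"
  "c2n.scale :: complex \<Rightarrow> 'n c2n \<Rightarrow> 'n::finite c2n" c2n.Basis_pair c2n.Basis_pair
  by unfold_locales

definition hinner :: "complex^'n::finite \<Rightarrow> complex^'n \<Rightarrow> complex" where
  "hinner a b = (\<Sum>i\<in>UNIV. a $ i * cnj (b $ i))"

definition hinner2 :: "'n::finite c2n \<Rightarrow> 'n c2n \<Rightarrow> complex" where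
  "hinner2 a b = hinner (fst a) (fst b) + hinner (snd a) (snd b)"

definition J :: "'n::finite c2n \<Rightarrow> 'n c2n" where
  "J z = (- snd z, fst z)"

definition omega :: "'n::finite c2n \<Rightarrow> 'n c2n \<Rightarrow> complex" where
  "omega a b = hinner2 (J a) b"

definition Omega :: "'n::finite c4n \<Rightarrow> 'n c4n \<Rightarrow> complex" where
  "Omega a b = - omega (fst a) (fst b) + omega (snd a) (snd b)"

definition lagrangian :: "('n::finite c4n) set \<Rightarrow> bool" where
  "lagrangian \<Lambda> \<longleftrightarrow>
     c4n.p.subspace \<Lambda> \<and> (\<forall>a\<in>\<Lambda>. \<forall>b\<in>\<Lambda>. Omega a b = 0) \<and>
     2 * c4n.p.dim \<Lambda> = c4n.p.dim (UNIV :: ('n c4n) set)"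

definition Lambda_D :: "('n::finite c4n) set" where
  "Lambda_D = (UNIV \<times> {0}) \<times> (UNIV \<times> {0})"

definition Lambda_N :: "('n::finite c4n) set" where
  "Lambda_N = ({0} \<times> UNIV) \<times> ({0} \<times> UNIV)"

definition V_space :: "('n::finite c4n) set \<Rightarrow> ('n c4n) set" where
  "V_space \<Lambda> = {a + b |a b. a \<in> \<Lambda> \<and> b \<in> Lambda_D} \<inter> Lambda_N"

definition nu :: "('n::finite c4n) set \<Rightarrow> nat" where
  "nu \<Lambda> = c4n.p.dim (V_space \<Lambda>)"


section \<open>The linearization and its Morse index\<close>

text \<open>
  \<open>f \<in> W\<^sup>1\<^sup>,\<^sup>2([0,T])\<close> with weak derivative \<open>g\<close>, where \<open>f\<close> is the continuous representative.
\<close>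

definition L2_on :: "real \<Rightarrow> (real \<Rightarrow> 'a::euclidean_space) \<Rightarrow> bool" where
  "L2_on T g \<longleftrightarrow> set_borel_measurable lebesgue {0..T} g \<and>
                 set_integrable lebesgue {0..T} (\<lambda>t. (norm (g t))\<^sup>2)"

definition has_weak_deriv ::
    "real \<Rightarrow> (real \<Rightarrow> 'a::euclidean_space) \<Rightarrow> (real \<Rightarrow> 'a) \<Rightarrow> bool" where
  "has_weak_deriv T f g \<longleftrightarrow>
     L2_on T g \<and> (\<forall>t\<in>{0..T}. f t = f 0 + (LINT s:{0..t}|lebesgue. g s))"

definition W12 :: "real \<Rightarrow> (real \<Rightarrow> 'a::euclidean_space) set" where
  "W12 T = {f. \<exists>g. has_weak_deriv T f g}"

text \<open>The choice is unique almost everywhere on \<open>[0,T]\<close> for \<open>f \<in> W12 T\<close>.\<close>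

definition weak_deriv :: "real \<Rightarrow> (real \<Rightarrow> 'a::euclidean_space) \<Rightarrow> real \<Rightarrow> 'a" where
  "weak_deriv T f = (SOME g. has_weak_deriv T f g)"

abbreviation cmat :: "real^'n^'n \<Rightarrow> complex^'n^'n" where
  "cmat \<equiv> map_matrix complex_of_real"

context
  fixes T :: real and L :: "'n::finite lagr" and x :: "real \<Rightarrow> real^'n"
begin

definition P_coeff :: "real \<Rightarrow> real^'n^'n" where
  "P_coeff t = L_vv L t (x t) (dot T x t)"

definition Q_coeff :: "real \<Rightarrow> real^'n^'n" where
  "Q_coeff t = L_vu L t (x t) (dot T x t)"

definition R_coeff :: "real \<Rightarrow> real^'n^'n" where
  "R_coeff t = L_uu L t (x t) (dot T x t)"

definition momentum :: "(real \<Rightarrow> complex^'n) \<Rightarrow> real \<Rightarrow> complex^'n" where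
  "momentum \<xi> t = cmat (P_coeff t) *v dot T \<xi> t + cmat (Q_coeff t) *v \<xi> t"

definition A_op :: "(real \<Rightarrow> complex^'n) \<Rightarrow> real \<Rightarrow> complex^'n" where
  "A_op \<xi> t = - weak_deriv T (momentum \<xi>) t
     + cmat (transpose (Q_coeff t)) *v dot T \<xi> t + cmat (R_coeff t) *v \<xi> t"

text \<open>
  The domain of the operator.  For \<open>L\<close> of class \<open>C\<^sup>2\<close> the coefficients \<open>P\<close>, \<open>Q\<close> are only continuous,
  so that \<open>(d/dt)(P \<xi>' + Q \<xi>)\<close> need not exist for \<open>\<xi> \<in> W\<^sup>2\<^sup>,\<^sup>2\<close>; the second-order
  regularity is therefore expressed by \<open>P \<xi>' + Q \<xi> \<in> W\<^sup>1\<^sup>,\<^sup>2\<close>.  This is the domain on which the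
  expression is self-adjoint, and as \<open>P\<close> is invertible it equals the set of \<open>\<xi> \<in> W\<^sup>2\<^sup>,\<^sup>2\<close>
  satisfying the boundary condition whenever \<open>P\<close>, \<open>Q\<close> are of class \<open>C\<^sup>1\<close>.
  Functions vanish outside \<open>[0,T]\<close>, so that equal functions on \<open>[0,T]\<close> are counted once.
\<close>

definition E_dom :: "('n c4n) set \<Rightarrow> (real \<Rightarrow> complex^'n) set" where
  "E_dom \<Lambda> = {\<xi>. (\<forall>t. t \<notin> {0..T} \<longrightarrow> \<xi> t = 0) \<and> C1_path T \<xi> \<and> momentum \<xi> \<in> W12 T \<and>
                 ((momentum \<xi> 0, \<xi> 0), (momentum \<xi> T, \<xi> T)) \<in> \<Lambda>}"

definition eigenspace :: "('n c4n) set \<Rightarrow> real \<Rightarrow> (real \<Rightarrow> complex^'n) set" where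
  "eigenspace \<Lambda> \<mu> =
     {\<xi> \<in> E_dom \<Lambda>. AE t\<in>{0..T} in lebesgue. A_op \<xi> t = complex_of_real \<mu> *s \<xi> t}"

end

interpretation cfun: vector_space
  "\<lambda>(c::complex) (f :: 'b \<Rightarrow> complex^'n::finite) t. c *s f t"
  by unfold_locales
    (auto simp: fun_eq_iff vec.scale_right_distrib vec.scale_left_distrib)

definition edim :: "('b \<Rightarrow> complex^'n::finite) set \<Rightarrow> enat" where
  "edim S = (if \<exists>B. finite B \<and> S \<subseteq> cfun.span B then enat (cfun.dim S) else \<infinity>)"

text \<open>
  Negative eigenvalues are counted with multiplicity.  Summation in the extended naturals avoids
  default values: every sum there converges, with value \<open>\<infinity>\<close> if infinitely many terms are nonzero.
\<close>

definition morse_index ::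
    "real \<Rightarrow> 'n::finite lagr \<Rightarrow> (real \<Rightarrow> real^'n) \<Rightarrow> ('n c4n) set \<Rightarrow> enat" where
  "morse_index T L x \<Lambda> = (\<Sum>\<^sub>\<infinity>\<mu>\<in>{..<0}. edim (eigenspace T L x \<Lambda> \<mu>))"

end

theory Submission
  imports Defs "HOL-Complex_Analysis.Great_Picard"
begin

text \<open>
  A function in the domain of the form of \<open>\<Lambda>\<^sub>0\<close> that vanishes at both ends lies in the domain of
  the Dirichlet form, on which the two quadratic forms agree.  So both inequalities follow from one
  principle: if \<open>k\<close> orthonormal eigenfunctions of the operator with boundary condition \<open>\<Lambda>\<close> have
  negative eigenvalues, and some \<open>C\<^sup>1\<close> function that vanishes at both ends is orthogonal to all
  of them and makes the form \<open>\<integral> (P\<xi>' + Q\<xi>, \<xi>') + (Q\<^sup>T\<xi>' + R\<xi>, \<xi>)\<close> negative, then there is a further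
  eigenfunction with negative eigenvalue orthogonal to them.  A combination of \<open>N\<close> eigenfunctions
  of the other condition is such a function as soon as \<open>N\<close> exceeds the number of linear conditions
  on its coefficients: \<open>k\<close> for the orthogonality, and, when the other condition is \<open>\<Lambda>\<^sub>0\<close>, \<open>\<nu>(\<Lambda>\<^sub>0)\<close>
  for the boundary values, which range over \<open>V(\<Lambda>\<^sub>0)\<close>.

  For the principle, take \<open>c\<close> so large that the form shifted by \<open>c\<close> is coercive.  The inverse \<open>K\<close>
  of \<open>\<A> + c\<close> exists because the graph of the monodromy of the Hamiltonian system is transversal
  to \<open>\<Lambda>\<close>; it is symmetric, and compact by the theorem of Arzela and Ascoli.  Its Rayleigh quotient
  at the given function exceeds \<open>1/c\<close>, so its maximum on the orthogonal complement is attained at an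
  eigenvalue \<open>\<rho> > 1/c\<close>, which gives the eigenvalue \<open>1/\<rho> - c < 0\<close> of \<open>\<A>\<close>.
\<close>

section \<open>Complex vectors, matrices and paths\<close>

text \<open>An eigenfunction for one boundary condition is in general not in the operator domain for
  the other, so the operators cannot be compared directly; the principle is therefore stated for a
  function \<open>F0\<close> for which only the form is available. Its Rayleigh quotient is
  estimated by evaluating the form q shifted by \<open>c\<close> at \<open>F0 - c K F0\<close>,
  which takes the place of the Cauchy-Schwarz inequality
  \<open>(F0, F0)^2 \<le> q(F0) (F0, K F0)\<close>.

  For general \<Lambda> Green's formula leaves a boundary term. It is bounded by a constant
  \<open>C\<close> times the squared end positions, and a trace inequality with a small parameter
  absorbs these; this is why \<open>coercive\<close> has a free \<open>C\<close> and why
  \<open>c\<close> depends on \<Lambda>.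

  The functions are continuous and the norm is that of L2, so the space is not complete: solvability
  comes from a dimension count on \<Lambda>, and the maximum of the Rayleigh quotient from uniform
  convergence of a subsequence. Orthogonality is Hermitian, so that linear conditions are counted
  over the complex numbers, whereas the quadratic forms are real.\<close>

lemma homogeneous_system_nontrivial:
  fixes \<phi> :: "nat \<Rightarrow> nat \<Rightarrow> 'a::field"
  assumes "m < N"
  shows "\<exists>c. (\<exists>i<N. c i \<noteq> 0) \<and> (\<forall>j<m. (\<Sum>i<N. c i * \<phi> j i) = 0)"
  using assms
proof (induction m arbitrary: N \<phi>)
  case 0
  then show ?case by (intro exI[of _ "\<lambda>_. 1"]) auto
next
  case (Suc m)
  then obtain M where N: "N = Suc M" "m < M" by (cases N) auto
  show ?case
  proof (cases "\<forall>i<N. \<phi> m i = 0")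
    case True
    from Suc.IH[of N \<phi>] Suc.prems obtain c where "\<exists>i<N. c i \<noteq> 0" "\<forall>j<m. (\<Sum>i<N. c i * \<phi> j i) = 0"
      by auto
    with True show ?thesis by (intro exI[of _ c]) (auto simp: less_Suc_eq)
  next
    case False
    then obtain p where p: "p < N" "\<phi> m p \<noteq> 0" by auto
    \<comment> \<open>Gaussian elimination: the transposition \<open>s\<close> moves a pivot
      \<open>p\<close> of the last equation to the last position \<open>M\<close>, so that the
      remaining unknowns are again indexed by an initial segment.\<close>
    define s where "s i = (if i = p then M else if i = M then p else i)" for i
    have s: "bij_betw s {..<N} {..<N}"
      using p N by (intro bij_betwI[of _ _ _ s]) (auto simp: s_def)
    have sM: "s M = p" by (simp add: s_def)
    define \<psi> where "\<psi> j i = \<phi> j (s i)" for j i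
    have pM: "\<psi> m M \<noteq> 0" using p sM by (simp add: \<psi>_def)
    obtain d where d: "\<exists>i<M. d i \<noteq> 0" "\<forall>j<m. (\<Sum>i<M. d i * (\<psi> j i - \<psi> m i / \<psi> m M * \<psi> j M)) = 0"
      using Suc.IH[OF N(2), of "\<lambda>j i. \<psi> j i - \<psi> m i / \<psi> m M * \<psi> j M"] by blast
    \<comment> \<open>The last coordinate is solved from equation \<open>m\<close>; substituting it
      in the other equations gives the reduced system satisfied by \<open>d\<close>.\<close>
    define e where "e i = (if i = M then - (\<Sum>i<M. d i * \<psi> m i) / \<psi> m M else d i)" for i
    have sumN: "(\<Sum>i<N. e i * \<psi> j i) = (\<Sum>i<M. d i * \<psi> j i) - (\<Sum>i<M. d i * \<psi> m i) / \<psi> m M * \<psi> j M" for j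
    proof -
      have "(\<Sum>i<M. e i * \<psi> j i) = (\<Sum>i<M. d i * \<psi> j i)" by (rule sum.cong) (auto simp: e_def)
      then show ?thesis by (simp add: N e_def)
    qed
    have z: "(\<Sum>i<N. e i * \<psi> j i) = 0" if "j < Suc m" for j
    proof (cases "j = m")
      case True then show ?thesis using pM unfolding sumN by simp
    next
      case False
      then have "(\<Sum>i<M. d i * (\<psi> j i - \<psi> m i / \<psi> m M * \<psi> j M)) = 0" using d that by auto
      then show ?thesis unfolding sumN
        by (simp add: right_diff_distrib sum_subtractf sum_distrib_left sum_distrib_right sum_divide_distrib mult_ac)
    qed
    define c where "c i = e (s i)" for i
    have ss: "s (s i) = i" for i by (simp add: s_def)
    have "(\<Sum>i<N. c i * \<phi> j i) = (\<Sum>i<N. e i * \<psi> j i)" for j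
      unfolding c_def \<psi>_def using sum.reindex_bij_betw[OF s, of "\<lambda>i. e (s i) * \<phi> j i"] by (simp add: ss)
    moreover have "\<exists>i<N. c i \<noteq> 0"
    proof -
      obtain i where "i < M" "d i \<noteq> 0" using d by auto
      moreover have "s i < N" using s N \<open>i < M\<close> by (auto simp: bij_betw_def)
      ultimately show ?thesis by (intro exI[of _ "s i"]) (auto simp: c_def ss e_def)
    qed
    ultimately show ?thesis using z by (intro exI[of _ c]) auto
  qed
qed

lemma hinner_sums:
  "hinner (a + b) d = hinner a d + hinner b d"
  "hinner d (a + b) = hinner d a + hinner d b"
  "hinner (a - b) d = hinner a d - hinner b d"
  "hinner d (a - b) = hinner d a - hinner d b"
  "hinner (- a) d = - hinner a d"
  "hinner d (- a) = - hinner d a"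
  "hinner (c *s a) d = c * hinner a d"
  "hinner d (c *s a) = cnj c * hinner d a"
  "hinner 0 d = 0" "hinner d 0 = 0"
  by (simp_all add: hinner_def sum.distrib sum_subtractf sum_negf algebra_simps sum_distrib_left)

lemma hinner_cnj: "cnj (hinner a b) = hinner b a"
  by (simp add: hinner_def mult.commute)

lemma Re_hinner: "Re (hinner a b) = a \<bullet> b"
  by (simp add: hinner_def inner_vec_def inner_complex_def)

lemma scaleR_eq_smult: "r *\<^sub>R (a :: complex^'n) = complex_of_real r *s a"
  unfolding vec_eq_iff vector_scaleR_component vector_smult_component by (simp add: scaleR_conv_of_real)

text \<open>The factor \<open>CARD('n)\<close> is crude and comes from estimating every coordinate
  by the norm; it serves for boundedness and continuity only.\<close>

lemma norm_hinner_le: "norm (hinner a b) \<le> real CARD('n) * norm a * norm (b :: complex^'n::finite)"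
proof -
  have "norm (hinner a b) \<le> (\<Sum>i\<in>(UNIV::'n set). norm a * norm b)"
    unfolding hinner_def
    by (rule sum_norm_le) (auto simp: norm_mult intro!: mult_mono Finite_Cartesian_Product.norm_nth_le)
  then show ?thesis by simp
qed

lemma hinner_bounded_bilinear: "bounded_bilinear (hinner :: complex^'n::finite \<Rightarrow> _)"
proof
  fix a b a' b' :: "complex^'n" and r :: real
  show "hinner (a + a') b = hinner a b + hinner a' b" "hinner a (b + b') = hinner a b + hinner a b'"
    by (rule hinner_sums)+
  show "hinner (r *\<^sub>R a) b = r *\<^sub>R hinner a b" "hinner a (r *\<^sub>R b) = r *\<^sub>R hinner a b"
    by (simp_all add: scaleR_eq_smult hinner_sums scaleR_conv_of_real)
next
  have "norm (hinner a b) \<le> norm a * norm b * real CARD('n)" for a b :: "complex^'n"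
    using norm_hinner_le[of a b] by (simp add: mult_ac)
  then show "\<exists>K. \<forall>a b :: complex^'n. norm (hinner a b) \<le> norm a * norm b * K" by blast
qed

lemmas continuous_on_hinner[continuous_intros] = bounded_bilinear.continuous_on[OF hinner_bounded_bilinear]

lemma matrix_vector_mult_bounded_bilinear:
  "bounded_bilinear ((*v) :: 'a::real_normed_field^'n::finite^'m::finite \<Rightarrow> _)"
proof
  fix A A' :: "'a^'n^'m" and b b' :: "'a^'n" and r :: real
  show "(A + A') *v b = A *v b + A' *v b" by (simp add: matrix_vector_mult_add_rdistrib)
  show "A *v (b + b') = A *v b + A *v b'" by (simp add: matrix_vector_right_distrib)
  show "(r *\<^sub>R A) *v b = r *\<^sub>R (A *v b)" "A *v (r *\<^sub>R b) = r *\<^sub>R (A *v b)"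
    by (simp_all add: vec_eq_iff matrix_vector_mult_def scaleR_sum_right)
next
  have "norm (A *v b) \<le> norm A * norm b * (real CARD('m) * real CARD('n))" for A :: "'a^'n^'m" and b :: "'a^'n"
  proof -
    have "norm (A *v b) \<le> (\<Sum>i\<in>UNIV. norm ((A *v b) $ i))" by (simp add: norm_vec_def L2_set_le_sum)
    also have "\<dots> \<le> (\<Sum>i\<in>(UNIV::'m set). \<Sum>j\<in>(UNIV::'n set). norm A * norm b)"
    proof (rule sum_mono)
      fix i
      have "norm ((A *v b) $ i) \<le> (\<Sum>j\<in>UNIV. norm (A $ i $ j * b $ j))"
        by (simp add: matrix_vector_mult_def norm_sum)
      also have "\<dots> \<le> (\<Sum>j\<in>(UNIV::'n set). norm A * norm b)"
      proof (rule sum_mono)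
        fix j
        have "norm (A $ i $ j) \<le> norm A"
          using Finite_Cartesian_Product.norm_nth_le[of "A $ i" j] Finite_Cartesian_Product.norm_nth_le[of A i] by linarith
        then show "norm (A $ i $ j * b $ j) \<le> norm A * norm b"
          by (auto simp: norm_mult intro!: mult_mono Finite_Cartesian_Product.norm_nth_le)
      qed
      finally show "norm ((A *v b) $ i) \<le> (\<Sum>j\<in>(UNIV::'n set). norm A * norm b)" .
    qed
    finally show ?thesis by (simp add: mult_ac)
  qed
  then show "\<exists>K. \<forall>(A :: 'a^'n^'m) b. norm (A *v b) \<le> norm A * norm b * K" by blast
qed

lemmas continuous_on_matrix_vector_mult[continuous_intros] =
  bounded_bilinear.continuous_on[OF matrix_vector_mult_bounded_bilinear]

lemma continuous_on_smult[continuous_intros]: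
  fixes f :: "'a::topological_space \<Rightarrow> complex^'n"
  assumes "continuous_on S f" shows "continuous_on S (\<lambda>t. c *s f t)"
  unfolding vector_scalar_mult_def by (intro continuous_intros assms)

lemma bounded_linear_smult: "bounded_linear (\<lambda>v::complex^'n::finite. c *s v)"
  unfolding linear_conv_bounded_linear[symmetric]
  by (rule linearI) (simp_all add: vector_ssub_ldistrib vec.scale_right_distrib scaleR_eq_smult mult.commute)

lemma has_vector_derivative_smult:
  fixes f :: "real \<Rightarrow> complex^'n::finite"
  assumes "(f has_vector_derivative f') F"
  shows "((\<lambda>t. c *s f t) has_vector_derivative c *s f') F"
  using bounded_linear.has_vector_derivative[OF bounded_linear_smult assms] .

section \<open>Calculus of continuously differentiable paths on [0,T]\<close>

lemma C1_path_has_vector_derivative: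
  assumes "C1_path T f" "t \<in> {0..T}"
  shows "(f has_vector_derivative dot T f t) (at t within {0..T})"
  using assms unfolding C1_path_def dot_def differentiable_on_def
  by (simp add: vector_derivative_works)

lemma dot_unique:
  assumes "(f has_vector_derivative f') (at t within {0..T})" "0 < T" "t \<in> {0..T}"
  shows "dot T f t = f'"
  unfolding dot_def using assms vector_derivative_within_cbox[of 0 T t f f'] by simp

lemma C1_pathI:
  assumes "0 < T" "\<And>t. t \<in> {0..T} \<Longrightarrow> (f has_vector_derivative f' t) (at t within {0..T})"
    and "continuous_on {0..T} f'"
  shows "C1_path T f" and "\<And>t. t \<in> {0..T} \<Longrightarrow> dot T f t = f' t"
proof -
  show *: "dot T f t = f' t" if "t \<in> {0..T}" for t using dot_unique[OF assms(2)] assms(1) that by auto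
  have "continuous_on {0..T} (dot T f)" using assms(3) * continuous_on_cong[of "{0..T}" "{0..T}" "dot T f" f'] by simp
  then show "C1_path T f" unfolding C1_path_def differentiable_on_def
    using assms(2) unfolding has_vector_derivative_def differentiable_def by blast
qed

lemma C1_path_continuous:
  assumes "C1_path T f" shows "continuous_on {0..T} f" "continuous_on {0..T} (dot T f)"
  using assms unfolding C1_path_def by (auto simp: differentiable_imp_continuous_on)

lemma C1_path_add:
  assumes "0 < T" "C1_path T f" "C1_path T g"
  shows "C1_path T (\<lambda>t. f t + g t)" and "\<And>t. t \<in> {0..T} \<Longrightarrow> dot T (\<lambda>t. f t + g t) t = dot T f t + dot T g t"
proof -
  have *: "\<And>t. t \<in> {0..T} \<Longrightarrow> ((\<lambda>t. f t + g t) has_vector_derivative dot T f t + dot T g t) (at t within {0..T})"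
    by (intro has_vector_derivative_add C1_path_has_vector_derivative assms)
  have c: "continuous_on {0..T} (\<lambda>t. dot T f t + dot T g t)"
    by (intro continuous_intros C1_path_continuous assms)
  show "C1_path T (\<lambda>t. f t + g t)" and "\<And>t. t \<in> {0..T} \<Longrightarrow> dot T (\<lambda>t. f t + g t) t = dot T f t + dot T g t"
    using C1_pathI[OF assms(1) * c] by auto
qed

lemma C1_path_smult:
  fixes f :: "real \<Rightarrow> complex^'n::finite"
  assumes "0 < T" "C1_path T f"
  shows "C1_path T (\<lambda>t. c *s f t)" and "\<And>t. t \<in> {0..T} \<Longrightarrow> dot T (\<lambda>t. c *s f t) t = c *s dot T f t"
proof -
  have *: "\<And>t. t \<in> {0..T} \<Longrightarrow> ((\<lambda>t. c *s f t) has_vector_derivative c *s dot T f t) (at t within {0..T})"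
    by (intro has_vector_derivative_smult C1_path_has_vector_derivative assms)
  have c: "continuous_on {0..T} (\<lambda>t. c *s dot T f t)"
    by (intro continuous_intros C1_path_continuous assms)
  show "C1_path T (\<lambda>t. c *s f t)" and "\<And>t. t \<in> {0..T} \<Longrightarrow> dot T (\<lambda>t. c *s f t) t = c *s dot T f t"
    using C1_pathI[OF assms(1) * c] by auto
qed

section \<open>The quadratic form\<close>

lemma matrix_path_bounded:
  fixes A :: "real \<Rightarrow> complex^'n::finite^'m::finite"
  assumes "continuous_on {0..T} A"
  obtains \<kappa> where "\<kappa> > 0" "\<And>t (a :: complex^'n). t \<in> {0..T} \<Longrightarrow> norm (A t *v a) \<le> \<kappa> * norm a"
proof -
  obtain K where K: "K > 0" "\<And>(A :: complex^'n^'m) b. norm (A *v b) \<le> norm A * norm b * K"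
    using bounded_bilinear.pos_bounded[OF matrix_vector_mult_bounded_bilinear] by blast
  have "bounded (A ` {0..T})"
    using assms compact_Icc by (intro compact_imp_bounded compact_continuous_image)
  then obtain B where B: "B > 0" "\<And>t. t \<in> {0..T} \<Longrightarrow> norm (A t) \<le> B"
    unfolding bounded_pos by auto
  show thesis
  proof (rule that[of "B * K"])
    fix t and a :: "complex^'n" assume "t \<in> {0..T}"
    then have "norm (A t) * norm a * K \<le> B * norm a * K"
      using B K by (intro mult_right_mono) auto
    then show "norm (A t *v a) \<le> B * K * norm a" using K(2)[of "A t" a] by (simp add: mult_ac)
  qed (use B K in auto)
qed

text \<open>Two products are kept. Orthogonality is Hermitian and uses \<open>hip\<close>; energy
  estimates and Rayleigh quotients are real and use its real part \<open>ip\<close>.\<close>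

definition hip :: "real \<Rightarrow> (real \<Rightarrow> complex^'n::finite) \<Rightarrow> (real \<Rightarrow> complex^'n) \<Rightarrow> complex" where
  "hip T f g = integral {0..T} (\<lambda>t. hinner (f t) (g t))"

definition ip :: "real \<Rightarrow> (real \<Rightarrow> 'a::euclidean_space) \<Rightarrow> (real \<Rightarrow> 'a) \<Rightarrow> real" where
  "ip T f g = integral {0..T} (\<lambda>t. f t \<bullet> g t)"

lemma Re_hip:
  assumes "continuous_on {0..T} f" "continuous_on {0..T} g"
  shows "Re (hip T f g) = ip T f g"
proof -
  have "((\<lambda>t. hinner (f t) (g t)) has_integral hip T f g) {0..T}"
    unfolding hip_def by (intro integrable_integral integrable_continuous_interval continuous_intros assms)
  from has_integral_linear[OF this bounded_linear_Re] show ?thesis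
    unfolding ip_def by (simp add: o_def Re_hinner integral_unique)
qed

text \<open>If the integrand is not integrable, \<open>integral\<close> is 0 by default, so no
  continuity is asked for.\<close>

lemma ip_self_nonneg: "0 \<le> ip T f f"
  unfolding ip_def by (cases "(\<lambda>t. f t \<bullet> f t) integrable_on {0..T}") (auto simp: not_integrable_integral intro!: integral_nonneg)

lemma ip_commute: "ip T f g = ip T g f"
  by (simp add: ip_def inner_commute)

lemma hip_cnj: "cnj (hip T f g) = hip T g f"
  unfolding hip_def by (simp add: integral_cnj hinner_cnj)

lemma ip_self_0:
  assumes "0 < T" "continuous_on {0..T} f" "ip T f f = 0" "t \<in> {0..T}"
  shows "f t = 0"
proof -
  have "((\<lambda>t. f t \<bullet> f t) has_integral 0) (cbox 0 T)"
    using assms(3) unfolding ip_def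
    by (metis assms(2) box_real(2) continuous_on_inner integrable_continuous_interval integrable_integral)
  then have "f t \<bullet> f t = 0"
    using assms by (intro has_integral_0_cbox_imp_0[of 0 T "\<lambda>t. f t \<bullet> f t"]) (auto intro!: continuous_intros)
  then show ?thesis by simp
qed

text \<open>The derivative of \<open>(norm \<xi>)^2\<close> is at most
  \<open>\<epsilon> (norm \<xi>')^2 + (norm \<xi>)^2 / \<epsilon>\<close> in absolute value, and the
  minimum of \<open>(norm \<xi>)^2\<close> is at most its mean. The free \<epsilon> allows end
  values to be absorbed into a small part of the derivative term.\<close>

lemma trace_bound:
  fixes \<xi> :: "real \<Rightarrow> 'a::euclidean_space"
  assumes T: "0 < T" and C: "C1_path T \<xi>" and "\<epsilon> > 0" "t \<in> {0..T}"
  shows "(norm (\<xi> t))\<^sup>2 \<le> \<epsilon> * ip T (dot T \<xi>) (dot T \<xi>) + (1/\<epsilon> + 1/T) * ip T \<xi> \<xi>"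
proof -
  note cont = C1_path_continuous[OF C]
  define \<psi> where "\<psi> t = \<epsilon> * (dot T \<xi> t \<bullet> dot T \<xi> t) + (1/\<epsilon>) * (\<xi> t \<bullet> \<xi> t)" for t
  have c\<psi>: "continuous_on {0..T} \<psi>" unfolding \<psi>_def by (intro continuous_intros cont)
  have I: "integral {0..T} \<psi> = \<epsilon> * ip T (dot T \<xi>) (dot T \<xi>) + (1/\<epsilon>) * ip T \<xi> \<xi>"
    unfolding \<psi>_def ip_def
    by (subst integral_add) (auto intro!: integrable_continuous_interval continuous_intros cont simp del: times_divide_eq_left)
  have pt: "\<bar>2 * (\<xi> t \<bullet> dot T \<xi> t)\<bar> \<le> \<psi> t" for t
  proof -
    have "0 \<le> (sqrt \<epsilon> * norm (dot T \<xi> t) - norm (\<xi> t) / sqrt \<epsilon>)\<^sup>2" by simp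
    also have "\<dots> = \<psi> t - 2 * (norm (\<xi> t) * norm (dot T \<xi> t))"
      using \<open>\<epsilon> > 0\<close> by (simp add: \<psi>_def power2_diff power_mult_distrib power_divide dot_square_norm)
    finally show ?thesis using Cauchy_Schwarz_ineq2[of "\<xi> t" "dot T \<xi> t"] by linarith
  qed
  have diff: "\<bar>(norm (\<xi> b))\<^sup>2 - (norm (\<xi> a))\<^sup>2\<bar> \<le> integral {0..T} \<psi>" if "0 \<le> a" "a \<le> b" "b \<le> T" for a b
  proof -
    have sub: "{a..b} \<subseteq> {0..T}" using that by auto
    have "((\<lambda>t. 2 * (\<xi> t \<bullet> dot T \<xi> t)) has_integral \<xi> b \<bullet> \<xi> b - \<xi> a \<bullet> \<xi> a) {a..b}"
    proof (rule fundamental_theorem_of_calculus[OF that(2)])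
      fix s assume "s \<in> {a..b}"
      then have "(\<xi> has_vector_derivative dot T \<xi> s) (at s within {a..b})"
        using C1_path_has_vector_derivative[OF C, of s] sub has_vector_derivative_within_subset by blast
      then have "((\<lambda>t. \<xi> t \<bullet> \<xi> t) has_vector_derivative \<xi> s \<bullet> dot T \<xi> s + dot T \<xi> s \<bullet> \<xi> s) (at s within {a..b})"
        by (rule bounded_bilinear.has_vector_derivative[OF bounded_bilinear_inner]) fact
      then show "((\<lambda>t. \<xi> t \<bullet> \<xi> t) has_vector_derivative 2 * (\<xi> s \<bullet> dot T \<xi> s)) (at s within {a..b})"
        by (simp add: inner_commute)
    qed
    then have "\<bar>\<xi> b \<bullet> \<xi> b - \<xi> a \<bullet> \<xi> a\<bar> = norm (integral {a..b} (\<lambda>t. 2 * (\<xi> t \<bullet> dot T \<xi> t)))"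
      by (metis integral_unique real_norm_def)
    also have "\<dots> \<le> integral {a..b} \<psi>"
      using pt by (intro integral_norm_bound_integral)
        (auto intro!: integrable_continuous_interval continuous_intros continuous_on_subset[OF cont(1) sub]
           continuous_on_subset[OF cont(2) sub] continuous_on_subset[OF c\<psi> sub])
    also have "\<dots> \<le> integral {0..T} \<psi>"
    proof (rule integral_subset_le[OF sub])
      show "\<psi> integrable_on {a..b}" "\<psi> integrable_on {0..T}"
        by (auto intro!: integrable_continuous_interval continuous_on_subset[OF c\<psi> sub] c\<psi>)
      show "\<forall>t\<in>{0..T}. 0 \<le> \<psi> t" using pt by (metis abs_ge_zero order_trans)
    qed
    finally show ?thesis by (simp add: dot_square_norm)
  qed
  \<comment> \<open>A point where \<open>norm \<xi>\<close> is minimal; the value there is compared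
    with the mean over [0,T].\<close>
  obtain s where s: "s \<in> {0..T}" "\<And>r. r \<in> {0..T} \<Longrightarrow> (norm (\<xi> s))\<^sup>2 \<le> (norm (\<xi> r))\<^sup>2"
  proof -
    have "continuous_on {0..T} (\<lambda>r. (norm (\<xi> r))\<^sup>2)" by (intro continuous_intros cont)
    then have "\<exists>s\<in>{0..T}. \<forall>r\<in>{0..T}. (norm (\<xi> s))\<^sup>2 \<le> (norm (\<xi> r))\<^sup>2"
      using T by (intro continuous_attains_inf) auto
    then show thesis using that by blast
  qed
  have "integral {0..T} (\<lambda>r. (norm (\<xi> s))\<^sup>2) \<le> ip T \<xi> \<xi>"
    unfolding ip_def using s
    by (intro integral_le) (auto intro!: integrable_continuous_interval continuous_intros cont simp: dot_square_norm)
  then have "(norm (\<xi> s))\<^sup>2 \<le> ip T \<xi> \<xi> / T" using T by (simp add: field_simps)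
  moreover have "(norm (\<xi> t))\<^sup>2 - (norm (\<xi> s))\<^sup>2 \<le> integral {0..T} \<psi>"
    using diff[of s t] diff[of t s] s \<open>t \<in> _\<close> by (cases "s \<le> t") auto
  ultimately show ?thesis unfolding I by (simp add: algebra_simps)
qed

text \<open>The coefficients keep only their Hermitian symmetries and a uniform ellipticity constant
  \<open>p0\<close>; \<open>Q'\<close> is the pointwise adjoint of \<open>Q\<close>. They are merely
  continuous, as they are for a Lagrangian of class C2.\<close>

locale sturm =
  fixes T :: real and P Q Q' R :: "real \<Rightarrow> complex^'n::finite^'n" and p0 :: real
  assumes T: "0 < T"
    and contP: "continuous_on {0..T} P" and contQ: "continuous_on {0..T} Q"
    and contQ': "continuous_on {0..T} Q'" and contR: "continuous_on {0..T} R"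
    and P_sym: "t \<in> {0..T} \<Longrightarrow> hinner (P t *v a) b = hinner a (P t *v b)"
    and Q_adj: "t \<in> {0..T} \<Longrightarrow> hinner (Q t *v a) b = hinner a (Q' t *v b)"
    and R_sym: "t \<in> {0..T} \<Longrightarrow> hinner (R t *v a) b = hinner a (R t *v b)"
    and p0: "0 < p0"
    and P_pos: "t \<in> {0..T} \<Longrightarrow> p0 * (norm a)\<^sup>2 \<le> (P t *v a) \<bullet> a"
begin

definition mom :: "(real \<Rightarrow> complex^'n) \<Rightarrow> real \<Rightarrow> complex^'n" where
  "mom \<xi> t = P t *v dot T \<xi> t + Q t *v \<xi> t"

text \<open>For the quadratic Lagrangian \<open>(P v, v)/2 + (Q u, v) + (R u, u)/2\<close>, the
  gradients in v and in u at \<open>(\<xi>, \<xi>')\<close> are \<open>mom \<xi>\<close> and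
  \<open>low \<xi>\<close>.\<close>

definition low :: "(real \<Rightarrow> complex^'n) \<Rightarrow> real \<Rightarrow> complex^'n" where
  "low \<xi> t = Q' t *v dot T \<xi> t + R t *v \<xi> t"

text \<open>
  The equation \<open>\<A>\<xi> = h\<close> in classical form: for continuous \<open>h\<close> the momentum is continuously
  differentiable, although \<open>\<xi>'\<close> need not be.
\<close>

definition sol :: "(real \<Rightarrow> complex^'n) \<Rightarrow> (real \<Rightarrow> complex^'n) \<Rightarrow> bool" where
  "sol \<xi> h \<longleftrightarrow> C1_path T \<xi> \<and>
     (\<forall>t\<in>{0..T}. (mom \<xi> has_vector_derivative low \<xi> t - h t) (at t within {0..T}))"

definition bd :: "(real \<Rightarrow> complex^'n) \<Rightarrow> 'n c4n" where
  "bd \<xi> = ((mom \<xi> 0, \<xi> 0), (mom \<xi> T, \<xi> T))"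

text \<open>The form contains no boundary contribution, so it makes sense for every C1 path;
  boundary conditions enter through Green's formula.\<close>

definition qf :: "(real \<Rightarrow> complex^'n) \<Rightarrow> (real \<Rightarrow> complex^'n) \<Rightarrow> real" where
  "qf \<xi> \<zeta> = integral {0..T} (\<lambda>t. mom \<xi> t \<bullet> dot T \<zeta> t + low \<xi> t \<bullet> \<zeta> t)"

lemma continuous_mom: "C1_path T \<xi> \<Longrightarrow> continuous_on {0..T} (mom \<xi>)"
  unfolding mom_def by (intro continuous_intros contP contQ C1_path_continuous)

lemma continuous_low: "C1_path T \<xi> \<Longrightarrow> continuous_on {0..T} (low \<xi>)"
  unfolding low_def by (intro continuous_intros contQ' contR C1_path_continuous)

lemma mom_add:
  assumes "C1_path T f" "C1_path T g" "t \<in> {0..T}"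
  shows "mom (\<lambda>t. f t + g t) t = mom f t + mom g t" "low (\<lambda>t. f t + g t) t = low f t + low g t"
  using assms by (simp_all add: mom_def low_def C1_path_add[OF T] matrix_vector_right_distrib)

lemma mom_smult:
  assumes "C1_path T f" "t \<in> {0..T}"
  shows "mom (\<lambda>t. c *s f t) t = c *s mom f t" "low (\<lambda>t. c *s f t) t = c *s low f t"
  using assms by (simp_all add: mom_def low_def C1_path_smult[OF T] vector_scalar_commute[symmetric]
    vec.scale_right_distrib)

lemma sol_add:
  assumes "sol f h" "sol g k"
  shows "sol (\<lambda>t. f t + g t) (\<lambda>t. h t + k t)"
  unfolding sol_def
proof (intro conjI ballI)
  have C: "C1_path T f" "C1_path T g" using assms by (auto simp: sol_def)
  show "C1_path T (\<lambda>t. f t + g t)" using C1_path_add[OF T C] by auto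
  fix t assume t: "t \<in> {0..T}"
  have "((\<lambda>t. mom f t + mom g t) has_vector_derivative (low f t - h t) + (low g t - k t)) (at t within {0..T})"
    using assms t by (intro has_vector_derivative_add) (auto simp: sol_def)
  then show "(mom (\<lambda>t. f t + g t) has_vector_derivative low (\<lambda>t. f t + g t) t - (h t + k t)) (at t within {0..T})"
    using has_vector_derivative_transform[OF t, of "mom (\<lambda>t. f t + g t)" "\<lambda>t. mom f t + mom g t"] mom_add[OF C] t
    by (simp add: algebra_simps)
qed

lemma sol_smult:
  assumes "sol f h"
  shows "sol (\<lambda>t. c *s f t) (\<lambda>t. c *s h t)"
  unfolding sol_def
proof (intro conjI ballI)
  have C: "C1_path T f" using assms by (auto simp: sol_def)
  show "C1_path T (\<lambda>t. c *s f t)" using C1_path_smult[OF T C] by auto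
  fix t assume t: "t \<in> {0..T}"
  have "((\<lambda>t. c *s mom f t) has_vector_derivative c *s (low f t - h t)) (at t within {0..T})"
    using assms t by (intro has_vector_derivative_smult) (auto simp: sol_def)
  then show "(mom (\<lambda>t. c *s f t) has_vector_derivative low (\<lambda>t. c *s f t) t - c *s h t) (at t within {0..T})"
    using has_vector_derivative_transform[OF t, of "mom (\<lambda>t. c *s f t)" "\<lambda>t. c *s mom f t"] mom_smult[OF C] t
    by (simp add: vec.scale_right_diff_distrib)
qed

lemma bd_add: "\<lbrakk>C1_path T f; C1_path T g\<rbrakk> \<Longrightarrow> bd (\<lambda>t. f t + g t) = bd f + bd g"
  using T by (simp add: bd_def mom_add)

lemma bd_smult: "C1_path T f \<Longrightarrow> bd (\<lambda>t. c *s f t) = c4n.scale c (bd f)"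
  using T by (simp add: bd_def mom_smult c4n.scale_def c2n.scale_def)

text \<open>Integrate the derivative of \<open>mom \<xi> \<bullet> \<zeta>\<close>. Only the
  momentum of \<xi> has to be differentiable, and \<zeta> may be any C1 path, whatever its end
  values.\<close>

lemma qf_green:
  assumes S: "sol \<xi> h" and h: "continuous_on {0..T} h" and Z: "C1_path T \<zeta>"
  shows "qf \<xi> \<zeta> = ip T h \<zeta> + (mom \<xi> T \<bullet> \<zeta> T - mom \<xi> 0 \<bullet> \<zeta> 0)"
proof -
  have X: "C1_path T \<xi>" using S by (simp add: sol_def)
  have "((\<lambda>t. mom \<xi> t \<bullet> dot T \<zeta> t + (low \<xi> t - h t) \<bullet> \<zeta> t) has_integral mom \<xi> T \<bullet> \<zeta> T - mom \<xi> 0 \<bullet> \<zeta> 0) {0..T}"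
  proof (rule fundamental_theorem_of_calculus)
    fix t assume t: "t \<in> {0..T}"
    show "((\<lambda>t. mom \<xi> t \<bullet> \<zeta> t) has_vector_derivative mom \<xi> t \<bullet> dot T \<zeta> t + (low \<xi> t - h t) \<bullet> \<zeta> t) (at t within {0..T})"
      using S t C1_path_has_vector_derivative[OF Z t]
      by (intro bounded_bilinear.has_vector_derivative[OF bounded_bilinear_inner]) (auto simp: sol_def)
  qed (use T in auto)
  moreover have "((\<lambda>t. h t \<bullet> \<zeta> t) has_integral ip T h \<zeta>) {0..T}"
    unfolding ip_def by (intro integrable_integral integrable_continuous_interval continuous_intros h C1_path_continuous Z)
  ultimately have "((\<lambda>t. mom \<xi> t \<bullet> dot T \<zeta> t + (low \<xi> t - h t) \<bullet> \<zeta> t + h t \<bullet> \<zeta> t) has_integral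
     (mom \<xi> T \<bullet> \<zeta> T - mom \<xi> 0 \<bullet> \<zeta> 0) + ip T h \<zeta>) {0..T}" by (rule has_integral_add)
  then show ?thesis unfolding qf_def by (simp add: inner_diff_left integral_unique)
qed

text \<open>Lagrange's identity: \<open>?F\<close> is \<open>omega\<close> of the two phase curves
  (momentum, position), and in its derivative all terms with \<open>P\<close>, \<open>Q\<close>,
  \<open>R\<close> cancel by symmetry. Evaluation at \<open>T\<close> minus evaluation at 0 produces
  the signs of \<open>Omega\<close>.\<close>

lemma hip_green:
  assumes S: "sol \<xi> h" and h: "continuous_on {0..T} h" and S2: "sol \<eta> k" and k: "continuous_on {0..T} k"
  shows "hip T \<xi> k - hip T h \<eta> = Omega (bd \<xi>) (bd \<eta>)"
proof -
  have X: "C1_path T \<xi>" "C1_path T \<eta>" using S S2 by (simp_all add: sol_def)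
  let ?F = "\<lambda>t. hinner (mom \<xi> t) (\<eta> t) - hinner (\<xi> t) (mom \<eta> t)"
  have "((\<lambda>t. hinner (\<xi> t) (k t) - hinner (h t) (\<eta> t)) has_integral ?F T - ?F 0) {0..T}"
  proof (rule fundamental_theorem_of_calculus)
    fix t assume t: "t \<in> {0..T}"
    have "(?F has_vector_derivative
        (hinner (mom \<xi> t) (dot T \<eta> t) + hinner (low \<xi> t - h t) (\<eta> t)) -
        (hinner (\<xi> t) (low \<eta> t - k t) + hinner (dot T \<xi> t) (mom \<eta> t))) (at t within {0..T})"
      using S S2 t C1_path_has_vector_derivative[OF X(1) t] C1_path_has_vector_derivative[OF X(2) t]
      by (intro has_vector_derivative_diff bounded_bilinear.has_vector_derivative[OF hinner_bounded_bilinear])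
         (auto simp: sol_def)
    moreover have "hinner (Q' t *v a) b = hinner a (Q t *v b)" for a b
      by (metis Q_adj hinner_cnj t)
    ultimately show "(?F has_vector_derivative hinner (\<xi> t) (k t) - hinner (h t) (\<eta> t)) (at t within {0..T})"
      by (simp add: mom_def low_def hinner_sums P_sym[OF t] Q_adj[OF t] R_sym[OF t])
  qed (use T in auto)
  moreover have "((\<lambda>t. hinner (\<xi> t) (k t) - hinner (h t) (\<eta> t)) has_integral hip T \<xi> k - hip T h \<eta>) {0..T}"
    unfolding hip_def
    by (intro has_integral_diff integrable_integral integrable_continuous_interval continuous_intros h k C1_path_continuous X)
  ultimately have "hip T \<xi> k - hip T h \<eta> = ?F T - ?F 0"
    using has_integral_unique by blast
  then show ?thesis
    by (simp add: Omega_def omega_def hinner2_def J_def bd_def hinner_sums)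
qed

lemma qf_commute:
  assumes "C1_path T \<xi>" "C1_path T \<zeta>"
  shows "qf \<xi> \<zeta> = qf \<zeta> \<xi>"
  unfolding qf_def
proof (rule integral_cong)
  fix t assume t: "t \<in> {0..T}"
  have 1: "(P t *v a) \<bullet> b = (P t *v b) \<bullet> a" and 2: "(R t *v a) \<bullet> b = (R t *v b) \<bullet> a"
    and 3: "(Q t *v a) \<bullet> b = (Q' t *v b) \<bullet> a" for a b
    by (metis P_sym[OF t] R_sym[OF t] Q_adj[OF t] Re_hinner inner_commute)+
  show "mom \<xi> t \<bullet> dot T \<zeta> t + low \<xi> t \<bullet> \<zeta> t = mom \<zeta> t \<bullet> dot T \<xi> t + low \<zeta> t \<bullet> \<xi> t"
    by (simp add: mom_def low_def inner_add_left 3)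
       (simp add: 1[of "dot T \<xi> t"] 2[of "\<xi> t"])
qed

lemma qf_add_scaled:
  fixes s :: real and \<xi> \<zeta> :: "real \<Rightarrow> complex^'n"
  assumes X: "C1_path T \<xi>" "C1_path T \<zeta>"
  defines "\<eta> \<equiv> \<lambda>t. complex_of_real s *s \<xi> t + \<zeta> t"
  shows "qf \<eta> \<eta> = s\<^sup>2 * qf \<xi> \<xi> + 2 * s * qf \<xi> \<zeta> + qf \<zeta> \<zeta>"
proof -
  have X': "C1_path T (\<lambda>t. complex_of_real s *s \<xi> t)" using C1_path_smult[OF T X(1)] by auto
  have "qf \<eta> \<eta> = integral {0..T} (\<lambda>t. s\<^sup>2 * (mom \<xi> t \<bullet> dot T \<xi> t + low \<xi> t \<bullet> \<xi> t) +
     s * (mom \<xi> t \<bullet> dot T \<zeta> t + low \<xi> t \<bullet> \<zeta> t) + s * (mom \<zeta> t \<bullet> dot T \<xi> t + low \<zeta> t \<bullet> \<xi> t) +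
     (mom \<zeta> t \<bullet> dot T \<zeta> t + low \<zeta> t \<bullet> \<zeta> t))"
    unfolding qf_def
  proof (rule integral_cong)
    fix t assume t: "t \<in> {0..T}"
    have e: "mom \<eta> t = s *\<^sub>R mom \<xi> t + mom \<zeta> t" "low \<eta> t = s *\<^sub>R low \<xi> t + low \<zeta> t"
      "dot T \<eta> t = s *\<^sub>R dot T \<xi> t + dot T \<zeta> t" "\<eta> t = s *\<^sub>R \<xi> t + \<zeta> t"
      unfolding \<eta>_def scaleR_eq_smult mom_add[OF X' X(2) t] mom_smult[OF X(1) t]
        C1_path_add(2)[OF T X' X(2) t] C1_path_smult(2)[OF T X(1) t] by (rule refl)+
    show "mom \<eta> t \<bullet> dot T \<eta> t + low \<eta> t \<bullet> \<eta> t = s\<^sup>2 * (mom \<xi> t \<bullet> dot T \<xi> t + low \<xi> t \<bullet> \<xi> t) +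
     s * (mom \<xi> t \<bullet> dot T \<zeta> t + low \<xi> t \<bullet> \<zeta> t) + s * (mom \<zeta> t \<bullet> dot T \<xi> t + low \<zeta> t \<bullet> \<xi> t) +
     (mom \<zeta> t \<bullet> dot T \<zeta> t + low \<zeta> t \<bullet> \<zeta> t)"
      by (simp add: e inner_add_left inner_add_right power2_eq_square) (simp add: algebra_simps)
  qed
  also have "\<dots> = s\<^sup>2 * qf \<xi> \<xi> + s * qf \<xi> \<zeta> + s * qf \<zeta> \<xi> + qf \<zeta> \<zeta>"
  proof (rule integral_unique)
    have *: "((\<lambda>t. mom f t \<bullet> dot T g t + low f t \<bullet> g t) has_integral qf f g) {0..T}" if "C1_path T f" "C1_path T g" for f g
      unfolding qf_def using that
      by (intro integrable_integral integrable_continuous_interval continuous_intros continuous_mom continuous_low C1_path_continuous)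
    show "((\<lambda>t. s\<^sup>2 * (mom \<xi> t \<bullet> dot T \<xi> t + low \<xi> t \<bullet> \<xi> t) +
     s * (mom \<xi> t \<bullet> dot T \<zeta> t + low \<xi> t \<bullet> \<zeta> t) + s * (mom \<zeta> t \<bullet> dot T \<xi> t + low \<zeta> t \<bullet> \<xi> t) +
     (mom \<zeta> t \<bullet> dot T \<zeta> t + low \<zeta> t \<bullet> \<zeta> t)) has_integral (s\<^sup>2 * qf \<xi> \<xi> + s * qf \<xi> \<zeta> + s * qf \<zeta> \<xi> + qf \<zeta> \<zeta>)) {0..T}"
      by (intro has_integral_add has_integral_mult_right * X)
  qed
  finally show ?thesis using qf_commute[OF X] by simp
qed

text \<open>Young's inequality for the cross term \<open>2 (Q \<xi>, \<xi>')\<close> costs a quarter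
  of \<open>p0\<close>, with \<open>k\<close> as its price in \<open>ip T \<xi> \<xi>\<close>; the
  end values cost another quarter by \<open>trace_bound\<close>. All multiples of
  \<open>ip T \<xi> \<xi>\<close> are collected in \<open>c\<close>. The term with \<open>C\<close>
  reserves room for the boundary form of a Lagrangian subspace.\<close>

lemma coercive:
  assumes "0 \<le> C"
  obtains c where "0 < c" "\<And>\<xi>. C1_path T \<xi> \<Longrightarrow>
    (p0/2) * ip T (dot T \<xi>) (dot T \<xi>) + ip T \<xi> \<xi> \<le> qf \<xi> \<xi> + c * ip T \<xi> \<xi> - C * ((norm (\<xi> 0))\<^sup>2 + (norm (\<xi> T))\<^sup>2)"
proof -
  obtain \<kappa>1 where k1: "\<kappa>1 > 0" "\<And>t a. t \<in> {0..T} \<Longrightarrow> norm (Q t *v a) \<le> \<kappa>1 * norm a" using matrix_path_bounded[OF contQ] by metis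
  obtain \<kappa>2 where k2: "\<kappa>2 > 0" "\<And>t a. t \<in> {0..T} \<Longrightarrow> norm (R t *v a) \<le> \<kappa>2 * norm a" using matrix_path_bounded[OF contR] by metis
  define k where "k = 4 * \<kappa>1\<^sup>2 / p0"
  \<comment> \<open>The denominator has \<open>C + 1\<close> rather than \<open>C\<close> so that
    \<epsilon> is positive also when \<open>C\<close> is 0.\<close>
  define \<epsilon> where "\<epsilon> = p0 / (8 * (C + 1))"
  have e: "\<epsilon> > 0" "2 * C * \<epsilon> \<le> p0/4" using p0 assms by (simp_all add: \<epsilon>_def field_simps)
  define c where "c = 1 + k + \<kappa>2 + 2 * C * (1/\<epsilon> + 1/T)"
  have "k \<ge> 0" using p0 by (simp add: k_def)
  then have c: "c > 0" unfolding c_def using k2 e T assms by (simp add: add_nonneg_nonneg add_pos_nonneg)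
  show thesis
  proof (rule that[OF c])
    fix \<xi> :: "real \<Rightarrow> complex^'n" assume X: "C1_path T \<xi>"
    note cont = C1_path_continuous[OF X]
    let ?D = "ip T (dot T \<xi>) (dot T \<xi>)" and ?M = "ip T \<xi> \<xi>"
    have "integral {0..T} (\<lambda>t. (3/4*p0) * (dot T \<xi> t \<bullet> dot T \<xi> t) + (- (k + \<kappa>2)) * (\<xi> t \<bullet> \<xi> t)) \<le> qf \<xi> \<xi>"
      unfolding qf_def
    proof (rule integral_le)
      fix t assume t: "t \<in> {0..T}"
      let ?a = "norm (dot T \<xi> t)" and ?b = "norm (\<xi> t)"
      have "(Q t *v a) \<bullet> b = (Q' t *v b) \<bullet> a" for a b
        by (metis Q_adj[OF t] Re_hinner inner_commute)
      then have eq: "mom \<xi> t \<bullet> dot T \<xi> t + low \<xi> t \<bullet> \<xi> t = (P t *v dot T \<xi> t) \<bullet> dot T \<xi> t + 2 * ((Q t *v \<xi> t) \<bullet> dot T \<xi> t) + (R t *v \<xi> t) \<bullet> \<xi> t"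
        by (simp add: mom_def low_def inner_add_left)
      have "\<bar>(Q t *v \<xi> t) \<bullet> dot T \<xi> t\<bar> \<le> norm (Q t *v \<xi> t) * ?a" by (rule Cauchy_Schwarz_ineq2)
      also have "\<dots> \<le> (\<kappa>1 * ?b) * ?a" using k1(2)[OF t] by (intro mult_right_mono) auto
      finally have q: "- ((Q t *v \<xi> t) \<bullet> dot T \<xi> t) \<le> \<kappa>1 * ?b * ?a" by linarith
      have "\<bar>(R t *v \<xi> t) \<bullet> \<xi> t\<bar> \<le> norm (R t *v \<xi> t) * ?b" by (rule Cauchy_Schwarz_ineq2)
      also have "\<dots> \<le> (\<kappa>2 * ?b) * ?b" using k2(2)[OF t] by (intro mult_right_mono) auto
      finally have r: "- ((R t *v \<xi> t) \<bullet> \<xi> t) \<le> \<kappa>2 * ?b\<^sup>2" by (simp add: power2_eq_square)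
      have "0 \<le> (p0/2 * ?a - 2 * \<kappa>1 * ?b)\<^sup>2 / p0" using p0 by simp
      also have "\<dots> = p0/4 * ?a\<^sup>2 + k * ?b\<^sup>2 - 2 * (\<kappa>1 * ?b * ?a)"
        using p0 by (simp add: k_def power2_eq_square field_simps)
      finally have am: "2 * (\<kappa>1 * ?b * ?a) \<le> p0/4 * ?a\<^sup>2 + k * ?b\<^sup>2" by simp
      show "(3/4*p0) * (dot T \<xi> t \<bullet> dot T \<xi> t) + (- (k + \<kappa>2)) * (\<xi> t \<bullet> \<xi> t) \<le> mom \<xi> t \<bullet> dot T \<xi> t + low \<xi> t \<bullet> \<xi> t"
        unfolding eq dot_square_norm using q r am P_pos[OF t, of "dot T \<xi> t"] by (simp add: algebra_simps)
    qed (auto intro!: integrable_continuous_interval continuous_intros cont continuous_mom continuous_low X)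
    also have "integral {0..T} (\<lambda>t. (3/4*p0) * (dot T \<xi> t \<bullet> dot T \<xi> t) + (- (k + \<kappa>2)) * (\<xi> t \<bullet> \<xi> t))
       = 3/4*p0 * ?D - (k + \<kappa>2) * ?M"
    proof -
      have "((\<lambda>t. (3/4*p0) * (dot T \<xi> t \<bullet> dot T \<xi> t) + (- (k + \<kappa>2)) * (\<xi> t \<bullet> \<xi> t)) has_integral
          (3/4*p0) * ?D + (- (k + \<kappa>2)) * ?M) {0..T}"
        unfolding ip_def
        by (intro has_integral_add has_integral_mult_right integrable_integral integrable_continuous_interval continuous_intros cont)
      then show ?thesis by (simp add: integral_unique left_diff_distrib distrib_right)
    qed
    finally have 1: "3/4*p0 * ?D - (k + \<kappa>2) * ?M \<le> qf \<xi> \<xi>" .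
    have "(norm (\<xi> 0))\<^sup>2 + (norm (\<xi> T))\<^sup>2 \<le> 2 * (\<epsilon> * ?D + (1/\<epsilon> + 1/T) * ?M)"
      using trace_bound[OF T X e(1), of 0] trace_bound[OF T X e(1), of T] T by simp
    then have "C * ((norm (\<xi> 0))\<^sup>2 + (norm (\<xi> T))\<^sup>2) \<le> C * (2 * (\<epsilon> * ?D + (1/\<epsilon> + 1/T) * ?M))"
      using assms by (rule mult_left_mono)
    also have "\<dots> = (2 * C * \<epsilon>) * ?D + 2 * C * (1/\<epsilon> + 1/T) * ?M" by (simp add: algebra_simps)
    also have "\<dots> \<le> (p0/4) * ?D + 2 * C * (1/\<epsilon> + 1/T) * ?M"
      using e(2) ip_self_nonneg by (intro add_right_mono mult_right_mono) auto
    finally show "(p0/2) * ?D + ?M \<le> qf \<xi> \<xi> + c * ?M - C * ((norm (\<xi> 0))\<^sup>2 + (norm (\<xi> T))\<^sup>2)"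
      using 1 by (simp add: c_def algebra_simps)
  qed
qed

end

section \<open>Linear differential equations\<close>

text \<open>
  In the unknown \<open>u(t) = exp (-K t) z(t)\<close> the Picard operator is a contraction on all of \<open>[0,T]\<close>.
\<close>

lemma lipschitz_ode_exists:
  fixes f :: "real \<Rightarrow> 'a::banach \<Rightarrow> 'a"
  assumes T: "0 \<le> T"
    and lip: "\<And>t x y. t \<in> {0..T} \<Longrightarrow> norm (f t x - f t y) \<le> B * norm (x - y)"
    and cont: "\<And>z. continuous_on {0..T} z \<Longrightarrow> continuous_on {0..T} (\<lambda>t. f t (z t))"
  shows "\<exists>z. z 0 = z0 \<and> (\<forall>t\<in>{0..T}. (z has_vector_derivative f t (z t)) (at t within {0..T}))"
proof -
  \<comment> \<open>The contraction factor is \<open>\<bar>B\<bar> / K\<close>, at most 1/2; the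
    summand 1 keeps \<open>K\<close> positive when \<open>B\<close> is 0.\<close>
  define K where "K = 2 * \<bar>B\<bar> + 1"
  have K: "K > 0" "2 * \<bar>B\<bar> \<le> K" unfolding K_def by auto
  define h where "h u t = exp (- K * t) *\<^sub>R (z0 + integral {0..t} (\<lambda>s. f s (exp (K * s) *\<^sub>R u s)))" for u :: "real \<Rightarrow> 'a" and t
  have cf: "continuous_on {0..T} (\<lambda>s. f s (exp (K * s) *\<^sub>R u s))" if "continuous_on {0..T} u" for u
    by (intro cont continuous_intros that)
  have ch: "continuous_on (cbox 0 T) (h u)" if "continuous_on {0..T} u" for u
    unfolding h_def using cf[OF that]
    by (auto intro!: continuous_intros indefinite_integral_continuous_1 integrable_continuous_interval)
  \<comment> \<open>The fixed point is sought in the complete space of bounded continuous functions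
    on the whole line; \<open>clamp\<close> continues \<open>h u\<close> constantly beyond
    [0,T].\<close>
  have "\<exists>g :: real \<Rightarrow>\<^sub>C 'a. \<forall>t. g t = h u (clamp 0 T t)" for u :: "real \<Rightarrow>\<^sub>C 'a"
    by (rule continuous_on_cbox_bcontfunE[OF ch[of u]]) (simp, blast)
  then obtain G :: "(real \<Rightarrow>\<^sub>C 'a) \<Rightarrow> (real \<Rightarrow>\<^sub>C 'a)" where G: "\<And>u t. apply_bcontfun (G u) t = h (apply_bcontfun u) (clamp 0 T t)"
    using choice[of "\<lambda>u g. \<forall>t. apply_bcontfun g t = h (apply_bcontfun u) (clamp 0 T t)"] by blast
  have lipG: "dist (G u) (G v) \<le> (1/2) * dist u v" for u v
  proof (rule dist_bound)
    fix t
    define \<tau> where "\<tau> = clamp 0 T t"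
    have \<tau>: "\<tau> \<in> {0..T}" using clamp_in_interval[of 0 T t] T by (simp add: \<tau>_def)
    define d where "d s = f s (exp (K * s) *\<^sub>R u s) - f s (exp (K * s) *\<^sub>R v s)" for s
    have cu: "continuous_on {0..\<tau>} (\<lambda>s. f s (exp (K * s) *\<^sub>R w s))" for w :: "real \<Rightarrow>\<^sub>C 'a"
      using \<tau> by (intro continuous_on_subset[OF cf]) auto
    have I: "((\<lambda>s. \<bar>B\<bar> * dist u v * exp (K * s)) has_integral \<bar>B\<bar> * dist u v * ((exp (K * \<tau>) - exp (K * 0)) / K)) {0..\<tau>}"
    proof -
      have "((\<lambda>s. exp (K * s)) has_integral (exp (K * \<tau>) / K - exp (K * 0) / K)) {0..\<tau>}"
        using \<tau> K by (intro fundamental_theorem_of_calculus)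
          (auto intro!: derivative_eq_intros simp flip: has_real_derivative_iff_has_vector_derivative)
      then show ?thesis by (simp add: has_integral_mult_right diff_divide_distrib)
    qed
    have "norm (integral {0..\<tau>} d) \<le> integral {0..\<tau>} (\<lambda>s. \<bar>B\<bar> * dist u v * exp (K * s))"
    proof (rule integral_norm_bound_integral)
      show "d integrable_on {0..\<tau>}" unfolding d_def
        by (intro integrable_continuous_interval continuous_intros cu)
      show "(\<lambda>s. \<bar>B\<bar> * dist u v * exp (K * s)) integrable_on {0..\<tau>}" using I by blast
      fix s assume s: "s \<in> {0..\<tau>}"
      have "norm (d s) \<le> B * norm (exp (K * s) *\<^sub>R u s - exp (K * s) *\<^sub>R v s)"
        unfolding d_def using \<tau> s by (intro lip) auto
      also have "\<dots> \<le> \<bar>B\<bar> * (exp (K * s) * dist (u s) (v s))"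
        by (simp add: dist_norm mult_right_mono flip: scaleR_diff_right)
      also have "\<dots> \<le> \<bar>B\<bar> * (exp (K * s) * dist u v)"
        by (intro mult_left_mono dist_bounded) auto
      finally show "norm (d s) \<le> \<bar>B\<bar> * dist u v * exp (K * s)" by (simp add: mult_ac)
    qed
    also have "\<dots> = \<bar>B\<bar> * dist u v * ((exp (K * \<tau>) - 1) / K)"
      using integral_unique[OF I] by (simp only: mult_zero_right exp_zero)
    also have "\<dots> \<le> \<bar>B\<bar> * dist u v * (exp (K * \<tau>) / K)"
      using K by (intro mult_left_mono divide_right_mono) auto
    finally have n: "norm (integral {0..\<tau>} d) \<le> \<bar>B\<bar> * dist u v * (exp (K * \<tau>) / K)" .
    have "h u \<tau> - h v \<tau> = exp (- K * \<tau>) *\<^sub>R integral {0..\<tau>} d"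
      unfolding h_def d_def integral_diff[OF integrable_continuous_interval[OF cu] integrable_continuous_interval[OF cu]]
      by (simp add: algebra_simps)
    then have "dist (h u \<tau>) (h v \<tau>) = exp (- K * \<tau>) * norm (integral {0..\<tau>} d)"
      by (simp add: dist_norm)
    also have "\<dots> \<le> exp (- K * \<tau>) * (\<bar>B\<bar> * dist u v * (exp (K * \<tau>) / K))"
      using n by (intro mult_left_mono) auto
    also have "\<dots> = \<bar>B\<bar> / K * dist u v" by (simp add: exp_minus field_simps)
    also have "\<dots> \<le> (1/2) * dist u v"
      using K by (intro mult_right_mono) (auto simp: field_simps)
    finally show "dist (G u t) (G v t) \<le> (1/2) * dist u v" unfolding G \<tau>_def .
  qed
  then obtain u where u: "G u = u" using banach_fix_type[of "1/2" G] by auto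
  define z where "z t = exp (K * t) *\<^sub>R u t" for t
  have z: "z t = z0 + integral {0..t} (\<lambda>s. f s (z s))" if "t \<in> {0..T}" for t
  proof -
    have "u t = h u t" using G[of u t] u that by simp
    then have "z t = exp (K * t) *\<^sub>R h u t" unfolding z_def by simp
    also have "\<dots> = z0 + integral {0..t} (\<lambda>s. f s (z s))"
      by (simp add: h_def z_def flip: exp_add)
    finally show ?thesis .
  qed
  show ?thesis
  proof (intro exI[of _ z] conjI ballI)
    show "z 0 = z0" using z[of 0] T by simp
    fix t assume t: "t \<in> {0..T}"
    have "continuous_on {0..T} (\<lambda>s. f s (z s))" unfolding z_def by (rule cf) simp
    then have "((\<lambda>t. z0 + integral {0..t} (\<lambda>s. f s (z s))) has_vector_derivative 0 + f t (z t)) (at t within {0..T})"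
      by (intro has_vector_derivative_add has_vector_derivative_const integral_has_vector_derivative t)
    then show "(z has_vector_derivative f t (z t)) (at t within {0..T})"
      using has_vector_derivative_transform[OF t z] by auto
  qed
qed

text \<open>Gronwall's argument: the weighted squared distance
  \<open>exp (- 2 B t) (d t \<bullet> d t)\<close> starts at 0 and has nonpositive
  derivative.\<close>

lemma lipschitz_ode_unique:
  fixes f :: "real \<Rightarrow> 'a::real_inner \<Rightarrow> 'a"
  assumes lip: "\<And>t x y. t \<in> {0..T} \<Longrightarrow> norm (f t x - f t y) \<le> B * norm (x - y)"
    and z: "\<And>t. t \<in> {0..T} \<Longrightarrow> (z has_vector_derivative f t (z t)) (at t within {0..T})"
    and w: "\<And>t. t \<in> {0..T} \<Longrightarrow> (w has_vector_derivative f t (w t)) (at t within {0..T})"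
    and init: "z 0 = w 0" and t: "t \<in> {0..T}"
  shows "z t = w t"
proof -
  define d where "d t = z t - w t" for t
  define d' where "d' t = f t (z t) - f t (w t)" for t
  define \<phi> where "\<phi> t = exp (- 2 * B * t) * (d t \<bullet> d t)" for t
  define \<phi>' where "\<phi>' t = exp (- 2 * B * t) * (d t \<bullet> d' t + d' t \<bullet> d t) + (exp (- 2 * B * t) * (- 2 * B)) * (d t \<bullet> d t)" for t
  have "(\<phi>' has_integral \<phi> t - \<phi> 0) {0..t}"
  proof (rule fundamental_theorem_of_calculus)
    fix s assume s: "s \<in> {0..t}"
    then have sT: "s \<in> {0..T}" and sub: "{0..t} \<subseteq> {0..T}" using t by auto
    have 1: "(d has_vector_derivative d' s) (at s within {0..t})"
      unfolding d_def[abs_def] d'_def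
      by (intro has_vector_derivative_diff has_vector_derivative_within_subset[OF z[OF sT] sub]
        has_vector_derivative_within_subset[OF w[OF sT] sub])
    have 2: "((\<lambda>t. exp (- 2 * B * t)) has_vector_derivative exp (- 2 * B * s) * (- 2 * B)) (at s within {0..t})"
      unfolding has_real_derivative_iff_has_vector_derivative[symmetric]
      by (auto intro!: derivative_eq_intros)
    show "(\<phi> has_vector_derivative \<phi>' s) (at s within {0..t})"
      unfolding \<phi>_def[abs_def] \<phi>'_def
      by (intro bounded_bilinear.has_vector_derivative[OF bounded_bilinear_mult] 2
          bounded_bilinear.has_vector_derivative[OF bounded_bilinear_inner] 1)
  qed (use t in auto)
  moreover have "\<phi>' s \<le> 0" if "s \<in> {0..t}" for s
  proof -
    have "d s \<bullet> d' s \<le> norm (d s) * norm (d' s)" by (rule norm_cauchy_schwarz)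
    also have "\<dots> \<le> norm (d s) * (B * norm (d s))"
      unfolding d'_def d_def using that t by (intro mult_left_mono lip) auto
    finally have "d s \<bullet> d' s + d' s \<bullet> d s - 2 * B * (d s \<bullet> d s) \<le> 0"
      by (simp add: inner_commute dot_square_norm power2_eq_square mult.left_commute)
    then have "exp (- 2 * B * s) * (d s \<bullet> d' s + d' s \<bullet> d s - 2 * B * (d s \<bullet> d s)) \<le> 0"
      by (simp add: mult_le_0_iff)
    then show ?thesis by (simp add: \<phi>'_def algebra_simps)
  qed
  ultimately have "\<phi> t - \<phi> 0 \<le> 0" by (rule has_integral_le[OF _ has_integral_0]) auto
  then have "exp (- 2 * B * t) * (d t \<bullet> d t) \<le> 0" using init by (simp add: \<phi>_def d_def)
  then have "d t \<bullet> d t \<le> 0" by (simp add: mult_le_0_iff)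
  then have "d t = 0" using inner_ge_zero[of "d t"] by (metis antisym inner_eq_zero_iff)
  then show ?thesis by (simp add: d_def)
qed

text \<open>The boundary term of \<open>qf_green\<close> for \<zeta> = \<xi>, as a function of the
  boundary value \<open>bd \<xi>\<close>.\<close>

definition bform :: "'n::finite c4n \<Rightarrow> real" where
  "bform a = fst (snd a) \<bullet> snd (snd a) - fst (fst a) \<bullet> snd (fst a)"

lemma c4n_subspace_real:
  assumes "c4n.p.subspace \<Lambda>" shows "subspace \<Lambda>"
proof -
  have "r *\<^sub>R a = c4n.scale (complex_of_real r) a" for r and a :: "'a c4n"
    by (cases a rule: prod_cases3) (auto simp: c4n.scale_def c2n.scale_def scaleR_eq_smult)
  then show ?thesis
    using assms by (auto simp: subspace_def c4n.p.subspace_def)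
qed

text \<open>
  On a Lagrangian subspace the boundary term of the quadratic form is determined by the positions
  \<open>\<xi>(0)\<close>, \<open>\<xi>(T)\<close>, so a linear right inverse of the projection to the positions bounds it.
\<close>

lemma lagrangian_bform_bound:
  fixes \<Lambda> :: "'n::finite c4n set"
  assumes "lagrangian \<Lambda>"
  obtains C where "0 \<le> C" "\<And>a. a \<in> \<Lambda> \<Longrightarrow> bform a \<le> C * ((norm (snd (fst a)))\<^sup>2 + (norm (snd (snd a)))\<^sup>2)"
proof -
  define pr :: "'n c4n \<Rightarrow> 'n c2n" where "pr a = (snd (fst a), snd (snd a))" for a
  have sub: "subspace \<Lambda>" using assms by (simp add: lagrangian_def c4n_subspace_real)
  have "linear pr" unfolding pr_def by (rule linearI) auto
  from linear_exists_right_inverse_on[OF this sub]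
  obtain g where g: "range g \<subseteq> \<Lambda>" "linear g" "\<And>v. v \<in> pr ` \<Lambda> \<Longrightarrow> pr (g v) = v" by blast
  obtain K where K: "K > 0" "\<And>v. norm (g v) \<le> norm v * K"
    using bounded_linear.pos_bounded[of g] g(2) by (auto simp: linear_conv_bounded_linear)
  show thesis
  proof (rule that[of "2 * K"])
    fix a assume a: "a \<in> \<Lambda>"
    define a' where "a' = g (pr a)"
    have a': "a' \<in> \<Lambda>" "pr a' = pr a" using g a by (auto simp: a'_def)
    have eq: "snd (fst a') = snd (fst a)" "snd (snd a') = snd (snd a)" using a'(2) by (auto simp: pr_def)
    \<comment> \<open>As \<open>a - a'\<close> has zero positions, its \<open>Omega\<close>-product
      with \<open>a\<close> compares the momenta of \<open>a\<close> and \<open>a'\<close> against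
      their common positions; the real part is \<open>bform a - bform a'\<close>.\<close>
    have "Omega (a - a') a = 0"
      using assms a a' sub by (auto simp: lagrangian_def intro: subspace_diff)
    then have "Re (Omega (a - a') a) = 0" by simp
    then have "bform a = bform a'"
      by (simp add: Omega_def omega_def hinner2_def J_def eq hinner_sums bform_def Re_hinner)
    also have "\<dots> \<le> \<bar>fst (snd a') \<bullet> snd (snd a)\<bar> + \<bar>fst (fst a') \<bullet> snd (fst a)\<bar>"
      unfolding bform_def eq by linarith
    also have "\<dots> \<le> norm (g (pr a)) * norm (pr a) + norm (g (pr a)) * norm (pr a)"
    proof (intro add_mono order_trans[OF Cauchy_Schwarz_ineq2] mult_mono)
      show "norm (fst (snd a')) \<le> norm (g (pr a))" "norm (fst (fst a')) \<le> norm (g (pr a))"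
        unfolding a'_def[symmetric] by (metis norm_fst_le norm_snd_le order_trans prod.collapse)+
      show "norm (snd (snd a)) \<le> norm (pr a)" "norm (snd (fst a)) \<le> norm (pr a)"
        unfolding pr_def by (rule norm_snd_le norm_fst_le)+
    qed auto
    also have "\<dots> \<le> 2 * K * (norm (pr a))\<^sup>2"
      using mult_right_mono[OF K(2)[of "pr a"], of "norm (pr a)"] by (simp add: power2_eq_square algebra_simps)
    also have "(norm (pr a))\<^sup>2 = (norm (snd (fst a)))\<^sup>2 + (norm (snd (snd a)))\<^sup>2"
      by (simp add: pr_def norm_Pair)
    finally show "bform a \<le> 2 * K * ((norm (snd (fst a)))\<^sup>2 + (norm (snd (snd a)))\<^sup>2)" .
  qed (use K in auto)
qed

text \<open>A Lagrangian subspace has half the dimension of the doubled space, that is, the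
  dimension of the target. An injective linear map on it is therefore onto.\<close>

lemma lagrangian_image_UNIV:
  fixes \<Lambda> :: "'n::finite c4n set" and g :: "'n c4n \<Rightarrow> 'n c2n"
  assumes L: "lagrangian \<Lambda>" and lin: "Vector_Spaces.linear c4n.scale c2n.scale g"
    and inj: "\<And>a. a \<in> \<Lambda> \<Longrightarrow> g a = 0 \<Longrightarrow> a = 0"
  shows "g ` \<Lambda> = UNIV"
proof -
  interpret pr: finite_dimensional_vector_space_pair c4n.scale "c4n.Basis_pair" c2n.scale "c2n.Basis_pair"
    by unfold_locales
  interpret g: Vector_Spaces.linear c4n.scale c2n.scale g by (fact lin)
  have S: "c4n.p.subspace \<Lambda>" and D: "2 * c4n.p.dim \<Lambda> = c4n.p.dim (UNIV :: ('n c4n) set)"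
    using L by (auto simp: lagrangian_def)
  have "inj_on g \<Lambda>"
  proof (rule inj_onI)
    fix a b assume "a \<in> \<Lambda>" "b \<in> \<Lambda>" "g a = g b"
    then have "a - b \<in> \<Lambda>" "g (a - b) = 0" using c4n.p.subspace_diff[OF S] by (auto simp: g.diff)
    then have "a - b = 0" by (rule inj)
    then show "a = b" by simp
  qed
  then have "c2n.p.dim (g ` \<Lambda>) = c4n.p.dim \<Lambda>"
    using pr.dim_image_eq[OF lin, of \<Lambda>] S by (metis c4n.p.span_eq_iff)
  moreover have "c4n.p.dim (UNIV :: ('n c4n) set) = 2 * c2n.p.dim (UNIV :: ('n c2n) set)"
  proof -
    have "c4n.p.dim ((UNIV :: 'n c2n set) \<times> (UNIV :: 'n c2n set)) = c2n.p.dim (UNIV :: 'n c2n set) + c2n.p.dim (UNIV :: 'n c2n set)"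
      by (rule c4n.dim_Times[OF c2n.p.subspace_UNIV c2n.p.subspace_UNIV])
    then show ?thesis by (simp only: UNIV_Times_UNIV mult_2)
  qed
  ultimately have "c2n.p.dim (UNIV :: ('n c2n) set) \<le> c2n.p.dim (g ` \<Lambda>)" using D by simp
  then show ?thesis
    using c2n.p.subspace_dim_equal[OF g.subspace_image[OF S] c2n.p.subspace_UNIV] by simp
qed

section \<open>The boundary value problem\<close>

context sturm
begin

definition W :: "real \<Rightarrow> complex^'n \<Rightarrow> complex^'n" where
  "W t v = matrix_inv (P t) *v v"

lemma P_bound_below:
  assumes "t \<in> {0..T}" shows "p0 * norm a \<le> norm (P t *v a)"
proof (cases "a = 0")
  case False
  have "p0 * (norm a)\<^sup>2 \<le> norm (P t *v a) * norm a"
    using P_pos[OF assms, of a] norm_cauchy_schwarz[of "P t *v a" a] by linarith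
  then show ?thesis using False by (simp add: power2_eq_square)
qed simp

lemma P_W: assumes "t \<in> {0..T}" shows "P t *v W t v = v" and W_P: "W t (P t *v v) = v"
proof -
  have "inj ((*v) (P t))"
    unfolding vec.inj_iff_eq_0
  proof (intro allI impI)
    fix a assume "P t *v a = 0"
    then have "p0 * norm a \<le> 0" using P_bound_below[OF assms, of a] by simp
    then show "a = 0" using p0 by (simp add: mult_le_0_iff)
  qed
  then have "invertible (P t)"
    by (simp add: invertible_left_inverse matrix_left_invertible_injective)
  then have "P t ** matrix_inv (P t) = mat 1 \<and> matrix_inv (P t) ** P t = mat 1"
    unfolding matrix_inv_def invertible_def by (rule someI_ex)
  then show "P t *v W t v = v" "W t (P t *v v) = v"
    unfolding W_def by (simp_all add: matrix_vector_mul_assoc)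
qed

lemma W_bound: assumes "t \<in> {0..T}" shows "norm (W t v) \<le> norm v / p0"
  using P_bound_below[OF assms, of "W t v"] p0 P_W[OF assms, of v] by (simp add: field_simps)

lemma W_diff: "W t (a - b) = W t a - W t b"
  by (simp add: W_def matrix_vector_mult_diff_distrib)

text \<open>Write \<open>W t (g t) - W s (g s)\<close> as \<open>W t\<close> applied to
  \<open>?u t\<close>. The vector \<open>?u t\<close> tends to 0 as t tends to s, and
  \<open>W t\<close> is bounded by \<open>1 / p0\<close> uniformly in t.\<close>

lemma continuous_on_W:
  assumes g: "continuous_on {0..T} g"
  shows "continuous_on {0..T} (\<lambda>t. W t (g t))"
  unfolding continuous_on_def
proof
  fix s assume s: "s \<in> {0..T}"
  let ?u = "\<lambda>t. g t - P t *v W s (g s)"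
  have "continuous_on {0..T} ?u" by (intro continuous_intros contP g)
  then have "(?u \<longlongrightarrow> ?u s) (at s within {0..T})" using s by (simp add: continuous_on_def)
  then have "((\<lambda>t. norm (?u t) / p0) \<longlongrightarrow> norm (?u s) / p0) (at s within {0..T})"
    by (intro tendsto_divide tendsto_norm tendsto_const) (use p0 in auto)
  then have lim: "((\<lambda>t. norm (?u t) / p0) \<longlongrightarrow> 0) (at s within {0..T})" using P_W[OF s] by simp
  have "((\<lambda>t. W t (g t) - W s (g s)) \<longlongrightarrow> 0) (at s within {0..T})"
  proof (rule Lim_null_comparison[OF _ lim])
    have "norm (W t (g t) - W s (g s)) \<le> norm (?u t) / p0" if "t \<in> {0..T}" for t
    proof -
      have "W t (?u t) = W t (g t) - W s (g s)" by (simp add: W_diff W_P[OF that])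
      then show ?thesis using W_bound[OF that, of "?u t"] by simp
    qed
    then show "\<forall>\<^sub>F t in at s within {0..T}. norm (W t (g t) - W s (g s)) \<le> norm (?u t) / p0"
      by (auto simp: eventually_at_filter)
  qed
  then show "((\<lambda>t. W t (g t)) \<longlongrightarrow> W s (g s)) (at s within {0..T})" by (simp add: LIM_zero_iff)
qed

text \<open>
  The Hamiltonian form of \<open>(\<A> + c)\<xi> = F\<close> as a first-order system for \<open>z = (y, \<xi>)\<close>.
\<close>

definition rhs :: "real \<Rightarrow> (real \<Rightarrow> complex^'n) \<Rightarrow> real \<Rightarrow> 'n c2n \<Rightarrow> 'n c2n" where
  "rhs c F t z = (let w = W t (fst z - Q t *v snd z)
     in (Q' t *v w + R t *v snd z + c *\<^sub>R snd z - F t, w))"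

lemma rhs_lipschitz:
  obtains B where "\<And>t x y. t \<in> {0..T} \<Longrightarrow> norm (rhs c F t x - rhs c F t y) \<le> B * norm (x - y)"
proof -
  obtain k1 where k1: "k1 > 0" "\<And>t a. t \<in> {0..T} \<Longrightarrow> norm (Q t *v a) \<le> k1 * norm a" using matrix_path_bounded[OF contQ] by metis
  obtain k2 where k2: "k2 > 0" "\<And>t a. t \<in> {0..T} \<Longrightarrow> norm (R t *v a) \<le> k2 * norm a" using matrix_path_bounded[OF contR] by metis
  obtain k3 where k3: "k3 > 0" "\<And>t a. t \<in> {0..T} \<Longrightarrow> norm (Q' t *v a) \<le> k3 * norm a" using matrix_path_bounded[OF contQ'] by metis
  define k4 where "k4 = (1 + k1) / p0"
  show thesis
  proof (rule that[of "k3 * k4 + k2 + \<bar>c\<bar> + k4"])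
    fix t and x y :: "'n c2n" assume t: "t \<in> {0..T}"
    define d where "d = x - y"
    define w where "w = W t (fst d - Q t *v snd d)"
    have d: "norm (fst d) \<le> norm d" "norm (snd d) \<le> norm d" by (metis norm_fst_le norm_snd_le prod.collapse)+
    have "norm w \<le> norm (fst d - Q t *v snd d) / p0" unfolding w_def by (rule W_bound[OF t])
    also have "\<dots> \<le> (norm d + k1 * norm d) / p0"
    proof (rule divide_right_mono)
      have "norm (Q t *v snd d) \<le> k1 * norm d"
        using k1(2)[OF t, of "snd d"] mult_left_mono[OF d(2), of k1] k1(1) by linarith
      then show "norm (fst d - Q t *v snd d) \<le> norm d + k1 * norm d"
        using norm_triangle_ineq4[of "fst d" "Q t *v snd d"] d by linarith
    qed (use p0 in auto)
    finally have w: "norm w \<le> k4 * norm d" by (simp add: k4_def algebra_simps)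
    have "rhs c F t x - rhs c F t y = (Q' t *v w + R t *v snd d + c *\<^sub>R snd d, w)"
    proof -
      have w: "w = W t (fst x - Q t *v snd x) - W t (fst y - Q t *v snd y)"
        unfolding W_diff[symmetric] w_def d_def fst_diff snd_diff matrix_vector_mult_diff_distrib
        by (rule arg_cong[where f = "W t"]) simp
      show ?thesis
        unfolding w d_def rhs_def Let_def diff_Pair snd_diff matrix_vector_mult_diff_distrib
        by (simp add: scaleR_diff_right)
    qed
    then have "norm (rhs c F t x - rhs c F t y) \<le> norm (Q' t *v w + R t *v snd d + c *\<^sub>R snd d) + norm w"
      using norm_Pair_le by simp
    also have "norm (Q' t *v w + R t *v snd d + c *\<^sub>R snd d) \<le> norm (Q' t *v w) + norm (R t *v snd d) + norm (c *\<^sub>R snd d)"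
      using norm_triangle_ineq[of "Q' t *v w + R t *v snd d" "c *\<^sub>R snd d"] norm_triangle_ineq[of "Q' t *v w" "R t *v snd d"] by linarith
    also have "norm (Q' t *v w) \<le> k3 * (k4 * norm d)"
      using k3(2)[OF t, of w] mult_left_mono[OF w, of k3] k3(1) by linarith
    also have "norm (R t *v snd d) \<le> k2 * norm d"
      using k2(2)[OF t, of "snd d"] mult_left_mono[OF d(2), of k2] k2(1) by linarith
    also have "norm (c *\<^sub>R snd d) \<le> \<bar>c\<bar> * norm d" using d(2) by (simp add: mult_left_mono)
    also note w
    finally show "norm (rhs c F t x - rhs c F t y) \<le> (k3 * k4 + k2 + \<bar>c\<bar> + k4) * norm (x - y)"
      by (simp add: d_def algebra_simps)
  qed
qed

text \<open>
  The equation \<open>(\<A> + c)\<eta> = F\<close>.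
\<close>

definition shifted :: "real \<Rightarrow> (real \<Rightarrow> complex^'n) \<Rightarrow> (real \<Rightarrow> complex^'n) \<Rightarrow> bool" where
  "shifted c F \<eta> \<longleftrightarrow> sol \<eta> (\<lambda>t. F t - c *\<^sub>R \<eta> t)"

lemma shifted_rhs:
  assumes "shifted c F \<eta>" "t \<in> {0..T}"
  shows "((\<lambda>t. (mom \<eta> t, \<eta> t)) has_vector_derivative rhs c F t (mom \<eta> t, \<eta> t)) (at t within {0..T})"
proof -
  have "rhs c F t (mom \<eta> t, \<eta> t) = (low \<eta> t - (F t - c *\<^sub>R \<eta> t), dot T \<eta> t)"
    using W_P[OF assms(2)] by (simp add: rhs_def Let_def mom_def low_def)
  moreover have "(mom \<eta> has_vector_derivative low \<eta> t - (F t - c *\<^sub>R \<eta> t)) (at t within {0..T})"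
    and "(\<eta> has_vector_derivative dot T \<eta> t) (at t within {0..T})"
    using assms C1_path_has_vector_derivative[of T \<eta> t] by (auto simp: shifted_def sol_def)
  ultimately show ?thesis using has_vector_derivative_Pair by fastforce
qed

lemma shifted_unique:
  assumes "shifted c F \<eta>" "shifted c F \<eta>'" "fst (bd \<eta>) = fst (bd \<eta>')" "t \<in> {0..T}"
  shows "mom \<eta> t = mom \<eta>' t" "\<eta> t = \<eta>' t"
proof -
  obtain B where B: "\<And>t x y. t \<in> {0..T} \<Longrightarrow> norm (rhs c F t x - rhs c F t y) \<le> B * norm (x - y)"
    using rhs_lipschitz[of c F] by blast
  have "(mom \<eta> t, \<eta> t) = (mom \<eta>' t, \<eta>' t)"
    by (rule lipschitz_ode_unique[where f = "rhs c F" and T = T,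
      OF B shifted_rhs[OF assms(1)] shifted_rhs[OF assms(2)] _ assms(4)]) (use assms(3) in \<open>auto simp: bd_def\<close>)
  then show "mom \<eta> t = mom \<eta>' t" "\<eta> t = \<eta>' t" by auto
qed

text \<open>Solve the Hamiltonian system with initial value \<open>a\<close>. Since \<open>W\<close>
  inverts \<open>P\<close>, the first component of the solution is the momentum of the second, which
  is then cut off outside [0,T].\<close>

lemma shifted_exists:
  assumes F: "continuous_on {0..T} F"
  shows "\<exists>\<eta>. shifted c F \<eta> \<and> fst (bd \<eta>) = a \<and> (\<forall>t. t \<notin> {0..T} \<longrightarrow> \<eta> t = 0)"
proof -
  obtain B where B: "\<And>t x y. t \<in> {0..T} \<Longrightarrow> norm (rhs c F t x - rhs c F t y) \<le> B * norm (x - y)"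
    using rhs_lipschitz[of c F] by blast
  have cont: "continuous_on {0..T} (\<lambda>t. rhs c F t (z t))" if "continuous_on {0..T} z" for z
    unfolding rhs_def Let_def
    by (intro continuous_intros continuous_on_W contQ contQ' contR F that)
  obtain z where z: "z 0 = a" "\<And>t. t \<in> {0..T} \<Longrightarrow> (z has_vector_derivative rhs c F t (z t)) (at t within {0..T})"
    using lipschitz_ode_exists[where f = "rhs c F" and ?z0.0 = a, OF less_imp_le[OF T] B cont] by blast
  have cz: "continuous_on {0..T} z"
    using z(2) by (meson continuous_on_eq_continuous_within has_vector_derivative_continuous)
  define w where "w t = W t (fst (z t) - Q t *v snd (z t))" for t
  define \<eta> where "\<eta> t = (if t \<in> {0..T} then snd (z t) else 0)" for t
  have cw: "continuous_on {0..T} w"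
    unfolding w_def by (intro continuous_intros continuous_on_W contQ cz)
  have d\<eta>: "(\<eta> has_vector_derivative w t) (at t within {0..T})" if t: "t \<in> {0..T}" for t
  proof -
    have "((\<lambda>t. snd (z t)) has_vector_derivative snd (rhs c F t (z t))) (at t within {0..T})"
      using bounded_linear.has_vector_derivative[OF bounded_linear_snd z(2)[OF t]] .
    then have "((\<lambda>t. snd (z t)) has_vector_derivative w t) (at t within {0..T})"
      by (simp add: rhs_def w_def Let_def)
    then show ?thesis
      by (rule has_vector_derivative_transform[OF t, rotated]) (simp add: \<eta>_def)
  qed
  have C: "C1_path T \<eta>" "\<And>t. t \<in> {0..T} \<Longrightarrow> dot T \<eta> t = w t"
    using C1_pathI[OF T d\<eta> cw] by auto
  have mom: "mom \<eta> t = fst (z t)" if "t \<in> {0..T}" for t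
    unfolding mom_def C(2)[OF that] using that by (simp add: w_def P_W \<eta>_def)
  have "sol \<eta> (\<lambda>t. F t - c *\<^sub>R \<eta> t)"
    unfolding sol_def
  proof (intro conjI ballI C(1))
    fix t assume t: "t \<in> {0..T}"
    have "((\<lambda>t. fst (z t)) has_vector_derivative fst (rhs c F t (z t))) (at t within {0..T})"
      using bounded_linear.has_vector_derivative[OF bounded_linear_fst z(2)[OF t]] .
    moreover have "fst (rhs c F t (z t)) = low \<eta> t - (F t - c *\<^sub>R \<eta> t)"
      unfolding low_def C(2)[OF t] using t by (simp add: rhs_def w_def Let_def \<eta>_def)
    ultimately show "(mom \<eta> has_vector_derivative low \<eta> t - (F t - c *\<^sub>R \<eta> t)) (at t within {0..T})"
      using has_vector_derivative_transform[OF t mom, where f' = "fst (rhs c F t (z t))"] by simp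
  qed
  moreover have "fst (bd \<eta>) = a" using T mom[of 0] z(1) by (simp add: bd_def \<eta>_def)
  ultimately show ?thesis unfolding shifted_def by (intro exI[of _ \<eta>]) (auto simp: \<eta>_def)
qed

lemma shifted_add:
  "\<lbrakk>shifted c F \<eta>; shifted c G \<zeta>\<rbrakk> \<Longrightarrow> shifted c (\<lambda>t. F t + G t) (\<lambda>t. \<eta> t + \<zeta> t)"
  unfolding shifted_def using sol_add[of \<eta> "\<lambda>t. F t - c *\<^sub>R \<eta> t" \<zeta> "\<lambda>t. G t - c *\<^sub>R \<zeta> t"] by (simp add: algebra_simps)

lemma shifted_smult:
  "shifted c F \<eta> \<Longrightarrow> shifted c (\<lambda>t. r *s F t) (\<lambda>t. r *s \<eta> t)"
  unfolding shifted_def using sol_smult[of \<eta> "\<lambda>t. F t - c *\<^sub>R \<eta> t" r]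
  by (simp add: vec.scale_right_diff_distrib scaleR_eq_smult mult.commute)

lemma shifted_C1: "shifted c F \<eta> \<Longrightarrow> C1_path T \<eta>"
  by (simp add: shifted_def sol_def)

lemma shifted_energy:
  assumes S: "shifted c F \<eta>" and F: "continuous_on {0..T} F" and Z: "C1_path T \<zeta>"
  shows "qf \<eta> \<zeta> + c * ip T \<eta> \<zeta> = ip T F \<zeta> + (mom \<eta> T \<bullet> \<zeta> T - mom \<eta> 0 \<bullet> \<zeta> 0)"
proof -
  note X = C1_path_continuous[OF shifted_C1[OF S]] C1_path_continuous[OF Z]
  have "qf \<eta> \<zeta> = ip T (\<lambda>t. F t - c *\<^sub>R \<eta> t) \<zeta> + (mom \<eta> T \<bullet> \<zeta> T - mom \<eta> 0 \<bullet> \<zeta> 0)"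
    using S by (intro qf_green Z) (auto simp: shifted_def intro!: continuous_intros F X)
  moreover have "ip T (\<lambda>t. F t - c *\<^sub>R \<eta> t) \<zeta> = ip T F \<zeta> - c * ip T \<eta> \<zeta>"
    unfolding ip_def inner_diff_left inner_scaleR_left
    by (subst integral_diff) (auto intro!: integrable_continuous_interval continuous_intros F X)
  ultimately show ?thesis by simp
qed

end

text \<open>\<open>C\<close> is to be a constant from \<open>lagrangian_bform_bound\<close> for
  \<Lambda>, and \<open>c\<close> the shift that \<open>coercive\<close> yields for this
  \<open>C\<close>.\<close>

locale coercive_bvp = sturm T P Q Q' R p0
  for T :: real and P Q Q' R :: "real \<Rightarrow> complex^'n::finite^'n" and p0 :: real +
  fixes \<Lambda> :: "'n c4n set" and C c :: real
  assumes lag: "lagrangian \<Lambda>" and c_pos: "0 < c"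
    and bform_le: "a \<in> \<Lambda> \<Longrightarrow> bform a \<le> C * ((norm (snd (fst a)))\<^sup>2 + (norm (snd (snd a)))\<^sup>2)"
    and coercive_c: "C1_path T \<xi> \<Longrightarrow>
      (p0/2) * ip T (dot T \<xi>) (dot T \<xi>) + ip T \<xi> \<xi> \<le> qf \<xi> \<xi> + c * ip T \<xi> \<xi> - C * ((norm (\<xi> 0))\<^sup>2 + (norm (\<xi> T))\<^sup>2)"
begin

definition bvp :: "(real \<Rightarrow> complex^'n) \<Rightarrow> (real \<Rightarrow> complex^'n) \<Rightarrow> bool" where
  "bvp F \<eta> \<longleftrightarrow> shifted c F \<eta> \<and> bd \<eta> \<in> \<Lambda> \<and> (\<forall>t. t \<notin> {0..T} \<longrightarrow> \<eta> t = 0)"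

text \<open>The boundary term of Green's formula is at most the term with \<open>C\<close> in
  \<open>coercive_c\<close>, so it disappears from the estimate.\<close>

lemma bvp_energy_le:
  assumes S: "shifted c F \<eta>" "bd \<eta> \<in> \<Lambda>" and F: "continuous_on {0..T} F"
  shows "(p0/2) * ip T (dot T \<eta>) (dot T \<eta>) + ip T \<eta> \<eta> \<le> ip T F \<eta>"
proof -
  have "mom \<eta> T \<bullet> \<eta> T - mom \<eta> 0 \<bullet> \<eta> 0 \<le> C * ((norm (\<eta> 0))\<^sup>2 + (norm (\<eta> T))\<^sup>2)"
    using bform_le[OF S(2)] by (simp add: bform_def bd_def)
  then show ?thesis
    using coercive_c[OF shifted_C1[OF S(1)]] shifted_energy[OF S(1) F shifted_C1[OF S(1)]] by linarith
qed

lemma bvp_unique_0: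
  assumes "shifted c (\<lambda>_. 0) \<eta>" "bd \<eta> \<in> \<Lambda>" "t \<in> {0..T}"
  shows "\<eta> t = 0"
proof -
  note X = C1_path_continuous[OF shifted_C1[OF assms(1)]]
  have "(p0/2) * ip T (dot T \<eta>) (dot T \<eta>) + ip T \<eta> \<eta> \<le> 0"
    using bvp_energy_le[OF assms(1,2)] by (simp add: ip_def)
  moreover have "0 \<le> (p0/2) * ip T (dot T \<eta>) (dot T \<eta>)" using p0 ip_self_nonneg[of T "dot T \<eta>"] by simp
  ultimately have "ip T \<eta> \<eta> = 0" using ip_self_nonneg[of T \<eta>] by linarith
  then show ?thesis using ip_self_0[OF T X(1)] assms(3) by simp
qed

lemma bvp_exists:
  assumes F: "continuous_on {0..T} F"
  shows "\<exists>\<eta>. bvp F \<eta>"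
proof -
  define H where "H a = (SOME \<eta>. shifted c (\<lambda>_. 0) \<eta> \<and> fst (bd \<eta>) = a \<and> (\<forall>t. t \<notin> {0..T} \<longrightarrow> \<eta> t = 0))" for a
  have HH: "shifted c (\<lambda>_. 0) (H a) \<and> fst (bd (H a)) = a \<and> (\<forall>t. t \<notin> {0..T} \<longrightarrow> H a t = 0)" for a
    unfolding H_def by (rule someI_ex[OF shifted_exists[OF continuous_on_const]])
  note H = HH[THEN conjunct1] HH[THEN conjunct2, THEN conjunct1] HH[THEN conjunct2, THEN conjunct2, rule_format]
  define \<Phi> where "\<Phi> a = snd (bd (H a))" for a
  have \<Phi>I: "snd (bd \<eta>) = \<Phi> (fst (bd \<eta>))" if "shifted c (\<lambda>_. 0) \<eta>" for \<eta>
  proof -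
    define b where "b = fst (bd \<eta>)"
    have e: "fst (bd \<eta>) = fst (bd (H b))" unfolding b_def by (rule H(2)[symmetric])
    have "T \<in> {0..T}" using T by simp
    note shifted_unique[OF that H(1) e this]
    then show ?thesis unfolding \<Phi>_def b_def[symmetric] by (simp add: bd_def)
  qed
  have C: "C1_path T (H a)" for a using H(1) shifted_C1 by blast
  have \<Phi>_add: "\<Phi> (a + b) = \<Phi> a + \<Phi> b" for a b
  proof -
    have "shifted c (\<lambda>_. 0) (\<lambda>t. H a t + H b t)" using shifted_add[OF H(1) H(1)] by simp
    from \<Phi>I[OF this] show ?thesis using bd_add[OF C C, of a b] H(2) by (simp add: \<Phi>_def)
  qed
  have \<Phi>_scale: "\<Phi> (c2n.scale r a) = c2n.scale r (\<Phi> a)" for r a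
  proof -
    have "shifted c (\<lambda>_. 0) (\<lambda>t. r *s H a t)" using shifted_smult[OF H(1), of r a] by simp
    from \<Phi>I[OF this] show ?thesis using bd_smult[OF C, of r a] H(2) by (simp add: \<Phi>_def c4n.scale_def)
  qed
  define g where "g a = snd a - \<Phi> (fst a)" for a
  have "Vector_Spaces.linear c4n.scale c2n.scale g"
    by unfold_locales (auto simp: g_def \<Phi>_add \<Phi>_scale c4n.scale_def c2n.p.scale_right_diff_distrib)
  moreover have "a = 0" if a: "a \<in> \<Lambda>" "g a = 0" for a
  proof -
    define \<eta> where "\<eta> = H (fst a)"
    have S: "shifted c (\<lambda>_. 0) \<eta>" unfolding \<eta>_def by (rule H)
    have bd: "bd \<eta> = a" using a(2) H(2)[of "fst a"] unfolding \<eta>_def g_def \<Phi>_def by (metis eq_iff_diff_eq_0 prod.expand)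
    have z: "\<eta> t = 0" if "t \<in> {0..T}" for t using bvp_unique_0[OF S _ that] bd a by simp
    have dz: "dot T \<eta> t = 0" if "t \<in> {0..T}" for t
  proof (rule dot_unique[OF _ T that])
    show "(\<eta> has_vector_derivative 0) (at t within {0..T})"
      by (rule has_vector_derivative_transform[OF that z has_vector_derivative_const])
  qed
    have "mom \<eta> t = 0" if "t \<in> {0..T}" for t using z dz that by (simp add: mom_def)
    then have "bd \<eta> = 0" using z T by (simp add: bd_def zero_prod_def)
    then show "a = 0" using bd by simp
  qed
  ultimately have surj: "g ` \<Lambda> = UNIV" by (intro lagrangian_image_UNIV[OF lag])
  \<comment> \<open>The particular solution \<open>p\<close> starts from 0. Adding the homogeneous
    solution with initial value \<open>fst a\<close> gives final value
    \<open>snd (bd p) + \<Phi> (fst a)\<close>, which is \<open>snd a\<close> by the choice of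
    \<open>a\<close>.\<close>
  obtain p where p: "shifted c F p" "fst (bd p) = 0" "\<And>t. t \<notin> {0..T} \<Longrightarrow> p t = 0"
    using shifted_exists[OF F] by blast
  obtain a where a: "a \<in> \<Lambda>" "g a = snd (bd p)" using surj by (metis UNIV_I image_iff)
  have 1: "shifted c F (\<lambda>t. p t + H (fst a) t)" using shifted_add[OF p(1) H(1)] by simp
  have "bd (\<lambda>t. p t + H (fst a) t) = bd p + bd (H (fst a))"
    by (rule bd_add[OF shifted_C1[OF p(1)] C])
  also have "\<dots> = a"
  proof (rule prod_eqI)
    show "fst (bd p + bd (H (fst a))) = fst a" by (simp add: p(2) H(2))
    have "snd (bd p) = snd a - snd (bd (H (fst a)))" using a(2) unfolding g_def \<Phi>_def by simp
    then show "snd (bd p + bd (H (fst a))) = snd a" by (simp only: snd_add diff_add_cancel)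
  qed
  finally have "bvp F (\<lambda>t. p t + H (fst a) t)" unfolding bvp_def using 1 a(1) p(3) H(3) by simp
  then show ?thesis by blast
qed

end

section \<open>Eigenvectors of compact symmetric operators\<close>

text \<open>The Cauchy-Schwarz inequality in the form needed for semidefinite forms: the quadratic
  polynomial is evaluated at its minimum \<open>s = - b / d\<close>, with \<open>d = 0\<close>
  treated separately.\<close>

lemma discriminant_le:
  fixes a b d :: real
  assumes "\<And>s. 0 \<le> a + 2 * s * b + s\<^sup>2 * d" and "0 \<le> d"
  shows "b\<^sup>2 \<le> a * d"
proof (cases "d = 0")
  case True
  have "b = 0"
  proof (rule ccontr)
    assume "b \<noteq> 0"
    \<comment> \<open>At this s the sum \<open>a + 2 s b\<close> equals -1.\<close>
    then show False using assms(1)[of "- (a + 1) / (2 * b)"] True by (simp add: field_simps)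
  qed
  then show ?thesis using True by simp
next
  case False
  then have "d > 0" using assms by simp
  have "0 \<le> a + 2 * (- b / d) * b + (- b / d)\<^sup>2 * d" by (rule assms(1))
  also have "\<dots> = a - b\<^sup>2 / d" using False by (simp add: power2_eq_square field_simps)
  finally show ?thesis using \<open>d > 0\<close> by (simp add: field_simps)
qed

text \<open>
  A maximizing sequence \<open>F n\<close> of the Rayleigh quotient satisfies \<open>\<rho> F n - K (F n) \<rightarrow> 0\<close> weakly, by the
  Cauchy-Schwarz inequality for the nonnegative form \<open>\<rho> \<langle>f, g\<rangle> - \<langle>K f, g\<rangle>\<close>; so no completeness is needed.
\<close>

lemma compact_symmetric_eigenvector:
  fixes scale :: "real \<Rightarrow> 'a::ab_group_add \<Rightarrow> 'a" and ip :: "'a \<Rightarrow> 'a \<Rightarrow> real"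
  assumes S_add: "\<And>f g. f \<in> S \<Longrightarrow> g \<in> S \<Longrightarrow> f + g \<in> S"
    and S_diff: "\<And>f g. f \<in> S \<Longrightarrow> g \<in> S \<Longrightarrow> f - g \<in> S"
    and S_scale: "\<And>r f. f \<in> S \<Longrightarrow> scale r f \<in> S"
    and ip_add: "\<And>f g h. f \<in> S \<Longrightarrow> g \<in> S \<Longrightarrow> h \<in> S \<Longrightarrow> ip (f + g) h = ip f h + ip g h"
    and ip_diff: "\<And>f g h. f \<in> S \<Longrightarrow> g \<in> S \<Longrightarrow> h \<in> S \<Longrightarrow> ip (f - g) h = ip f h - ip g h"
    and ip_scale: "\<And>r f h. f \<in> S \<Longrightarrow> h \<in> S \<Longrightarrow> ip (scale r f) h = r * ip f h"
    and ip_sym: "\<And>f g. ip f g = ip g f" and ip_nonneg: "\<And>f. 0 \<le> ip f f"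
    and K: "\<And>f. f \<in> S \<Longrightarrow> K f \<in> S"
    and K_sym: "\<And>f g. f \<in> S \<Longrightarrow> g \<in> S \<Longrightarrow> ip (K f) g = ip f (K g)"
    and K_bound: "\<And>f. f \<in> S \<Longrightarrow> ip (K f) f \<le> M * ip f f"
    and K_compact: "\<And>F :: nat \<Rightarrow> 'a. (\<And>n. F n \<in> S) \<Longrightarrow> (\<And>n. ip (F n) (F n) = 1) \<Longrightarrow>
       \<exists>r g. strict_mono r \<and> g \<in> S \<and> (\<lambda>n. ip (K (F (r n)) - g) (K (F (r n)) - g)) \<longlonglongrightarrow> 0"
    and f0: "f0 \<in> S" "0 < ip f0 f0" "\<kappa> * ip f0 f0 < ip (K f0) f0" and \<kappa>: "0 \<le> \<kappa>"
  shows "\<exists>\<rho> g. \<kappa> < \<rho> \<and> g \<in> S \<and> 0 < ip g g \<and> (\<forall>h\<in>S. ip (K g) h = \<rho> * ip g h)"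
proof -
  have ip_add': "ip h (f + g) = ip h f + ip h g" and ip_scale': "ip h (scale r f) = r * ip h f"
    if "f \<in> S" "g \<in> S" "h \<in> S" for f g h r
    using ip_add[OF that] ip_scale[OF that(1,3)] ip_sym by metis+
  have expand: "ip (f + scale s h) (f + scale s h) = ip f f + 2 * s * ip f h + s\<^sup>2 * ip h h"
    and expandK: "ip (K (f + scale s h)) (f + scale s h) = ip (K f) f + 2 * s * ip (K f) h + s\<^sup>2 * ip (K h) h"
    if fh: "f \<in> S" "h \<in> S" for f h s
  proof -
    note m = fh S_scale[OF fh(2), of s] S_add[OF fh(1) S_scale[OF fh(2), of s]]
    show "ip (f + scale s h) (f + scale s h) = ip f f + 2 * s * ip f h + s\<^sup>2 * ip h h"
      using m ip_sym[of h f] by (simp add: ip_add ip_add' ip_scale ip_scale' power2_eq_square algebra_simps)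
    have hf: "ip (K h) f = ip (K f) h" using K_sym[OF fh(2,1)] ip_sym by metis
    let ?u = "f + scale s h"
    \<comment> \<open>Symmetry moves \<open>K\<close> off the sum, so that additivity of
      \<open>ip\<close> does the work of linearity of \<open>K\<close>.\<close>
    have "ip (K ?u) ?u = ip ?u (K ?u)" by (rule ip_sym)
    also have "\<dots> = ip f (K ?u) + s * ip h (K ?u)" using m K by (simp add: ip_add ip_scale)
    also have "\<dots> = ip (K f) ?u + s * ip (K h) ?u" using K_sym m by metis
    also have "\<dots> = ip (K f) f + 2 * s * ip (K f) h + s\<^sup>2 * ip (K h) h"
      using m K hf by (simp add: ip_add' ip_scale' power2_eq_square algebra_simps)
    finally show "ip (K ?u) ?u = ip (K f) f + 2 * s * ip (K f) h + s\<^sup>2 * ip (K h) h" .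
  qed
  have CS: "(ip f h)\<^sup>2 \<le> ip f f * ip h h" if "f \<in> S" "h \<in> S" for f h
    by (rule discriminant_le) (use expand[OF that] ip_nonneg in metis)+
  have normalize: "\<exists>u\<in>S. ip u u = 1 \<and> ip (K u) u = ip (K f) f / ip f f" if "f \<in> S" "0 < ip f f" for f
  proof -
    let ?u = "scale (1 / sqrt (ip f f)) f"
    have "f - f \<in> S" using S_diff that by blast
    then have z: "0 \<in> S" by simp
    have z0: "ip 0 h = 0" "ip h 0 = 0" if "h \<in> S" for h using ip_add[OF z z that] ip_sym by (metis add_cancel_left_left add.left_neutral)+
    have "ip ?u ?u = ip f f / (sqrt (ip f f))\<^sup>2" "ip (K ?u) ?u = ip (K f) f / (sqrt (ip f f))\<^sup>2"
      using expand[OF z that(1), of "1 / sqrt (ip f f)"] expandK[OF z that(1), of "1 / sqrt (ip f f)"] z0 that(1) K z K_sym[OF z that(1)]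
      by (simp_all add: power_divide)
    then show ?thesis using that S_scale[OF that(1)] by (intro bexI[of _ ?u]) auto
  qed
  define V where "V = {ip (K u) u |u. u \<in> S \<and> ip u u = 1}"
  define \<rho> where "\<rho> = Sup V"
  have bdd: "bdd_above V"
  proof (rule bdd_aboveI)
    fix x assume "x \<in> V"
    then obtain u where "u \<in> S" "ip u u = 1" "x = ip (K u) u" unfolding V_def by blast
    then show "x \<le> M" using K_bound[of u] by simp
  qed
  obtain u0 where u0: "u0 \<in> S" "ip u0 u0 = 1" "ip (K u0) u0 = ip (K f0) f0 / ip f0 f0"
    using normalize[OF f0(1,2)] by blast
  have VI: "ip (K u) u \<in> V" if "u \<in> S" "ip u u = 1" for u unfolding V_def using that by blast
  have V: "V \<noteq> {}" "ip (K u0) u0 \<in> V" using VI[OF u0(1,2)] by blast+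
  have "\<kappa> < ip (K u0) u0" unfolding u0(3) using f0(2,3) by (simp add: pos_less_divide_eq)
  also have "\<dots> \<le> \<rho>" unfolding \<rho>_def by (rule cSup_upper[OF V(2) bdd])
  finally have \<rho>: "\<kappa> < \<rho>" .
  have B_nonneg: "0 \<le> \<rho> * ip f f - ip (K f) f" if "f \<in> S" for f
  proof (cases "ip f f = 0")
    \<comment> \<open>\<open>ip\<close> may be degenerate; where \<open>ip f f\<close> is 0,
      \<open>K_bound\<close> makes \<open>ip (K f) f\<close> nonpositive.\<close>
    case True then show ?thesis using K_bound[OF that] by simp
  next
    case False
    then have pos: "0 < ip f f" using ip_nonneg[of f] by simp
    then obtain u where u: "u \<in> S" "ip u u = 1" "ip (K u) u = ip (K f) f / ip f f"
      using normalize[OF \<open>f \<in> S\<close> pos] by blast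
    then have "ip (K u) u \<le> \<rho>" unfolding \<rho>_def by (intro cSup_upper[OF _ bdd] VI)
    then show ?thesis unfolding u(3) using pos by (simp add: pos_divide_le_eq)
  qed
  have B_CS: "(\<rho> * ip f h - ip (K f) h)\<^sup>2 \<le> (\<rho> * ip f f - ip (K f) f) * (\<rho> * ip h h - ip (K h) h)"
    if "f \<in> S" "h \<in> S" for f h
  proof (rule discriminant_le)
    fix s
    have "0 \<le> \<rho> * ip (f + scale s h) (f + scale s h) - ip (K (f + scale s h)) (f + scale s h)"
      by (intro B_nonneg S_add S_scale that)
    then show "0 \<le> \<rho> * ip f f - ip (K f) f + 2 * s * (\<rho> * ip f h - ip (K f) h) + s\<^sup>2 * (\<rho> * ip h h - ip (K h) h)"
      unfolding expand[OF that] expandK[OF that] by (simp add: algebra_simps)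
  qed (rule B_nonneg[OF that(2)])
  have "\<exists>u. u \<in> S \<and> ip u u = 1 \<and> \<rho> - 1 / real (Suc n) < ip (K u) u" for n
  proof -
    have "\<rho> - 1 / real (Suc n) < Sup V" unfolding \<rho>_def by simp
    then show ?thesis using less_cSup_iff[OF V(1) bdd] unfolding V_def by blast
  qed
  then obtain F where F: "\<And>n. F n \<in> S" "\<And>n. ip (F n) (F n) = 1" "\<And>n. \<rho> - 1 / real (Suc n) < ip (K (F n)) (F n)"
    by metis
  obtain r g where r: "strict_mono r" and g: "g \<in> S"
    and lim: "(\<lambda>n. ip (K (F (r n)) - g) (K (F (r n)) - g)) \<longlonglongrightarrow> 0"
    using K_compact[of F] F by blast
  define G where "G n = F (r n)" for n
  have G: "\<And>n. G n \<in> S" "\<And>n. ip (G n) (G n) = 1" using F by (auto simp: G_def)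
  have Glim: "(\<lambda>n. ip (K (G n)) (G n)) \<longlonglongrightarrow> \<rho>"
  proof -
    have "(\<lambda>n. ip (K (F n)) (F n)) \<longlonglongrightarrow> \<rho>"
    proof (rule tendsto_sandwich[of "\<lambda>n. \<rho> - 1 / real (Suc n)" _ _ "\<lambda>_. \<rho>"])
      show "\<forall>\<^sub>F n in sequentially. \<rho> - 1 / real (Suc n) \<le> ip (K (F n)) (F n)" using F(3) less_imp_le by (intro always_eventually) blast
      show "\<forall>\<^sub>F n in sequentially. ip (K (F n)) (F n) \<le> \<rho>" using B_nonneg[OF F(1)] F(2) by (intro always_eventually) (auto simp: algebra_simps)
      show "(\<lambda>n. \<rho> - 1 / real (Suc n)) \<longlonglongrightarrow> \<rho>"
        using tendsto_diff[OF tendsto_const[of \<rho>] LIMSEQ_inverse_real_of_nat] by (simp add: inverse_eq_divide)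
    qed simp
    then show ?thesis unfolding G_def using LIMSEQ_subseq_LIMSEQ[OF _ r] by (auto simp: o_def)
  qed
  \<comment> \<open>The test elements may vary with n: constant ones serve for the eigenvalue
    equation, and \<open>H n = G n\<close> for the proof that \<open>g\<close> is not null.\<close>
  have KGh: "(\<lambda>n. ip (K (G n)) (H n) - ip g (H n)) \<longlonglongrightarrow> 0"
    if H: "\<And>n. H n \<in> S" "\<And>n. ip (H n) (H n) \<le> c" for H c
  proof -
    have "(\<lambda>n. sqrt (c * ip (K (G n) - g) (K (G n) - g))) \<longlonglongrightarrow> sqrt (c * 0)"
      unfolding G_def by (intro tendsto_intros lim)
    then have lim0: "(\<lambda>n. sqrt (c * ip (K (G n) - g) (K (G n) - g))) \<longlonglongrightarrow> 0" by simp
    have bound: "norm (ip (K (G n)) (H n) - ip g (H n)) \<le> sqrt (c * ip (K (G n) - g) (K (G n) - g))" for n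
    proof -
      have d: "K (G n) - g \<in> S" using S_diff K G(1) g by blast
      have "(ip (K (G n) - g) (H n))\<^sup>2 \<le> ip (K (G n) - g) (K (G n) - g) * ip (H n) (H n)" by (rule CS[OF d H(1)])
      also have "\<dots> \<le> c * ip (K (G n) - g) (K (G n) - g)"
        unfolding mult.commute[of c] by (rule mult_left_mono[OF H(2) ip_nonneg])
      finally have "\<bar>ip (K (G n) - g) (H n)\<bar> \<le> sqrt (c * ip (K (G n) - g) (K (G n) - g))"
        by (metis real_sqrt_abs real_sqrt_le_mono)
      then show ?thesis using ip_diff[OF K[OF G(1)] g H(1)] by simp
    qed
    show ?thesis by (rule Lim_null_comparison[OF always_eventually lim0]) (use bound in blast)
  qed
  have weak: "\<rho> * ip g h = ip (K g) h" if h: "h \<in> S" for h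
  proof -
    have 1: "(\<lambda>n. ip (K (G n)) h - ip g h) \<longlonglongrightarrow> 0" "(\<lambda>n. ip (K (G n)) (K h) - ip g (K h)) \<longlonglongrightarrow> 0"
      using KGh[of "\<lambda>_. h"] KGh[of "\<lambda>_. K h"] h K by auto
    have "(\<lambda>n. \<rho> * ip (K (G n)) h - ip (K (G n)) (K h)) \<longlonglongrightarrow> \<rho> * ip g h - ip g (K h)"
      using 1 by (intro tendsto_intros) (auto simp: LIM_zero_iff)
    \<comment> \<open>By symmetry \<open>ip (K (G n)) h\<close> is \<open>ip (G n) (K h)\<close>, so
      \<open>B_CS\<close> with \<open>K h\<close> as second argument bounds the square by a constant
      times \<open>\<rho> - ip (K (G n)) (G n)\<close>. Testing with \<open>K h\<close> brings in
      \<open>K (G n)\<close>, which converges, in place of \<open>G n\<close>.\<close>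
    moreover have "(\<lambda>n. \<rho> * ip (K (G n)) h - ip (K (G n)) (K h)) \<longlonglongrightarrow> 0"
    proof (rule Lim_null_comparison[of _ "\<lambda>n. sqrt ((\<rho> - ip (K (G n)) (G n)) * (\<rho> * ip (K h) (K h) - ip (K (K h)) (K h)))"])
      have "(\<lambda>n. sqrt ((\<rho> - ip (K (G n)) (G n)) * (\<rho> * ip (K h) (K h) - ip (K (K h)) (K h)))) \<longlonglongrightarrow>
          sqrt ((\<rho> - \<rho>) * (\<rho> * ip (K h) (K h) - ip (K (K h)) (K h)))"
        by (intro tendsto_intros Glim)
      then show "(\<lambda>n. sqrt ((\<rho> - ip (K (G n)) (G n)) * (\<rho> * ip (K h) (K h) - ip (K (K h)) (K h)))) \<longlonglongrightarrow> 0" by simp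
      have "norm (\<rho> * ip (K (G n)) h - ip (K (G n)) (K h)) \<le> sqrt ((\<rho> - ip (K (G n)) (G n)) * (\<rho> * ip (K h) (K h) - ip (K (K h)) (K h)))" for n
      proof -
        have "(\<rho> * ip (K (G n)) h - ip (K (G n)) (K h))\<^sup>2 \<le> (\<rho> - ip (K (G n)) (G n)) * (\<rho> * ip (K h) (K h) - ip (K (K h)) (K h))"
          using B_CS[OF G(1) K[OF h], of n] K_sym[OF G(1) h, of n] G(2)[of n] by simp
        then show ?thesis by (metis real_norm_def real_sqrt_abs real_sqrt_le_mono)
      qed
      then show "\<forall>\<^sub>F n in sequentially. norm (\<rho> * ip (K (G n)) h - ip (K (G n)) (K h)) \<le>
          sqrt ((\<rho> - ip (K (G n)) (G n)) * (\<rho> * ip (K h) (K h) - ip (K (K h)) (K h)))" by (intro always_eventually) blast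
    qed
    ultimately have "\<rho> * ip g h - ip g (K h) = 0" using LIMSEQ_unique by blast
    then show ?thesis using K_sym[OF g h] by simp
  qed
  have "0 < ip g g"
  proof -
    \<comment> \<open>The products \<open>ip g (G n)\<close> tend to \<rho>, which is positive, and
      \<open>G n\<close> has norm 1; Cauchy-Schwarz then keeps \<open>g\<close> away from 0.\<close>
    have "(\<lambda>n. ip (K (G n)) (G n) - (ip (K (G n)) (G n) - ip g (G n))) \<longlonglongrightarrow> \<rho> - 0"
      by (intro tendsto_diff Glim KGh[where c = 1] G) (simp add: G)
    then have "(\<lambda>n. ip g (G n)) \<longlonglongrightarrow> \<rho>" by simp
    then have "(\<lambda>n. (ip g (G n))\<^sup>2) \<longlonglongrightarrow> \<rho>\<^sup>2" by (intro tendsto_intros)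
    moreover have "(ip g (G n))\<^sup>2 \<le> ip g g" for n using CS[OF g G(1), of n] G(2) by simp
    ultimately have "\<rho>\<^sup>2 \<le> ip g g" by (intro LIMSEQ_le_const2) auto
    moreover have "0 < \<rho>\<^sup>2" using \<rho> \<kappa> by simp
    ultimately show ?thesis by linarith
  qed
  then show ?thesis using \<rho> g weak by (intro exI[of _ \<rho>] exI[of _ g]) auto
qed

section \<open>Eigenfunctions beyond a given orthonormal system\<close>

lemma ip_add_left:
  assumes "continuous_on {0..T} f" "continuous_on {0..T} g" "continuous_on {0..T} h"
  shows "ip T (\<lambda>t. f t + g t) h = ip T f h + ip T g h"
  unfolding ip_def inner_add_left
  by (rule integral_add) (auto intro!: integrable_continuous_interval continuous_intros assms)

lemma ip_diff_left:
  assumes "continuous_on {0..T} f" "continuous_on {0..T} g" "continuous_on {0..T} h"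
  shows "ip T (\<lambda>t. f t - g t) h = ip T f h - ip T g h"
  unfolding ip_def inner_diff_left
  by (rule integral_diff) (auto intro!: integrable_continuous_interval continuous_intros assms)

lemma ip_diff_self:
  assumes "continuous_on {0..T} f" "continuous_on {0..T} g"
  shows "ip T (\<lambda>t. f t - g t) (\<lambda>t. f t - g t) = ip T f f - 2 * ip T f g + ip T g g"
proof -
  have d: "continuous_on {0..T} (\<lambda>t. f t - g t)" by (intro continuous_intros assms)
  have "ip T (\<lambda>t. f t - g t) (\<lambda>t. f t - g t) = ip T f (\<lambda>t. f t - g t) - ip T g (\<lambda>t. f t - g t)"
    by (rule ip_diff_left[OF assms d])
  also have "ip T f (\<lambda>t. f t - g t) = ip T f f - ip T g f"
    unfolding ip_commute[of T f "\<lambda>t. f t - g t"] by (rule ip_diff_left[OF assms assms(1)])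
  also have "ip T g (\<lambda>t. f t - g t) = ip T f g - ip T g g"
    unfolding ip_commute[of T g "\<lambda>t. f t - g t"] by (rule ip_diff_left[OF assms assms(2)])
  finally show ?thesis using ip_commute[of T f g] by simp
qed

lemma ip_scaleR_left: "ip T (\<lambda>t. r *\<^sub>R f t) h = r * ip T f h"
  unfolding ip_def by simp

lemma hip_add_left:
  assumes "continuous_on {0..T} f" "continuous_on {0..T} g" "continuous_on {0..T} h"
  shows "hip T (\<lambda>t. f t + g t) h = hip T f h + hip T g h"
  unfolding hip_def hinner_sums
  by (rule integral_add) (auto intro!: integrable_continuous_interval continuous_intros assms)

lemma hip_diff_left:
  assumes "continuous_on {0..T} f" "continuous_on {0..T} g" "continuous_on {0..T} h"
  shows "hip T (\<lambda>t. f t - g t) h = hip T f h - hip T g h"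
  unfolding hip_def hinner_sums
  by (rule integral_diff) (auto intro!: integrable_continuous_interval continuous_intros assms)

lemma hip_smult_left: "hip T (\<lambda>t. r *s f t) h = r * hip T f h"
  unfolding hip_def hinner_sums by simp

lemma hip_smult_right: "hip T h (\<lambda>t. r *s f t) = cnj r * hip T h f"
  unfolding hip_def hinner_sums by simp

lemma hip_diff_right:
  assumes "continuous_on {0..T} f" "continuous_on {0..T} g" "continuous_on {0..T} h"
  shows "hip T h (\<lambda>t. f t - g t) = hip T h f - hip T h g"
  unfolding hip_def hinner_sums
  by (rule integral_diff) (auto intro!: integrable_continuous_interval continuous_intros assms)

text \<open>Integrate \<open>norm v \<le> \<epsilon> (v \<bullet> v) + 1 / (4 \<epsilon>)\<close>
  for the derivative between s and t. Optimizing \<epsilon> would give the Hoelder estimate of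
  exponent 1/2; this version serves for equicontinuity without square roots.\<close>

lemma norm_diff_le_energy:
  fixes \<xi> :: "real \<Rightarrow> 'a::euclidean_space"
  assumes C: "C1_path T \<xi>" and e: "0 < \<epsilon>" and st: "s \<in> {0..T}" "t \<in> {0..T}"
  shows "norm (\<xi> t - \<xi> s) \<le> \<epsilon> * ip T (dot T \<xi>) (dot T \<xi>) + \<bar>t - s\<bar> / (4 * \<epsilon>)"
proof -
  note cont = C1_path_continuous[OF C]
  have main: "norm (\<xi> b - \<xi> a) \<le> \<epsilon> * ip T (dot T \<xi>) (dot T \<xi>) + (b - a) / (4 * \<epsilon>)"
    if ab: "0 \<le> a" "a \<le> b" "b \<le> T" for a b
  proof -
    have sub: "{a..b} \<subseteq> {0..T}" using ab by auto
    have c: "continuous_on {a..b} (dot T \<xi>)" by (rule continuous_on_subset[OF cont(2) sub])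
    have I: "((dot T \<xi>) has_integral \<xi> b - \<xi> a) {a..b}"
    proof (rule fundamental_theorem_of_calculus[OF ab(2)])
      fix r assume "r \<in> {a..b}"
      then show "(\<xi> has_vector_derivative dot T \<xi> r) (at r within {a..b})"
        using C1_path_has_vector_derivative[OF C, of r] sub has_vector_derivative_within_subset by blast
    qed
    let ?\<psi> = "\<lambda>r. \<epsilon> * (dot T \<xi> r \<bullet> dot T \<xi> r) + 1 / (4 * \<epsilon>)"
    have pt: "norm v \<le> \<epsilon> * (v \<bullet> v) + 1 / (4 * \<epsilon>)" for v :: 'a
    proof -
      have "0 \<le> (2 * \<epsilon> * norm v - 1)\<^sup>2 / (4 * \<epsilon>)" using e by simp
      also have "\<dots> = \<epsilon> * (v \<bullet> v) + 1 / (4 * \<epsilon>) - norm v"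
        using e by (simp add: power2_eq_square dot_square_norm field_simps)
      finally show ?thesis by simp
    qed
    have "norm (integral {a..b} (dot T \<xi>)) \<le> integral {a..b} ?\<psi>"
      using pt by (intro integral_norm_bound_integral) (auto intro!: integrable_continuous_interval continuous_intros c)
    also have "\<dots> = \<epsilon> * integral {a..b} (\<lambda>r. dot T \<xi> r \<bullet> dot T \<xi> r) + (b - a) / (4 * \<epsilon>)"
      using ab by (subst integral_add) (auto intro!: integrable_continuous_interval continuous_intros c)
    also have "\<dots> \<le> \<epsilon> * ip T (dot T \<xi>) (dot T \<xi>) + (b - a) / (4 * \<epsilon>)"
    proof -
      have "integral {a..b} (\<lambda>r. dot T \<xi> r \<bullet> dot T \<xi> r) \<le> ip T (dot T \<xi>) (dot T \<xi>)"
        unfolding ip_def by (intro integral_subset_le[OF sub] integrable_continuous_interval continuous_intros c cont) auto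
      then show ?thesis using e by simp
    qed
    finally show ?thesis using I by (simp add: integral_unique)
  qed
  show ?thesis
  proof (cases "s \<le> t")
    case True then show ?thesis using main[of s t] st by simp
  next
    case False then show ?thesis using main[of t s] st by (simp add: norm_minus_commute)
  qed
qed

lemma lagrangian_Omega: "lagrangian \<Lambda> \<Longrightarrow> a \<in> \<Lambda> \<Longrightarrow> b \<in> \<Lambda> \<Longrightarrow> Omega a b = 0"
  unfolding lagrangian_def by blast

lemma lagrangian_scale: "lagrangian \<Lambda> \<Longrightarrow> a \<in> \<Lambda> \<Longrightarrow> c4n.scale r a \<in> \<Lambda>"
  unfolding lagrangian_def by (blast intro: c4n.p.subspace_scale)

context sturm
begin

text \<open>The classical counterpart of \<open>eigenspace\<close>: the eigenvalue equation holds at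
  every point, which loses nothing because its right-hand side is continuous.\<close>

definition eigen :: "'n c4n set \<Rightarrow> real \<Rightarrow> (real \<Rightarrow> complex^'n) \<Rightarrow> bool" where
  "eigen \<Lambda> \<mu> \<xi> \<longleftrightarrow> sol \<xi> (\<lambda>t. complex_of_real \<mu> *s \<xi> t) \<and> bd \<xi> \<in> \<Lambda> \<and> (\<forall>t. t \<notin> {0..T} \<longrightarrow> \<xi> t = 0)"

lemma eigen_C1: "eigen \<Lambda> \<mu> \<xi> \<Longrightarrow> C1_path T \<xi>"
  by (simp add: eigen_def sol_def)

lemma eigen_continuous: "eigen \<Lambda> \<mu> \<xi> \<Longrightarrow> continuous_on {0..T} \<xi>"
  using eigen_C1 C1_path_continuous by blast

text \<open>Both boundary values lie in the Lagrangian subspace, so Green's identity has no boundary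
  term.\<close>

lemma hip_eigen_symmetric:
  assumes "lagrangian \<Lambda>" "sol \<xi> h" "bd \<xi> \<in> \<Lambda>" "continuous_on {0..T} h" "eigen \<Lambda> \<mu> e"
  shows "hip T h e = complex_of_real \<mu> * hip T \<xi> e"
proof -
  have c: "continuous_on {0..T} (\<lambda>t. complex_of_real \<mu> *s e t)"
    by (intro continuous_intros eigen_continuous[OF assms(5)])
  have "hip T \<xi> (\<lambda>t. complex_of_real \<mu> *s e t) - hip T h e = Omega (bd \<xi>) (bd e)"
    using assms by (intro hip_green c) (auto simp: eigen_def)
  also have "\<dots> = 0" using assms unfolding eigen_def by (intro lagrangian_Omega[OF assms(1)]) blast+
  finally show ?thesis by (simp add: hip_smult_right)
qed

end

section \<open>The inverse of the shifted operator, its compactness and its eigenvectors\<close>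

context coercive_bvp
begin

text \<open>The inverse of \<A> + c. The choice is immaterial: by the energy estimate solutions are
  unique on [0,T], and they vanish outside.\<close>

definition Kop :: "(real \<Rightarrow> complex^'n) \<Rightarrow> real \<Rightarrow> complex^'n" where
  "Kop F = (SOME \<eta>. bvp F \<eta>)"

lemma bvp_Kop: "continuous_on {0..T} F \<Longrightarrow> bvp F (Kop F)"
  unfolding Kop_def by (rule someI_ex[OF bvp_exists])

lemma Kop_C1: "continuous_on {0..T} F \<Longrightarrow> C1_path T (Kop F)"
  using bvp_Kop[of F] shifted_C1[of c F "Kop F"] unfolding bvp_def by blast

lemma Kop_symmetric:
  assumes F: "continuous_on {0..T} F" and G: "continuous_on {0..T} G"
  shows "hip T (Kop F) G = hip T F (Kop G)"
proof -
  note X = bvp_Kop[OF F] bvp_Kop[OF G]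
  have C: "continuous_on {0..T} (Kop F)" "continuous_on {0..T} (Kop G)"
    using Kop_C1 F G C1_path_continuous by blast+
  have "hip T (Kop F) (\<lambda>t. G t - c *\<^sub>R Kop G t) - hip T (\<lambda>t. F t - c *\<^sub>R Kop F t) (Kop G) = Omega (bd (Kop F)) (bd (Kop G))"
    using X by (intro hip_green continuous_intros C F G) (auto simp: bvp_def shifted_def)
  also have "\<dots> = 0" using X lagrangian_Omega[OF lag] unfolding bvp_def by blast
  finally have 1: "hip T (Kop F) (\<lambda>t. G t - complex_of_real c *s Kop G t) - hip T (\<lambda>t. F t - complex_of_real c *s Kop F t) (Kop G) = 0"
    by (simp only: scaleR_eq_smult)
  have 2: "hip T (Kop F) (\<lambda>t. G t - complex_of_real c *s Kop G t) = hip T (Kop F) G - complex_of_real c * hip T (Kop F) (Kop G)"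
    using hip_diff_right[OF G continuous_on_smult[OF C(2)] C(1), of "complex_of_real c"] by (simp add: hip_smult_right)
  have 3: "hip T (\<lambda>t. F t - complex_of_real c *s Kop F t) (Kop G) = hip T F (Kop G) - complex_of_real c * hip T (Kop F) (Kop G)"
    using hip_diff_left[OF F continuous_on_smult[OF C(1)] C(2), of "complex_of_real c"] by (simp add: hip_smult_left)
  show ?thesis using 1 unfolding 2 3 by simp
qed

text \<open>An eigenfunction solves (\<A> + c) e = (\<mu> + c) e, and the energy estimate bounds
  \<open>(\<mu> + c) ip T e e\<close> below by \<open>ip T e e\<close>. That \<mu> + c is not 0
  makes orthogonality to \<open>e\<close> invariant under \<open>Kop\<close>.\<close>

lemma eigen_above:
  assumes "eigen \<Lambda> \<mu> e" "0 < ip T e e"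
  shows "0 < \<mu> + c"
proof -
  have E: "continuous_on {0..T} e" using assms(1) by (rule eigen_continuous)
  have S: "shifted c (\<lambda>t. (\<mu> + c) *\<^sub>R e t) e" "bd e \<in> \<Lambda>"
    using assms(1) by (auto simp: shifted_def eigen_def scaleR_left_distrib simp flip: scaleR_eq_smult)
  have "(p0/2) * ip T (dot T e) (dot T e) + ip T e e \<le> ip T (\<lambda>t. (\<mu> + c) *\<^sub>R e t) e"
    using S by (rule bvp_energy_le) (intro continuous_intros E)
  then have "(p0/2) * ip T (dot T e) (dot T e) + ip T e e \<le> (\<mu> + c) * ip T e e"
    by (simp add: ip_scaleR_left)
  moreover have "0 \<le> (p0/2) * ip T (dot T e) (dot T e)" using p0 ip_self_nonneg[of T "dot T e"] by simp
  ultimately have "0 < (\<mu> + c) * ip T e e" using assms(2) by linarith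
  then show ?thesis using assms(2) by (simp add: zero_less_mult_iff)
qed

text \<open>Double the energy estimate and use \<open>2 ip T F k \<le> ip T F F + ip T k k\<close>.
  The derivative term gives compactness, the other one the upper bound 1 for the Rayleigh
  quotient.\<close>

lemma Kop_energy:
  assumes F: "continuous_on {0..T} F"
  shows "p0 * ip T (dot T (Kop F)) (dot T (Kop F)) + ip T (Kop F) (Kop F) \<le> ip T F F"
proof -
  let ?k = "Kop F"
  have B: "bvp F ?k" by (rule bvp_Kop[OF F])
  have k: "continuous_on {0..T} ?k" using Kop_C1[OF F] C1_path_continuous by blast
  have 1: "(p0/2) * ip T (dot T ?k) (dot T ?k) + ip T ?k ?k \<le> ip T F ?k"
    using B F by (intro bvp_energy_le) (auto simp: bvp_def)
  have "0 \<le> ip T (\<lambda>t. F t - ?k t) (\<lambda>t. F t - ?k t)" by (rule ip_self_nonneg)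
  also have "\<dots> = ip T F F - 2 * ip T F ?k + ip T ?k ?k"
    by (rule ip_diff_self[OF F k])
  finally show ?thesis using 1 by simp
qed

text \<open>The energy bound on values and derivatives gives a uniform bound by
  \<open>trace_bound\<close> and equicontinuity by \<open>norm_diff_le_energy\<close>.\<close>

lemma Kop_compact:
  assumes F: "\<And>n. continuous_on {0..T} (F n)" and F1: "\<And>n. ip T (F n) (F n) = 1"
  obtains r g where "strict_mono (r :: nat \<Rightarrow> nat)" "continuous_on {0..T} g" "\<And>t. t \<notin> {0..T} \<Longrightarrow> g t = 0"
    "\<And>\<epsilon>. 0 < \<epsilon> \<Longrightarrow> \<exists>N. \<forall>n\<ge>N. \<forall>t\<in>{0..T}. norm (Kop (F (r n)) t - g t) < \<epsilon>"
proof -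
  have C1: "C1_path T (Kop (F n))" for n by (rule Kop_C1[OF F])
  have en: "p0 * ip T (dot T (Kop (F n))) (dot T (Kop (F n))) \<le> 1" "ip T (Kop (F n)) (Kop (F n)) \<le> 1" for n
  proof -
    have "0 \<le> p0 * ip T (dot T (Kop (F n))) (dot T (Kop (F n)))" "0 \<le> ip T (Kop (F n)) (Kop (F n))"
      using p0 ip_self_nonneg by (auto intro!: mult_nonneg_nonneg)
    then show "p0 * ip T (dot T (Kop (F n))) (dot T (Kop (F n))) \<le> 1" "ip T (Kop (F n)) (Kop (F n)) \<le> 1"
      using Kop_energy[OF F, of n] F1[of n] by linarith+
  qed
  have D: "ip T (dot T (Kop (F n))) (dot T (Kop (F n))) \<le> 1 / p0" for n
    using en(1)[of n] p0 by (simp add: field_simps)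
  have bound: "norm (Kop (F n) t) \<le> sqrt (1 / p0 + (1 + 1/T))" if "t \<in> {0..T}" for n t
  proof -
    have "(norm (Kop (F n) t))\<^sup>2 \<le> 1 * ip T (dot T (Kop (F n))) (dot T (Kop (F n))) + (1/1 + 1/T) * ip T (Kop (F n)) (Kop (F n))"
      by (rule trace_bound[OF T C1 _ that]) simp
    also have "\<dots> \<le> 1 / p0 + (1 + 1/T) * 1"
    proof (intro add_mono)
      show "(1/1 + 1/T) * ip T (Kop (F n)) (Kop (F n)) \<le> (1 + 1/T) * 1"
        using mult_left_mono[OF en(2)[of n], of "1 + 1/T"] T by simp
    qed (use D in simp)
    finally show ?thesis by (simp add: real_le_rsqrt)
  qed
  have equi: "\<exists>d. 0 < d \<and> (\<forall>n y. y \<in> {0..T} \<and> norm (x - y) < d \<longrightarrow> norm (Kop (F n) x - Kop (F n) y) < \<epsilon>)"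
    if x: "x \<in> {0..T}" and e: "0 < \<epsilon>" for x \<epsilon>
  proof (intro exI conjI allI impI)
    \<comment> \<open>With this parameter the energy term is at most \<open>\<epsilon> / 2\<close>,
      and so is the other term when the distance is below \<open>2 ?h \<epsilon>\<close>.\<close>
    let ?h = "p0 * \<epsilon> / 2"
    show "0 < 2 * ?h * \<epsilon>" using p0 e by simp
    fix n y assume y: "y \<in> {0..T} \<and> norm (x - y) < 2 * ?h * \<epsilon>"
    have "norm (Kop (F n) x - Kop (F n) y) \<le> ?h * ip T (dot T (Kop (F n))) (dot T (Kop (F n))) + \<bar>x - y\<bar> / (4 * ?h)"
      using p0 e y x by (intro norm_diff_le_energy C1) auto
    also have "\<dots> \<le> ?h * (1 / p0) + \<bar>x - y\<bar> / (4 * ?h)"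
      using D p0 e by (intro add_right_mono mult_left_mono) auto
    also have "\<dots> < ?h * (1 / p0) + (2 * ?h * \<epsilon>) / (4 * ?h)"
      using y p0 e by (intro add_strict_left_mono divide_strict_right_mono) auto
    also have "\<dots> = \<epsilon>" using p0 e by (simp add: field_simps)
    finally show "norm (Kop (F n) x - Kop (F n) y) < \<epsilon>" .
  qed
  obtain g0 r where g0: "continuous_on {0..T} g0" and r: "strict_mono (r :: nat \<Rightarrow> nat)"
    and lim: "\<And>\<epsilon>. 0 < \<epsilon> \<Longrightarrow> \<exists>N. \<forall>n x. n \<ge> N \<and> x \<in> {0..T} \<longrightarrow> norm (Kop (F (r n)) x - g0 x) < \<epsilon>"
    using Arzela_Ascoli[of "{0..T}" "\<lambda>n. Kop (F n)", OF compact_Icc bound equi] by metis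
  define g where "g t = (if t \<in> {0..T} then g0 t else 0)" for t
  have "continuous_on {0..T} g \<longleftrightarrow> continuous_on {0..T} g0"
    by (rule continuous_on_cong) (auto simp: g_def)
  then have gc: "continuous_on {0..T} g" using g0 by blast
  have gl: "\<exists>N. \<forall>n\<ge>N. \<forall>t\<in>{0..T}. norm (Kop (F (r n)) t - g t) < \<epsilon>" if "0 < \<epsilon>" for \<epsilon>
  proof -
    obtain N where "\<forall>n x. n \<ge> N \<and> x \<in> {0..T} \<longrightarrow> norm (Kop (F (r n)) x - g0 x) < \<epsilon>" using lim[OF \<open>0 < \<epsilon>\<close>] by blast
    then show ?thesis unfolding g_def by (intro exI[of _ N]) simp
  qed
  show thesis by (rule that[OF r gc _ gl]) (auto simp: g_def)
qed

lemma ip_le_uniform: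
  assumes f: "continuous_on {0..T} f" and b: "\<And>t. t \<in> {0..T} \<Longrightarrow> norm (f t) \<le> \<epsilon>"
  shows "ip T f f \<le> \<epsilon>\<^sup>2 * T"
proof -
  have "ip T f f \<le> integral {0..T} (\<lambda>_. \<epsilon>\<^sup>2)"
    unfolding ip_def
  proof (rule integral_le)
    fix t assume "t \<in> {0..T}"
    then show "f t \<bullet> f t \<le> \<epsilon>\<^sup>2" using b[of t] by (simp add: dot_square_norm power_mono)
  qed (auto intro!: integrable_continuous_interval continuous_intros f)
  then show ?thesis using T by (simp add: mult.commute)
qed

lemma hip_le_uniform:
  fixes f g :: "real \<Rightarrow> complex^'n"
  assumes f: "continuous_on {0..T} f" and g: "continuous_on {0..T} g"
    and b: "\<And>t. t \<in> {0..T} \<Longrightarrow> norm (f t) \<le> \<epsilon>" and B: "\<And>t. t \<in> {0..T} \<Longrightarrow> norm (g t) \<le> B"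
  shows "norm (hip T f g) \<le> real CARD('n) * \<epsilon> * B * T"
proof -
  have "norm (integral {0..T} (\<lambda>t. hinner (f t) (g t))) \<le> (real CARD('n) * \<epsilon> * B) * (T - 0)"
  proof (rule integral_bound)
    fix t assume t: "t \<in> {0..T}"
    have "norm (hinner (f t) (g t)) \<le> real CARD('n) * norm (f t) * norm (g t)" by (rule norm_hinner_le)
    also have "\<dots> \<le> real CARD('n) * \<epsilon> * B"
      using b[OF t] B[OF t] norm_ge_zero[of "f t"] norm_ge_zero[of "g t"] by (intro mult_mono mult_left_mono mult_nonneg_nonneg) linarith+
    finally show "norm (hinner (f t) (g t)) \<le> real CARD('n) * \<epsilon> * B" .
  qed (use T f g in \<open>auto intro!: continuous_intros\<close>)
  then show ?thesis by (simp add: hip_def)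
qed

text \<open>The space \<open>S\<close> of continuous functions orthogonal to the given
  eigenfunctions is invariant under \<open>Kop\<close> and contains \<open>F0\<close>, whose
  boundary value need not lie in \<Lambda>. The maximization of the Rayleigh quotient is carried out
  on \<open>S\<close>, so orthogonality of the new eigenfunction is automatic.\<close>

lemma eigen_extension:
  fixes e :: "'k \<Rightarrow> real \<Rightarrow> complex^'n" and \<mu> :: "'k \<Rightarrow> real"
  assumes e: "\<And>j. j \<in> I \<Longrightarrow> eigen \<Lambda> (\<mu> j) (e j)" "\<And>j. j \<in> I \<Longrightarrow> 0 < ip T (e j) (e j)"
    and F0: "C1_path T F0" "F0 0 = 0" "F0 T = 0" "\<And>t. t \<notin> {0..T} \<Longrightarrow> F0 t = 0"
    and F0_orth: "\<And>j. j \<in> I \<Longrightarrow> hip T F0 (e j) = 0"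
    and neg: "qf F0 F0 < 0"
  obtains \<nu> g where "\<nu> < 0" "eigen \<Lambda> \<nu> g" "0 < ip T g g" "\<And>j. j \<in> I \<Longrightarrow> hip T g (e j) = 0"
proof -
  define S where "S = {f. continuous_on {0..T} f \<and> (\<forall>t. t \<notin> {0..T} \<longrightarrow> f t = 0) \<and> (\<forall>j\<in>I. hip T f (e j) = 0)}"
  note ec = eigen_continuous[OF e(1)]
  have Sc: "continuous_on {0..T} f" if "f \<in> S" for f using that by (simp add: S_def)
  have S_add: "f + g \<in> S" if "f \<in> S" "g \<in> S" for f g
    using that hip_add_left[OF _ _ ec, of f g] unfolding S_def plus_fun_def by (auto intro!: continuous_intros)
  have S_diff: "f - g \<in> S" if "f \<in> S" "g \<in> S" for f g
    using that hip_diff_left[OF _ _ ec, of f g] unfolding S_def fun_diff_def by (auto intro!: continuous_intros)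
  have S_scale: "(\<lambda>t. r *\<^sub>R f t) \<in> S" if "f \<in> S" for r f
    using that unfolding S_def by (auto intro!: continuous_intros simp: scaleR_eq_smult hip_smult_left)
  have S_K: "Kop f \<in> S" if f: "f \<in> S" for f
  proof -
    have c: "continuous_on {0..T} f" and o: "\<And>j. j \<in> I \<Longrightarrow> hip T f (e j) = 0" using f by (auto simp: S_def)
    have B: "bvp f (Kop f)" by (rule bvp_Kop[OF c])
    have k: "continuous_on {0..T} (Kop f)" using Kop_C1[OF c] C1_path_continuous by blast
    have "hip T (Kop f) (e j) = 0" if j: "j \<in> I" for j
    proof -
      have "hip T (\<lambda>t. f t - c *\<^sub>R Kop f t) (e j) = complex_of_real (\<mu> j) * hip T (Kop f) (e j)"
        using B by (intro hip_eigen_symmetric[OF lag _ _ _ e(1)[OF j]] continuous_intros c k) (auto simp: bvp_def shifted_def)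
      moreover have "hip T (\<lambda>t. f t - c *\<^sub>R Kop f t) (e j) = hip T f (e j) - complex_of_real c * hip T (Kop f) (e j)"
        using c k ec[OF j] by (simp add: hip_diff_left continuous_on_smult scaleR_eq_smult hip_smult_left)
      ultimately have eq: "complex_of_real (\<mu> j) * hip T (Kop f) (e j) = 0 - complex_of_real c * hip T (Kop f) (e j)"
        using o[OF j] by metis
      \<comment> \<open>Testing the equation for \<open>Kop f\<close> with \<open>e j\<close> leaves
        the factor \<open>\<mu> j + c\<close>, which is positive by
        \<open>eigen_above\<close>.\<close>
      have "complex_of_real (\<mu> j + c) * hip T (Kop f) (e j) = 0"
        unfolding of_real_add distrib_right eq by simp
      then show ?thesis using eigen_above[OF e(1)[OF j] e(2)[OF j]] by (metis less_irrefl mult_eq_0_iff of_real_eq_0_iff)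
    qed
    then show ?thesis using k B unfolding S_def bvp_def by blast
  qed
  have F0S: "F0 \<in> S" using F0 F0_orth C1_path_continuous(1)[OF F0(1)] by (auto simp: S_def)
  have F0c: "continuous_on {0..T} F0" by (rule Sc[OF F0S])
  define \<eta> where "\<eta> = Kop F0"
  have \<eta>: "shifted c F0 \<eta>" "bd \<eta> \<in> \<Lambda>" using bvp_Kop[OF F0c] by (auto simp: \<eta>_def bvp_def)
  have \<eta>c: "continuous_on {0..T} \<eta>" using shifted_C1[OF \<eta>(1)] C1_path_continuous by blast
  have key: "c * ip T F0 F0 < c\<^sup>2 * ip T F0 \<eta>"
  proof -
    \<comment> \<open>This is \<open>F0 - c \<eta>\<close>, at which the coercive form is
      nonnegative. As \<open>F0\<close> vanishes at the ends, the end values are those of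
      \<open>\<eta>\<close> times -c, so the boundary term of \<open>\<eta>\<close> and the term
      with \<open>C\<close> both carry the factor \<open>c^2\<close>, and \<open>bform_le\<close>
      compares them. What remains is
      \<open>0 \<le> c^2 ip T F0 \<eta> - c ip T F0 F0 + qf F0 F0\<close>, and the last term is
      negative.\<close>
    define \<zeta> where "\<zeta> = (\<lambda>t. complex_of_real (- c) *s \<eta> t + F0 t)"
    have C1: "C1_path T \<eta>" by (rule shifted_C1[OF \<eta>(1)])
    have C1z: "C1_path T \<zeta>" unfolding \<zeta>_def by (intro C1_path_add[OF T] C1_path_smult[OF T] C1 F0)
    have q: "qf \<zeta> \<zeta> = c\<^sup>2 * qf \<eta> \<eta> - 2 * c * qf \<eta> F0 + qf F0 F0"
      unfolding \<zeta>_def by (subst qf_add_scaled[OF C1 F0(1)]) simp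
    have "ip T \<zeta> \<zeta> = ip T (\<lambda>t. (- c) *\<^sub>R \<eta> t + F0 t) (\<lambda>t. (- c) *\<^sub>R \<eta> t + F0 t)"
      by (simp only: \<zeta>_def scaleR_eq_smult)
    also have "\<dots> = c\<^sup>2 * ip T \<eta> \<eta> - 2 * c * ip T \<eta> F0 + ip T F0 F0"
    proof -
      let ?z = "\<lambda>t. (- c) *\<^sub>R \<eta> t + F0 t" and ?a = "\<lambda>t. (- c) *\<^sub>R \<eta> t"
      have a: "continuous_on {0..T} ?a" "continuous_on {0..T} ?z" by (intro continuous_intros \<eta>c F0c)+
      have 1: "ip T ?z h = - c * ip T \<eta> h + ip T F0 h" if "continuous_on {0..T} h" for h
        using ip_add_left[OF a(1) F0c that] ip_scaleR_left[of T "- c" \<eta> h] by simp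
      have "ip T ?z ?z = - c * ip T \<eta> ?z + ip T F0 ?z" by (rule 1[OF a(2)])
      also have "\<dots> = - c * (- c * ip T \<eta> \<eta> + ip T \<eta> F0) + (- c * ip T \<eta> F0 + ip T F0 F0)"
        unfolding ip_commute[of T \<eta> ?z] ip_commute[of T F0 ?z] 1[OF \<eta>c] 1[OF F0c] ip_commute[of T F0 \<eta>] by (rule refl)
      finally show ?thesis by (simp add: power2_eq_square algebra_simps)
    qed
    finally have i: "ip T \<zeta> \<zeta> = c\<^sup>2 * ip T \<eta> \<eta> - 2 * c * ip T \<eta> F0 + ip T F0 F0" .
    have "0 \<le> (p0/2) * ip T (dot T \<zeta>) (dot T \<zeta>) + ip T \<zeta> \<zeta>"
      using p0 ip_self_nonneg[of T "dot T \<zeta>"] ip_self_nonneg[of T \<zeta>] by simp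
    also have "\<dots> \<le> qf \<zeta> \<zeta> + c * ip T \<zeta> \<zeta> - C * ((norm (\<zeta> 0))\<^sup>2 + (norm (\<zeta> T))\<^sup>2)"
      by (rule coercive_c[OF C1z])
    finally have 1: "0 \<le> qf \<zeta> \<zeta> + c * ip T \<zeta> \<zeta> - C * ((norm (\<zeta> 0))\<^sup>2 + (norm (\<zeta> T))\<^sup>2)" .
    have z: "\<zeta> 0 = (- c) *\<^sub>R \<eta> 0" "\<zeta> T = (- c) *\<^sub>R \<eta> T" by (simp_all only: \<zeta>_def F0 scaleR_eq_smult add_0_right)
    then have b: "C * ((norm (\<zeta> 0))\<^sup>2 + (norm (\<zeta> T))\<^sup>2) = c\<^sup>2 * (C * ((norm (\<eta> 0))\<^sup>2 + (norm (\<eta> T))\<^sup>2))"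
      by (simp add: power_mult_distrib algebra_simps)
    have e1: "qf \<eta> \<eta> + c * ip T \<eta> \<eta> = ip T F0 \<eta> + bform (bd \<eta>)"
      using shifted_energy[OF \<eta>(1) F0c C1] by (simp add: bform_def bd_def)
    have e2: "qf \<eta> F0 + c * ip T \<eta> F0 = ip T F0 F0"
      using shifted_energy[OF \<eta>(1) F0c F0(1)] F0 by simp
    have bf: "bform (bd \<eta>) \<le> C * ((norm (\<eta> 0))\<^sup>2 + (norm (\<eta> T))\<^sup>2)"
      using bform_le[OF \<eta>(2)] by (simp add: bd_def)
    have "qf \<zeta> \<zeta> + c * ip T \<zeta> \<zeta> = c\<^sup>2 * (qf \<eta> \<eta> + c * ip T \<eta> \<eta>) - 2 * c * (qf \<eta> F0 + c * ip T \<eta> F0) + qf F0 F0 + c * ip T F0 F0"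
      unfolding q i by (simp add: algebra_simps power2_eq_square)
    also have "\<dots> = c\<^sup>2 * ip T F0 \<eta> + c\<^sup>2 * bform (bd \<eta>) - c * ip T F0 F0 + qf F0 F0"
      unfolding e1 e2 by (simp add: algebra_simps)
    finally have 2: "qf \<zeta> \<zeta> + c * ip T \<zeta> \<zeta> = c\<^sup>2 * ip T F0 \<eta> + c\<^sup>2 * bform (bd \<eta>) - c * ip T F0 F0 + qf F0 F0" .
    have "c\<^sup>2 * bform (bd \<eta>) \<le> c\<^sup>2 * (C * ((norm (\<eta> 0))\<^sup>2 + (norm (\<eta> T))\<^sup>2))"
      by (rule mult_left_mono[OF bf]) simp
    then show ?thesis using 1 2 b neg by linarith
  qed
  have F0pos: "0 < ip T F0 F0"
  proof (rule ccontr)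
    assume "\<not> 0 < ip T F0 F0"
    then have z: "ip T F0 F0 = 0" using ip_self_nonneg[of T F0] by linarith
    have "ip T F0 \<eta> = integral {0..T} (\<lambda>t. 0)"
      unfolding ip_def using ip_self_0[OF T F0c z] by (intro integral_cong) simp
    then show False using key z by simp
  qed
  have ex: "\<exists>\<rho> g. 1 / c < \<rho> \<and> g \<in> S \<and> 0 < ip T g g \<and> (\<forall>h\<in>S. ip T (Kop g) h = \<rho> * ip T g h)"
  proof (rule compact_symmetric_eigenvector[where scale = "\<lambda>r f t. r *\<^sub>R f t" and ?f0.0 = F0 and M = 1 and S = S and K = Kop and ip = "ip T"])
    show "f \<in> S \<Longrightarrow> g \<in> S \<Longrightarrow> f + g \<in> S" for f g by (rule S_add)
    show "f \<in> S \<Longrightarrow> g \<in> S \<Longrightarrow> f - g \<in> S" for f g by (rule S_diff)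
    show "f \<in> S \<Longrightarrow> (\<lambda>t. r *\<^sub>R f t) \<in> S" for f r by (rule S_scale)
    show "f \<in> S \<Longrightarrow> g \<in> S \<Longrightarrow> h \<in> S \<Longrightarrow> ip T (f + g) h = ip T f h + ip T g h" for f g h
      unfolding plus_fun_def by (intro ip_add_left Sc)
    show "f \<in> S \<Longrightarrow> g \<in> S \<Longrightarrow> h \<in> S \<Longrightarrow> ip T (f - g) h = ip T f h - ip T g h" for f g h
      unfolding fun_diff_def by (intro ip_diff_left Sc)
    show "ip T (\<lambda>t. r *\<^sub>R f t) h = r * ip T f h" for f h r by (rule ip_scaleR_left)
    show "ip T f g = ip T g f" for f g by (rule ip_commute)
    show "0 \<le> ip T f f" for f by (rule ip_self_nonneg)
    show "f \<in> S \<Longrightarrow> Kop f \<in> S" for f by (rule S_K)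
    show "f \<in> S \<Longrightarrow> g \<in> S \<Longrightarrow> ip T (Kop f) g = ip T f (Kop g)" for f g
      using Kop_symmetric[OF Sc Sc, of f g] Re_hip[OF Sc Sc] S_K by metis
    show "ip T (Kop f) f \<le> 1 * ip T f f" if f: "f \<in> S" for f
    proof -
      have k: "Kop f \<in> S" by (rule S_K[OF f])
      have "0 \<le> ip T (\<lambda>t. f t - Kop f t) (\<lambda>t. f t - Kop f t)" by (rule ip_self_nonneg)
      also have "\<dots> = ip T f f - 2 * ip T (Kop f) f + ip T (Kop f) (Kop f)"
        unfolding ip_commute[of T "Kop f" f] by (rule ip_diff_self[OF Sc[OF f] Sc[OF k]])
      finally have "2 * ip T (Kop f) f \<le> ip T f f + ip T (Kop f) (Kop f)" by simp
      moreover have "0 \<le> p0 * ip T (dot T (Kop f)) (dot T (Kop f))" using p0 ip_self_nonneg[of T "dot T (Kop f)"] by simp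
      ultimately show ?thesis using Kop_energy[OF Sc[OF f]] by linarith
    qed
    show "\<exists>r g. strict_mono r \<and> g \<in> S \<and> (\<lambda>n. ip T (Kop (F (r n)) - g) (Kop (F (r n)) - g)) \<longlonglongrightarrow> 0"
      if F: "\<And>n. F n \<in> S" "\<And>n. ip T (F n) (F n) = 1" for F :: "nat \<Rightarrow> real \<Rightarrow> complex^'n"
    proof -
      obtain r g where r: "strict_mono (r :: nat \<Rightarrow> nat)" and g: "continuous_on {0..T} g" "\<And>t. t \<notin> {0..T} \<Longrightarrow> g t = 0"
        and lim: "\<And>\<epsilon>. 0 < \<epsilon> \<Longrightarrow> \<exists>N. \<forall>n\<ge>N. \<forall>t\<in>{0..T}. norm (Kop (F (r n)) t - g t) < \<epsilon>"
        using Kop_compact[of F] Sc[OF F(1)] F(2) by metis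
      have k: "continuous_on {0..T} (Kop (F n))" for n using Sc S_K F by blast
      have dc: "continuous_on {0..T} (\<lambda>t. Kop (F (r n)) t - g t)" for n by (intro continuous_intros k g)
      have "hip T g (e j) = 0" if j: "j \<in> I" for j
      proof (rule ccontr)
        assume nz: "hip T g (e j) \<noteq> 0"
        have "bounded (e j ` {0..T})" using ec[OF j] by (intro compact_imp_bounded compact_continuous_image) auto
        then obtain B where B: "0 < B" "\<And>t. t \<in> {0..T} \<Longrightarrow> norm (e j t) \<le> B" unfolding bounded_pos by auto
        \<comment> \<open>Uniform closeness \<epsilon> changes the product with \<open>e j\<close>
          by at most half of \<open>norm (hip T g (e j))\<close>, while the product with
          \<open>Kop (F (r n))\<close> is 0.\<close>
        define \<epsilon> where "\<epsilon> = norm (hip T g (e j)) / (2 * real CARD('n) * B * T)"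
        have "0 < \<epsilon>" using nz B T by (simp add: \<epsilon>_def)
        then obtain n where n: "\<And>t. t \<in> {0..T} \<Longrightarrow> norm (Kop (F (r n)) t - g t) < \<epsilon>" using lim by blast
        have "hip T (\<lambda>t. Kop (F (r n)) t - g t) (e j) = - hip T g (e j)"
          using hip_diff_left[OF k g(1) ec[OF j]] S_K[OF F(1)] j by (simp add: S_def)
        moreover have "norm (hip T (\<lambda>t. Kop (F (r n)) t - g t) (e j)) \<le> real CARD('n) * \<epsilon> * B * T"
          using n B by (intro hip_le_uniform dc ec j) (auto intro: less_imp_le)
        moreover have "real CARD('n) * \<epsilon> * B * T = norm (hip T g (e j)) / 2"
          using B T by (simp add: \<epsilon>_def)
        ultimately show False using nz by simp
      qed
      then have "g \<in> S" using g by (auto simp: S_def)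
      moreover have "(\<lambda>n. ip T (Kop (F (r n)) - g) (Kop (F (r n)) - g)) \<longlonglongrightarrow> 0"
      proof (rule LIMSEQ_I)
        fix \<delta> :: real assume d: "0 < \<delta>"
        define \<epsilon> where "\<epsilon> = sqrt (\<delta> / (2 * T))"
        have ee: "0 < \<epsilon>" "\<epsilon>\<^sup>2 * T = \<delta> / 2" using d T by (simp_all add: \<epsilon>_def)
        obtain N where N: "\<forall>n\<ge>N. \<forall>t\<in>{0..T}. norm (Kop (F (r n)) t - g t) < \<epsilon>" using lim[OF ee(1)] by blast
        have "norm (ip T (Kop (F (r n)) - g) (Kop (F (r n)) - g) - 0) < \<delta>" if "n \<ge> N" for n
        proof -
          have "ip T (\<lambda>t. Kop (F (r n)) t - g t) (\<lambda>t. Kop (F (r n)) t - g t) \<le> \<epsilon>\<^sup>2 * T"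
            using N that by (intro ip_le_uniform dc) (auto intro: less_imp_le)
          then show ?thesis
            using ee d ip_self_nonneg[of T "\<lambda>t. Kop (F (r n)) t - g t"] by (simp add: fun_diff_def)
        qed
        then show "\<exists>N. \<forall>n\<ge>N. norm (ip T (Kop (F (r n)) - g) (Kop (F (r n)) - g) - 0) < \<delta>" by blast
      qed
      ultimately show ?thesis using r by blast
    qed
    show "F0 \<in> S" "0 < ip T F0 F0" by fact+
    show "1 / c * ip T F0 F0 < ip T (Kop F0) F0"
    proof -
      have "c * ip T F0 F0 < c * (c * ip T F0 \<eta>)" using key by (simp add: power2_eq_square mult.assoc)
      then have "ip T F0 F0 < c * ip T F0 \<eta>" using c_pos by (simp only: mult_less_cancel_left_pos)
      then have "1 / c * ip T F0 F0 < ip T F0 \<eta>" using c_pos by (simp add: pos_divide_less_eq mult.commute)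
      also have "\<dots> = ip T (Kop F0) F0" unfolding \<eta>_def by (rule ip_commute)
      finally show ?thesis .
    qed
    show "0 \<le> 1 / c" using c_pos by simp
  qed
  obtain \<rho> g where \<rho>: "1 / c < \<rho>" and g: "g \<in> S" "0 < ip T g g"
    and w: "\<And>h. h \<in> S \<Longrightarrow> ip T (Kop g) h = \<rho> * ip T g h" using ex by blast
  have \<rho>pos: "0 < \<rho>" using \<rho> c_pos by (meson divide_pos_pos less_trans zero_less_one)
  have Kg: "Kop g t = \<rho> *\<^sub>R g t" for t
  proof (cases "t \<in> {0..T}")
    case True
    \<comment> \<open>The eigenvalue equation is known only when tested against \<open>S\<close>;
      the defect \<open>h\<close> lies in \<open>S\<close> itself and may be tested with itself, and
      continuity makes it vanish at every point.\<close>
    define h where "h = (\<lambda>t. Kop g t - \<rho> *\<^sub>R g t)"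
    have h: "h \<in> S" using S_diff[OF S_K[OF g(1)] S_scale[OF g(1), of \<rho>]] by (simp add: h_def fun_diff_def)
    have "ip T h h = ip T (Kop g) h - ip T (\<lambda>t. \<rho> *\<^sub>R g t) h"
      unfolding h_def by (intro ip_diff_left Sc S_K g S_scale h[unfolded h_def])
    also have "\<dots> = 0" using w[OF h] by (simp add: ip_scaleR_left)
    finally have "h t = 0" using ip_self_0[OF T Sc[OF h] _ True] by simp
    then show ?thesis by (simp add: h_def)
  next
    case False
    then show ?thesis using g(1) S_K[OF g(1)] by (auto simp: S_def)
  qed
  have B: "bvp g (Kop g)" by (rule bvp_Kop[OF Sc[OF g(1)]])
  define \<nu> where "\<nu> = 1 / \<rho> - c"
  have "\<nu> < 0" using \<rho> \<rho>pos c_pos by (simp add: \<nu>_def field_simps)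
  have gK: "g = (\<lambda>t. complex_of_real (1 / \<rho>) *s Kop g t)"
    using \<rho>pos by (simp add: Kg scaleR_eq_smult)
  have sK: "sol (Kop g) (\<lambda>t. g t - c *\<^sub>R Kop g t)" using B by (simp add: bvp_def shifted_def)
  have "sol (\<lambda>t. complex_of_real (1 / \<rho>) *s Kop g t) (\<lambda>t. complex_of_real (1 / \<rho>) *s (g t - c *\<^sub>R Kop g t))"
    by (rule sol_smult[OF sK])
  moreover have "complex_of_real (1 / \<rho>) *s (g t - c *\<^sub>R Kop g t) = complex_of_real \<nu> *s g t" for t
  proof -
    have "(1 / \<rho>) *\<^sub>R (g t - c *\<^sub>R (\<rho> *\<^sub>R g t)) = \<nu> *\<^sub>R g t"
      using \<rho>pos by (simp add: \<nu>_def scaleR_diff_right scaleR_diff_left)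
    then show ?thesis by (simp only: Kg scaleR_eq_smult[symmetric])
  qed
  ultimately have "sol g (\<lambda>t. complex_of_real \<nu> *s g t)" using gK by simp
  moreover have "bd g \<in> \<Lambda>"
  proof -
    have "bd g = c4n.scale (complex_of_real (1 / \<rho>)) (bd (Kop g))"
      by (subst gK) (rule bd_smult[OF Kop_C1[OF Sc[OF g(1)]]])
    also have "\<dots> \<in> \<Lambda>" using B unfolding bvp_def by (blast intro: lagrangian_scale[OF lag])
    finally show ?thesis .
  qed
  ultimately have "eigen \<Lambda> \<nu> g" using g(1) by (auto simp: eigen_def S_def)
  then show thesis using that[OF \<open>\<nu> < 0\<close> _ g(2)] g(1) by (auto simp: S_def)
qed

end

section \<open>Orthonormal systems and the spectral index\<close>

lemma sum_fun_apply: "(sum f A) t = (\<Sum>a\<in>A. f a t)"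
  by (induction A rule: infinite_finite_induct) auto

lemma hip_self: "continuous_on {0..T} f \<Longrightarrow> hip T f f = complex_of_real (ip T f f)"
proof -
  assume f: "continuous_on {0..T} f"
  have "Im (hip T f f) = 0" using hip_cnj[of T f f] by (metis cnj.sel(2) neg_equal_0_iff_equal neg_equal_iff_equal equation_minus_iff add_eq_0_iff double_zero_sym)
  then show ?thesis using Re_hip[OF f f] by (simp add: complex_eq_iff)
qed

lemma continuous_on_lincomb:
  fixes e :: "'i \<Rightarrow> real \<Rightarrow> complex^'n::finite"
  assumes "\<And>i. i \<in> I \<Longrightarrow> continuous_on S (e i)"
  shows "continuous_on S (\<lambda>t. \<Sum>i\<in>I. c i *s e i t)"
  by (intro continuous_intros assms)

lemma hip_lincomb_left:
  assumes "\<And>i. i \<in> I \<Longrightarrow> continuous_on {0..T} (e i)" "continuous_on {0..T} h" "finite I"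
  shows "hip T (\<lambda>t. \<Sum>i\<in>I. c i *s e i t) h = (\<Sum>i\<in>I. c i * hip T (e i) h)"
  using assms(3,1)
proof (induction I rule: finite_induct)
  case empty
  then show ?case by (simp add: hip_def hinner_sums)
next
  case (insert j I)
  have "hip T (\<lambda>t. c j *s e j t + (\<Sum>i\<in>I. c i *s e i t)) h = hip T (\<lambda>t. c j *s e j t) h + hip T (\<lambda>t. \<Sum>i\<in>I. c i *s e i t) h"
    using insert.prems by (intro hip_add_left continuous_on_smult continuous_on_lincomb assms(2)) auto
  then show ?case using insert by (simp add: hip_smult_left)
qed

text \<open>\<open>dim\<close> is the cardinality of a basis, which is 0 by convention for infinite
  bases; the finite spanning set \<open>A\<close> excludes this case.\<close>

lemma (in vector_space) independent_card_le_dim_span: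
  assumes "independent B" "B \<subseteq> V" "finite A" "V \<subseteq> span A"
  shows "finite B" "card B \<le> dim V"
proof -
  obtain C where C: "C \<subseteq> V" "independent C" "V \<subseteq> span C" "card C = dim V" by (rule basis_exists)
  have "finite C" using independent_span_bound[OF assms(3) C(2)] C(1) assms(4) by blast
  then show "finite B" "card B \<le> dim V"
    using independent_span_bound[of C B] assms(1,2) C by auto
qed

lemma infsum_enat_le:
  fixes f :: "'a \<Rightarrow> enat"
  assumes "\<And>F. finite F \<Longrightarrow> F \<subseteq> A \<Longrightarrow> sum f F \<le> b"
  shows "infsum f A \<le> b"
  by (subst nonneg_infsum_complete) (auto intro!: SUP_least assms)

lemma sum_le_infsum_enat:
  fixes f :: "'a \<Rightarrow> enat"
  assumes "finite F" "F \<subseteq> A"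
  shows "sum f F \<le> infsum f A"
  by (subst nonneg_infsum_complete) (auto intro!: SUP_upper assms)

lemma lagrangian_Lambda_D: "lagrangian (Lambda_D :: 'n::finite c4n set)"
proof -
  let ?U = "(UNIV :: (complex^'n) set) \<times> {0 :: complex^'n}"
  have S2: "c2n.p.subspace ?U"
    by (auto simp: c2n.p.subspace_def c2n.scale_def zero_prod_def)
  have S: "c4n.p.subspace (Lambda_D :: 'n c4n set)"
    by (auto simp: Lambda_D_def c4n.p.subspace_def c4n.scale_def c2n.scale_def zero_prod_def)
  have "vec.dim {0 :: complex^'n} = 0" by (simp add: vec.dim_eq_0)
  then have d2: "c2n.p.dim ?U = vec.dim (UNIV :: (complex^'n) set)"
    using c2n.dim_Times[OF vec.subspace_UNIV, of "{0}"] by (simp add: vec.subspace_single_0)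
  have d4: "c4n.p.dim (Lambda_D :: 'n c4n set) = c2n.p.dim ?U + c2n.p.dim ?U"
    unfolding Lambda_D_def by (rule c4n.dim_Times[OF S2 S2])
  have "c2n.p.dim ((UNIV :: (complex^'n) set) \<times> (UNIV :: (complex^'n) set)) = vec.dim (UNIV :: (complex^'n) set) + vec.dim (UNIV :: (complex^'n) set)"
    by (rule c2n.dim_Times[OF vec.subspace_UNIV vec.subspace_UNIV])
  then have u2: "c2n.p.dim (UNIV :: 'n c2n set) = vec.dim (UNIV :: (complex^'n) set) + vec.dim (UNIV :: (complex^'n) set)"
    by (simp only: UNIV_Times_UNIV)
  have "c4n.p.dim ((UNIV :: 'n c2n set) \<times> (UNIV :: 'n c2n set)) = c2n.p.dim (UNIV :: 'n c2n set) + c2n.p.dim (UNIV :: 'n c2n set)"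
    by (rule c4n.dim_Times[OF c2n.p.subspace_UNIV c2n.p.subspace_UNIV])
  then have u4: "c4n.p.dim (UNIV :: 'n c4n set) = c2n.p.dim (UNIV :: 'n c2n set) + c2n.p.dim (UNIV :: 'n c2n set)"
    by (simp only: UNIV_Times_UNIV)
  have "2 * c4n.p.dim (Lambda_D :: 'n c4n set) = c4n.p.dim (UNIV :: 'n c4n set)"
    unfolding u4 u2 d4 d2 by (simp only: mult_2)
  moreover have "\<forall>a\<in>Lambda_D. \<forall>b\<in>Lambda_D. Omega a (b :: 'n c4n) = 0"
    by (auto simp: Lambda_D_def Omega_def omega_def hinner2_def J_def hinner_sums)
  ultimately show ?thesis using S unfolding lagrangian_def by blast
qed

context sturm
begin

definition spectral_index :: "'n c4n set \<Rightarrow> enat" where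
  "spectral_index \<Lambda> = (\<Sum>\<^sub>\<infinity>\<mu>\<in>{..<0}. edim {\<xi>. eigen \<Lambda> \<mu> \<xi>})"

text \<open>The values \<open>\<mu> i\<close> may repeat, so the length counts eigenvalues with
  multiplicity. The greatest possible length is the index, and this replaces sums of dimensions in
  the comparison.\<close>

definition neg_system :: "'n c4n set \<Rightarrow> nat \<Rightarrow> (nat \<Rightarrow> real \<Rightarrow> complex^'n) \<Rightarrow> (nat \<Rightarrow> real) \<Rightarrow> bool" where
  "neg_system \<Lambda> k e \<mu> \<longleftrightarrow> (\<forall>i<k. \<mu> i < 0 \<and> eigen \<Lambda> (\<mu> i) (e i)) \<and>
     (\<forall>i<k. \<forall>j<k. hip T (e i) (e j) = (if i = j then 1 else 0))"

lemma eigen_orthogonal: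
  assumes L: "lagrangian \<Lambda>" and e: "eigen \<Lambda> \<mu> \<xi>" "eigen \<Lambda> \<nu> \<zeta>" and "\<mu> \<noteq> \<nu>"
  shows "hip T \<xi> \<zeta> = 0"
proof -
  have "hip T (\<lambda>t. complex_of_real \<mu> *s \<xi> t) \<zeta> = complex_of_real \<nu> * hip T \<xi> \<zeta>"
    using e by (intro hip_eigen_symmetric[OF L _ _ _ e(2)] continuous_on_smult eigen_continuous[OF e(1)]) (auto simp: eigen_def)
  then have "complex_of_real \<mu> * hip T \<xi> \<zeta> = complex_of_real \<nu> * hip T \<xi> \<zeta>" by (simp add: hip_smult_left)
  then show ?thesis using \<open>\<mu> \<noteq> \<nu>\<close> by simp
qed

lemma sol_0: "sol (\<lambda>_. 0) (\<lambda>_. 0)"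
proof -
  have C: "C1_path T (\<lambda>_. 0 :: complex^'n)" "\<And>t. t \<in> {0..T} \<Longrightarrow> dot T (\<lambda>_. 0 :: complex^'n) t = 0"
    using C1_pathI[of T "\<lambda>_. 0 :: complex^'n" "\<lambda>_. 0"] T by auto
  have m: "mom (\<lambda>_. 0) t = 0" "low (\<lambda>_. 0) t = 0" if "t \<in> {0..T}" for t
    using C(2)[OF that] by (simp_all add: mom_def low_def)
  show ?thesis unfolding sol_def
  proof (intro conjI ballI C(1))
    fix t assume t: "t \<in> {0..T}"
    show "(mom (\<lambda>_. 0) has_vector_derivative low (\<lambda>_. 0) t - 0) (at t within {0..T})"
      using has_vector_derivative_transform[OF t m(1) has_vector_derivative_const] m(2)[OF t] by simp
  qed
qed

lemma sol_lincomb: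
  assumes "finite I" "\<And>i. i \<in> I \<Longrightarrow> sol (e i) (h i)"
  shows "sol (\<lambda>t. \<Sum>i\<in>I. c i *s e i t) (\<lambda>t. \<Sum>i\<in>I. c i *s h i t)"
  using assms
proof (induction I rule: finite_induct)
  case empty
  then show ?case by (simp add: sol_0)
next
  case (insert j I)
  then have "sol (\<lambda>t. c j *s e j t + (\<Sum>i\<in>I. c i *s e i t)) (\<lambda>t. c j *s h j t + (\<Sum>i\<in>I. c i *s h i t))"
    by (intro sol_add sol_smult) auto
  then show ?case using insert by simp
qed

lemma eigen_subspace:
  assumes L: "lagrangian \<Lambda>"
  shows "cfun.subspace {\<xi>. eigen \<Lambda> \<mu> \<xi>}"
proof (rule cfun.subspaceI)
  have sub: "c4n.p.subspace \<Lambda>" using L by (simp add: lagrangian_def)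
  have z: "bd (\<lambda>_. 0) = 0"
  proof -
    have "bd (\<lambda>t. 0 *s (0 :: complex^'n)) = c4n.scale 0 (bd (\<lambda>_. 0))"
      using bd_smult[of "\<lambda>_. 0" 0] sol_0 by (simp add: sol_def)
    then show ?thesis by simp
  qed
  show "0 \<in> {\<xi>. eigen \<Lambda> \<mu> \<xi>}"
    using sol_0 z c4n.p.subspace_0[OF sub] by (simp add: eigen_def zero_fun_def)
  fix f g assume "f \<in> {\<xi>. eigen \<Lambda> \<mu> \<xi>}" "g \<in> {\<xi>. eigen \<Lambda> \<mu> \<xi>}"
  then have f: "eigen \<Lambda> \<mu> f" and g: "eigen \<Lambda> \<mu> g" by auto
  have "sol (\<lambda>t. f t + g t) (\<lambda>t. complex_of_real \<mu> *s f t + complex_of_real \<mu> *s g t)"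
    using f g by (intro sol_add) (auto simp: eigen_def)
  then have "sol (\<lambda>t. f t + g t) (\<lambda>t. complex_of_real \<mu> *s (f t + g t))"
    by (simp only: vec.scale_right_distrib)
  moreover have "bd (\<lambda>t. f t + g t) \<in> \<Lambda>"
    unfolding bd_add[OF eigen_C1[OF f] eigen_C1[OF g]] using f g
    by (intro c4n.p.subspace_add[OF sub]) (auto simp: eigen_def)
  ultimately show "f + g \<in> {\<xi>. eigen \<Lambda> \<mu> \<xi>}"
    using f g by (auto simp: eigen_def plus_fun_def)
next
  fix c f assume "f \<in> {\<xi>. eigen \<Lambda> \<mu> \<xi>}"
  then have f: "eigen \<Lambda> \<mu> f" by auto
  have "sol (\<lambda>t. c *s f t) (\<lambda>t. c *s (complex_of_real \<mu> *s f t))"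
    using f by (intro sol_smult) (auto simp: eigen_def)
  then have "sol (\<lambda>t. c *s f t) (\<lambda>t. complex_of_real \<mu> *s (c *s f t))"
    by (simp add: mult.commute)
  moreover have "bd (\<lambda>t. c *s f t) \<in> \<Lambda>"
    unfolding bd_smult[OF eigen_C1[OF f]] using f by (intro lagrangian_scale[OF L]) (auto simp: eigen_def)
  ultimately show "(\<lambda>t. c *s f t) \<in> {\<xi>. eigen \<Lambda> \<mu> \<xi>}"
    using f by (auto simp: eigen_def)
qed

lemma neg_system_extend:
  assumes S: "neg_system \<Lambda> k e \<mu>" and g: "\<nu> < 0" "eigen \<Lambda> \<nu> g" "0 < ip T g g"
    and orth: "\<And>j. j < k \<Longrightarrow> hip T g (e j) = 0" and L: "lagrangian \<Lambda>"
  shows "\<exists>e' \<mu>'. neg_system \<Lambda> (Suc k) e' \<mu>'"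
proof -
  define r where "r = complex_of_real (1 / sqrt (ip T g g))"
  define g' where "g' = (\<lambda>t. r *s g t)"
  have "eigen \<Lambda> \<nu> g'"
    using cfun.subspace_scale[OF eigen_subspace[OF L], of g \<nu> r] g(2) by (simp add: g'_def)
  moreover have "hip T g' g' = 1"
  proof -
    have "hip T g' g' = r * (cnj r * complex_of_real (ip T g g))"
      by (simp add: g'_def hip_smult_left hip_smult_right hip_self[OF eigen_continuous[OF g(2)]])
    also have "\<dots> = complex_of_real (1 / sqrt (ip T g g) * (1 / sqrt (ip T g g)) * ip T g g)"
      by (simp only: r_def complex_cnj_complex_of_real of_real_mult mult.assoc)
    also have "1 / sqrt (ip T g g) * (1 / sqrt (ip T g g)) * ip T g g = 1" using g(3) by (simp add: field_simps)
    also have "complex_of_real 1 = 1" by simp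
    finally show ?thesis .
  qed
  moreover have "hip T g' (e j) = 0" "hip T (e j) g' = 0" if "j < k" for j
  proof -
    show "hip T g' (e j) = 0" using orth[OF that] by (simp add: g'_def hip_smult_left)
    then show "hip T (e j) g' = 0" using hip_cnj[of T g' "e j"] by simp
  qed
  ultimately have "neg_system \<Lambda> (Suc k) (e(k := g')) (\<mu>(k := \<nu>))"
    using S g(1) unfolding neg_system_def less_Suc_eq by auto
  then show ?thesis by blast
qed

lemma neg_system_pos:
  assumes "neg_system \<Lambda> k e \<mu>" "j < k"
  shows "0 < ip T (e j) (e j)"
  using assms hip_self[OF eigen_continuous[of \<Lambda> "\<mu> j" "e j"]] by (auto simp: neg_system_def)

text \<open>Subtract from an eigenfunction its projection to the members with the same eigenvalue.
  The rest is orthogonal to these, and to the other members because the eigenvalues differ; if it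
  were not 0, there would be a longer system. So the members span every negative eigenspace.\<close>

lemma spectral_index_le:
  assumes L: "lagrangian \<Lambda>" and S: "neg_system \<Lambda> k e \<mu>"
    and max: "\<And>e' \<mu>'. \<not> neg_system \<Lambda> (Suc k) e' \<mu>'"
  shows "spectral_index \<Lambda> \<le> enat k"
proof -
  define I where "I \<nu> = {i. i < k \<and> \<mu> i = \<nu>}" for \<nu>
  have I: "finite (I \<nu>)" "I \<nu> \<subseteq> {..<k}" for \<nu> by (auto simp: I_def)
  have Ec: "continuous_on {0..T} (e i)" if "i < k" for i
    using S that eigen_continuous unfolding neg_system_def by blast
  have span: "{\<xi>. eigen \<Lambda> \<nu> \<xi>} \<subseteq> cfun.span (e ` I \<nu>)" if \<nu>: "\<nu> < 0" for \<nu>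
  proof
    fix f assume "f \<in> {\<xi>. eigen \<Lambda> \<nu> \<xi>}"
    then have f: "eigen \<Lambda> \<nu> f" by simp
    define p where "p = (\<Sum>i\<in>I \<nu>. (\<lambda>t. hip T f (e i) *s e i t))"
    have p_eq: "p = (\<lambda>t. \<Sum>i\<in>I \<nu>. hip T f (e i) *s e i t)" by (rule ext) (simp add: p_def sum_fun_apply)
    have p: "p \<in> cfun.span (e ` I \<nu>)"
      unfolding p_def by (intro cfun.span_sum cfun.span_scale cfun.span_base) auto
    have "p \<in> {\<xi>. eigen \<Lambda> \<nu> \<xi>}"
      unfolding p_def using S
      by (intro cfun.subspace_sum[OF eigen_subspace[OF L]] cfun.subspace_scale[OF eigen_subspace[OF L]])
         (auto simp: I_def neg_system_def)
    then have g: "eigen \<Lambda> \<nu> (f - p)"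
      using cfun.subspace_diff[OF eigen_subspace[OF L], of f \<nu> p] f by simp
    have fc: "continuous_on {0..T} f" by (rule eigen_continuous[OF f])
    have pc: "continuous_on {0..T} p"
      unfolding p_eq by (intro continuous_on_lincomb Ec) (auto simp: I_def)
    have orth: "hip T (f - p) (e j) = 0" if j: "j < k" for j
    proof (cases "\<mu> j = \<nu>")
      case False
      then show ?thesis using S j by (intro eigen_orthogonal[OF L g, of "\<mu> j"]) (auto simp: neg_system_def)
    next
      case True
      then have jI: "j \<in> I \<nu>" using j by (simp add: I_def)
      have "hip T p (e j) = (\<Sum>i\<in>I \<nu>. hip T f (e i) * hip T (e i) (e j))"
        unfolding p_eq by (rule hip_lincomb_left) (use I Ec j in auto)
      also have "\<dots> = (\<Sum>i\<in>I \<nu>. if i = j then hip T f (e j) else 0)"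
        using S j by (intro sum.cong) (auto simp: neg_system_def I_def)
      also have "\<dots> = hip T f (e j)" using jI I by simp
      finally show ?thesis using hip_diff_left[OF fc pc Ec[OF j]] by (simp add: fun_diff_def)
    qed
    have "\<not> 0 < ip T (f - p) (f - p)"
      using neg_system_extend[OF S \<nu> g _ orth L] max by blast
    then have "ip T (f - p) (f - p) = 0" using ip_self_nonneg[of T "f - p"] by linarith
    then have "(f - p) t = 0" if "t \<in> {0..T}" for t
      using ip_self_0[OF T eigen_continuous[OF g] _ that] by blast
    moreover have "(f - p) t = 0" if "t \<notin> {0..T}" for t using g that unfolding eigen_def by blast
    ultimately have "f - p = 0" by (metis ext zero_fun_apply)
    then show "f \<in> cfun.span (e ` I \<nu>)" using p by simp
  qed
  have dim: "edim {\<xi>. eigen \<Lambda> \<nu> \<xi>} \<le> enat (card (I \<nu>))" if "\<nu> < 0" for \<nu>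
  proof -
    have "edim {\<xi>. eigen \<Lambda> \<nu> \<xi>} = enat (cfun.dim {\<xi>. eigen \<Lambda> \<nu> \<xi>})"
      unfolding edim_def using span[OF that] I by (meson finite_imageI)
    moreover have "cfun.dim {\<xi>. eigen \<Lambda> \<nu> \<xi>} \<le> card (e ` I \<nu>)"
      by (rule cfun.dim_le_card[OF span[OF that]]) (simp add: I)
    moreover have "card (e ` I \<nu>) \<le> card (I \<nu>)" by (rule card_image_le[OF I(1)])
    ultimately show ?thesis by simp
  qed
  show ?thesis
    unfolding spectral_index_def
  proof (rule infsum_enat_le)
    fix F :: "real set" assume F: "finite F" "F \<subseteq> {..<0}"
    have "(\<Sum>\<nu>\<in>F. edim {\<xi>. eigen \<Lambda> \<nu> \<xi>}) \<le> (\<Sum>\<nu>\<in>F. enat (card (I \<nu>)))"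
      using F dim by (intro sum_mono) auto
    also have "\<dots> = enat (\<Sum>\<nu>\<in>F. card (I \<nu>))" by (rule of_nat_sum[where 'a = enat, unfolded of_nat_eq_enat, symmetric])
    also have "(\<Sum>\<nu>\<in>F. card (I \<nu>)) = card (\<Union>\<nu>\<in>F. I \<nu>)"
      using F I by (intro card_UN_disjoint[symmetric]) (auto simp: I_def)
    also have "\<dots> \<le> card {..<k}" using I(2) by (intro card_mono) auto
    finally show "(\<Sum>\<nu>\<in>F. edim {\<xi>. eigen \<Lambda> \<nu> \<xi>}) \<le> enat k" by simp
  qed
qed

text \<open>Members with the same eigenvalue are independent in its eigenspace, so their number is
  at most its dimension; finitely many eigenvalues occur, and their partial sum is below the
  index.\<close>

lemma neg_system_le_spectral_index:
  assumes S: "neg_system \<Lambda> k e \<mu>"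
  shows "enat k \<le> spectral_index \<Lambda>"
proof -
  define I where "I \<nu> = {i. i < k \<and> \<mu> i = \<nu>}" for \<nu>
  have I: "finite (I \<nu>)" for \<nu> by (auto simp: I_def)
  have on: "hip T (e i) (e j) = (if i = j then 1 else 0)" if "i < k" "j < k" for i j
    using S that unfolding neg_system_def by blast
  have Ec: "continuous_on {0..T} (e i)" if "i < k" for i
    using S that eigen_continuous unfolding neg_system_def by blast
  have inj: "inj_on e {..<k}"
    using on by (intro inj_onI) (metis lessThan_iff zero_neq_one)
  have dim: "enat (card (I \<nu>)) \<le> edim {\<xi>. eigen \<Lambda> \<nu> \<xi>}" for \<nu>
  proof (cases "\<exists>B. finite B \<and> {\<xi>. eigen \<Lambda> \<nu> \<xi>} \<subseteq> cfun.span B")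
    case True
    then obtain B where B: "finite B" "{\<xi>. eigen \<Lambda> \<nu> \<xi>} \<subseteq> cfun.span B" by blast
    have injI: "inj_on e (I \<nu>)" using inj by (rule inj_on_subset) (auto simp: I_def)
    have "cfun.independent (e ` I \<nu>)"
    proof
      assume "cfun.dependent (e ` I \<nu>)"
      then obtain u v where u: "v \<in> e ` I \<nu>" "u v \<noteq> 0" "(\<Sum>w\<in>e ` I \<nu>. (\<lambda>t. u w *s w t)) = 0"
        using cfun.dependent_finite[of "e ` I \<nu>"] I by auto
      obtain j where j: "j \<in> I \<nu>" "v = e j" using u(1) by blast
      then have jk: "j < k" by (simp add: I_def)
      have "(\<lambda>t. \<Sum>i\<in>I \<nu>. u (e i) *s e i t) = (\<lambda>_. 0)"
        using u(3) by (auto simp: sum.reindex[OF injI] fun_eq_iff sum_fun_apply)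
      then have "0 = hip T (\<lambda>t. \<Sum>i\<in>I \<nu>. u (e i) *s e i t) (e j)" by (simp add: hip_def hinner_sums)
      also have "\<dots> = (\<Sum>i\<in>I \<nu>. u (e i) * hip T (e i) (e j))"
        by (rule hip_lincomb_left) (use I Ec jk in \<open>auto simp: I_def\<close>)
      also have "\<dots> = (\<Sum>i\<in>I \<nu>. if i = j then u (e j) else 0)"
        using on jk by (intro sum.cong) (auto simp: I_def)
      also have "\<dots> = u (e j)" using j I by simp
      finally show False using u(2) j(2) by simp
    qed
    moreover have "e ` I \<nu> \<subseteq> {\<xi>. eigen \<Lambda> \<nu> \<xi>}" using S by (auto simp: I_def neg_system_def)
    ultimately have "card (e ` I \<nu>) \<le> cfun.dim {\<xi>. eigen \<Lambda> \<nu> \<xi>}"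
      using cfun.independent_card_le_dim_span(2) B by blast
    then show ?thesis using True unfolding edim_def by (simp add: card_image[OF injI])
  next
    case False
    then have "edim {\<xi>. eigen \<Lambda> \<nu> \<xi>} = \<infinity>" unfolding edim_def by (rule if_not_P)
    then show ?thesis by simp
  qed
  define F where "F = \<mu> ` {..<k}"
  have F: "finite F" "F \<subseteq> {..<0}" using S by (auto simp: F_def neg_system_def)
  have "{..<k} = (\<Union>\<nu>\<in>F. I \<nu>)" by (auto simp: F_def I_def)
  then have "k = card (\<Union>\<nu>\<in>F. I \<nu>)" by (metis card_lessThan)
  also have "\<dots> = (\<Sum>\<nu>\<in>F. card (I \<nu>))"
    using F I by (intro card_UN_disjoint) (auto simp: I_def)
  finally have "enat k = (\<Sum>\<nu>\<in>F. enat (card (I \<nu>)))"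
    using of_nat_sum[where 'a = enat, unfolded of_nat_eq_enat] by metis
  also have "\<dots> \<le> (\<Sum>\<nu>\<in>F. edim {\<xi>. eigen \<Lambda> \<nu> \<xi>})" by (intro sum_mono dim)
  also have "\<dots> \<le> spectral_index \<Lambda>" unfolding spectral_index_def by (rule sum_le_infsum_enat[OF F])
  finally show ?thesis .
qed

text \<open>A bound on the lengths yields a system of greatest length, to which both estimates of
  the index apply.\<close>

lemma bounded_systems:
  assumes L: "lagrangian \<Lambda>" and b: "\<And>k e \<mu>. neg_system \<Lambda> k e \<mu> \<Longrightarrow> k \<le> b"
  obtains k e \<mu> where "neg_system \<Lambda> k e \<mu>" "\<And>e' \<mu>'. \<not> neg_system \<Lambda> (Suc k) e' \<mu>'" "spectral_index \<Lambda> = enat k"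
proof -
  have "neg_system \<Lambda> 0 (\<lambda>_ _. 0) (\<lambda>_. 0)" by (simp add: neg_system_def)
  then have "\<exists>k. (\<exists>e \<mu>. neg_system \<Lambda> k e \<mu>)" by blast
  then obtain k where k: "\<exists>e \<mu>. neg_system \<Lambda> k e \<mu>" "\<And>l. \<exists>e \<mu>. neg_system \<Lambda> l e \<mu> \<Longrightarrow> l \<le> k"
    using Nat.ex_has_greatest_nat[of "\<lambda>k. \<exists>e \<mu>. neg_system \<Lambda> k e \<mu>" _ b] b by blast
  then obtain e \<mu> where S: "neg_system \<Lambda> k e \<mu>" by blast
  have m: "\<not> neg_system \<Lambda> (Suc k) e' \<mu>'" for e' \<mu>' using k(2)[of "Suc k"] by (metis Suc_n_not_le_n)
  then show thesis
    using that[OF S m] spectral_index_le[OF L S m] neg_system_le_spectral_index[OF S] by (metis antisym)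
qed

text \<open>The combination \<xi> vanishes at both ends, so Green's formula has no boundary term,
  and orthonormality gives the value \<Sum> \<mu>(i) |c(i)|^2 < 0 of the form. By
  \<open>eigen_extension\<close> the system for \<Lambda>' could then be enlarged.\<close>

lemma neg_system_transfer:
  assumes L: "lagrangian \<Lambda>" "lagrangian \<Lambda>'" and S: "neg_system \<Lambda> N e \<mu>" and S': "neg_system \<Lambda>' k e' \<mu>'"
    and max: "\<And>e' \<mu>'. \<not> neg_system \<Lambda>' (Suc k) e' \<mu>'"
    and c: "\<exists>i<N. c i \<noteq> 0" "\<And>j. j < k \<Longrightarrow> (\<Sum>i<N. c i * hip T (e i) (e' j)) = 0"
    and ends: "(\<Sum>i<N. c i *s e i 0) = 0" "(\<Sum>i<N. c i *s e i T) = 0"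
  shows False
proof -
  define \<xi> where "\<xi> = (\<lambda>t. \<Sum>i<N. c i *s e i t)"
  define h where "h = (\<lambda>t. \<Sum>i<N. c i *s (complex_of_real (\<mu> i) *s e i t))"
  have E: "eigen \<Lambda> (\<mu> i) (e i)" "\<mu> i < 0" if "i < N" for i using S that by (auto simp: neg_system_def)
  have Ec: "continuous_on {0..T} (e i)" if "i < N" for i using eigen_continuous[OF E(1)[OF that]] .
  have sol: "sol \<xi> h" unfolding \<xi>_def h_def by (rule sol_lincomb) (use E in \<open>auto simp: eigen_def\<close>)
  then have C: "C1_path T \<xi>" by (simp add: sol_def)
  have hc: "continuous_on {0..T} h" unfolding h_def by (intro continuous_on_lincomb continuous_on_smult Ec) auto
  have \<xi>c: "continuous_on {0..T} \<xi>" using C C1_path_continuous by blast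
  have on: "hip T (e i) (e j) = (if i = j then 1 else 0)" if "i < N" "j < N" for i j
    using S that unfolding neg_system_def by blast
  have "hip T \<xi> (e j) = c j" if j: "j < N" for j
  proof -
    have "hip T \<xi> (e j) = (\<Sum>i<N. c i * hip T (e i) (e j))"
      unfolding \<xi>_def by (rule hip_lincomb_left) (use Ec j in auto)
    also have "\<dots> = (\<Sum>i<N. if i = j then c j else 0)" using on j by (intro sum.cong) auto
    also have "\<dots> = c j" using j by simp
    finally show ?thesis .
  qed
  then have ej: "hip T (e j) \<xi> = cnj (c j)" if "j < N" for j using that hip_cnj[of T \<xi> "e j"] by simp
  have "hip T h \<xi> = (\<Sum>i<N. (c i * complex_of_real (\<mu> i)) * hip T (e i) \<xi>)"
  proof -
    have "h = (\<lambda>t. \<Sum>i<N. (c i * complex_of_real (\<mu> i)) *s e i t)" by (simp add: h_def)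
    then show ?thesis using hip_lincomb_left[of "{..<N}" T e \<xi> "\<lambda>i. c i * complex_of_real (\<mu> i)"] Ec \<xi>c by simp
  qed
  also have "\<dots> = (\<Sum>i<N. complex_of_real (\<mu> i * (cmod (c i))\<^sup>2))"
  proof (rule sum.cong[OF refl])
    fix i assume "i \<in> {..<N}"
    have "c i * cnj (c i) = complex_of_real ((cmod (c i))\<^sup>2)" by (simp only: complex_norm_square)
    then show "c i * complex_of_real (\<mu> i) * hip T (e i) \<xi> = complex_of_real (\<mu> i * (cmod (c i))\<^sup>2)"
      using ej \<open>i \<in> _\<close> by (simp add: mult.commute mult.left_commute)
  qed
  finally have "ip T h \<xi> = (\<Sum>i<N. \<mu> i * (cmod (c i))\<^sup>2)"
    using Re_hip[OF hc \<xi>c] by simp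
  also have "\<dots> < (\<Sum>i<N. 0)"
  proof (rule sum_strict_mono_ex1)
    show "\<forall>i\<in>{..<N}. \<mu> i * (cmod (c i))\<^sup>2 \<le> 0" using E(2) by (auto simp: mult_le_0_iff less_imp_le)
    show "\<exists>i\<in>{..<N}. \<mu> i * (cmod (c i))\<^sup>2 < 0" using E(2) c(1) by (auto simp: mult_less_0_iff)
  qed simp
  finally have neg: "qf \<xi> \<xi> < 0"
    using qf_green[OF sol hc C] ends by (simp add: \<xi>_def)
  \<comment> \<open>The boundary constant and the shift have to suit \<Lambda>', under which the new
    eigenfunction is sought.\<close>
  obtain C where Cb: "0 \<le> C" "\<And>a. a \<in> \<Lambda>' \<Longrightarrow> bform a \<le> C * ((norm (snd (fst a)))\<^sup>2 + (norm (snd (snd a)))\<^sup>2)"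
    using lagrangian_bform_bound[OF L(2)] by blast
  obtain d where d: "0 < d" "\<And>\<xi>. C1_path T \<xi> \<Longrightarrow> (p0/2) * ip T (dot T \<xi>) (dot T \<xi>) + ip T \<xi> \<xi>
      \<le> qf \<xi> \<xi> + d * ip T \<xi> \<xi> - C * ((norm (\<xi> 0))\<^sup>2 + (norm (\<xi> T))\<^sup>2)"
    using coercive[OF Cb(1)] by blast
  interpret coercive_bvp T P Q Q' R p0 \<Lambda>' C d
    using L(2) d Cb by unfold_locales auto
  have E': "eigen \<Lambda>' (\<mu>' j) (e' j)" if "j < k" for j using S' that by (auto simp: neg_system_def)
  have orth: "hip T \<xi> (e' j) = 0" if "j < k" for j
    unfolding \<xi>_def using c(2)[OF that]
    by (subst hip_lincomb_left) (use Ec eigen_continuous[OF E'[OF that]] in auto)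
  have out: "\<xi> t = 0" if "t \<notin> {0..T}" for t
    using E(1) that unfolding \<xi>_def eigen_def by (intro sum.neutral) auto
  obtain \<nu> g where "\<nu> < 0" "eigen \<Lambda>' \<nu> g" "0 < ip T g g" "\<And>j. j \<in> {..<k} \<Longrightarrow> hip T g (e' j) = 0"
  proof (rule eigen_extension[of "{..<k}" \<mu>' e' \<xi>])
    show "\<xi> 0 = 0" "\<xi> T = 0" using ends by (simp_all add: \<xi>_def)
  qed (use E' neg_system_pos[OF S'] C out orth neg in auto)
  then show False using neg_system_extend[OF S' _ _ _ _ L(2)] max by (metis lessThan_iff)
qed

section \<open>The two index inequalities\<close>

theorem spectral_index_Dirichlet_le:
  assumes L: "lagrangian \<Lambda>"
  shows "spectral_index Lambda_D \<le> spectral_index \<Lambda>"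
proof (cases "spectral_index \<Lambda>")
  case (enat b)
  have "k \<le> b" if "neg_system \<Lambda> k e \<mu>" for k e \<mu>
    using neg_system_le_spectral_index[OF that] enat by simp
  then obtain k e' \<mu>' where k: "neg_system \<Lambda> k e' \<mu>'" "\<And>e' \<mu>'. \<not> neg_system \<Lambda> (Suc k) e' \<mu>'" "spectral_index \<Lambda> = enat k"
    using bounded_systems[OF L] by metis
  have "N \<le> k" if S: "neg_system Lambda_D N e \<mu>" for N e \<mu>
  proof (rule ccontr)
    assume "\<not> N \<le> k"
    then obtain c where c: "\<exists>i<N. c i \<noteq> 0" "\<forall>j<k. (\<Sum>i<N. c i * hip T (e i) (e' j)) = 0"
      using homogeneous_system_nontrivial[of k N "\<lambda>j i. hip T (e i) (e' j)"] by auto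
    \<comment> \<open>Dirichlet eigenfunctions vanish at both ends, so orthogonality contributes the
      only conditions on the coefficients.\<close>
    have "e i 0 = 0" "e i T = 0" if "i < N" for i
      using S that by (auto simp: neg_system_def eigen_def bd_def Lambda_D_def)
    then show False using c by (intro neg_system_transfer[OF lagrangian_Lambda_D L S k(1,2), of c]) auto
  qed
  then obtain N where "spectral_index Lambda_D = enat N" "N \<le> k"
    using bounded_systems[OF lagrangian_Lambda_D] by metis
  then show ?thesis using k(3) by simp
qed simp

theorem spectral_index_le_Dirichlet:
  assumes L: "lagrangian \<Lambda>"
  shows "spectral_index \<Lambda> \<le> spectral_index Lambda_D + enat (nu \<Lambda>)"
proof (cases "spectral_index (Lambda_D :: 'n c4n set)")
  case (enat b)
  have "k \<le> b" if "neg_system Lambda_D k e \<mu>" for k e \<mu>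
    using neg_system_le_spectral_index[OF that] enat by simp
  then obtain k e' \<mu>' where k: "neg_system Lambda_D k e' \<mu>'" "\<And>e' \<mu>'. \<not> neg_system Lambda_D (Suc k) e' \<mu>'"
      "spectral_index Lambda_D = enat k"
    using bounded_systems[OF lagrangian_Lambda_D] by metis
  obtain B where B: "B \<subseteq> V_space \<Lambda>" "c4n.p.independent B" "V_space \<Lambda> \<subseteq> c4n.p.span B" "card B = nu \<Lambda>"
    unfolding nu_def by (rule c4n.p.basis_exists)
  have fB: "finite B" using B(2) by (rule c4n.p.finiteI_independent)
  obtain b where b: "bij_betw b {..<nu \<Lambda>} B"
    using ex_bij_betw_nat_finite[OF fB] B(4) by (auto simp: atLeast0LessThan)
  have "N \<le> k + nu \<Lambda>" if S: "neg_system \<Lambda> N e \<mu>" for N e \<mu>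
  proof (rule ccontr)
    assume N: "\<not> N \<le> k + nu \<Lambda>"
    \<comment> \<open>The boundary value of \<open>e i\<close> with its momenta removed. The part
      removed lies in \<open>Lambda_D\<close> and the result in \<open>Lambda_N\<close>, hence
      \<open>v i\<close> is in \<open>V_space \<Lambda>\<close>.\<close>
    define v where "v i = (((0, e i 0), (0, e i T)) :: 'n c4n)" for i
    have v: "v i \<in> c4n.p.span B" if "i < N" for i
    proof -
      have "bd (e i) \<in> \<Lambda>" using S that by (auto simp: neg_system_def eigen_def)
      moreover have "((- mom (e i) 0, 0), (- mom (e i) T, 0)) \<in> Lambda_D" by (simp add: Lambda_D_def)
      moreover have "v i = bd (e i) + ((- mom (e i) 0, 0), (- mom (e i) T, 0))" by (simp add: v_def bd_def)
      moreover have "v i \<in> Lambda_N" by (simp add: v_def Lambda_N_def)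
      ultimately have "v i \<in> V_space \<Lambda>" unfolding V_space_def by blast
      then show ?thesis using B(3) by blast
    qed
    \<comment> \<open>The first \<open>k\<close> rows express orthogonality; the other
      \<open>nu \<Lambda>\<close> rows are the coordinates of \<open>v i\<close> in the basis
      \<open>B\<close>, and their vanishing annihilates both end positions of the
      combination.\<close>
    define \<phi> where "\<phi> j i = (if j < k then hip T (e i) (e' j) else c4n.p.representation B (v i) (b (j - k)))" for j i
    obtain c where c: "\<exists>i<N. c i \<noteq> 0" "\<forall>j<k + nu \<Lambda>. (\<Sum>i<N. c i * \<phi> j i) = 0"
      using homogeneous_system_nontrivial[of "k + nu \<Lambda>" N \<phi>] N by auto
    have c1: "(\<Sum>i<N. c i * hip T (e i) (e' j)) = 0" if "j < k" for j
      using c(2)[rule_format, of j] that by (simp add: \<phi>_def)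
    have c2: "(\<Sum>i<N. c i * c4n.p.representation B (v i) w) = 0" if w: "w \<in> B" for w
    proof -
      obtain j where "j < nu \<Lambda>" "w = b j" using b w by (auto simp: bij_betw_def)
      then show ?thesis using c(2)[rule_format, of "k + j"] by (simp add: \<phi>_def)
    qed
    have "(\<Sum>i<N. c4n.scale (c i) (v i)) = (\<Sum>i<N. c4n.scale (c i) (\<Sum>w\<in>B. c4n.scale (c4n.p.representation B (v i) w) w))"
      using c4n.p.sum_representation_eq[OF B(2) v fB order_refl] by (intro sum.cong) auto
    also have "\<dots> = (\<Sum>i<N. \<Sum>w\<in>B. c4n.scale (c i * c4n.p.representation B (v i) w) w)"
      by (simp add: c4n.p.scale_sum_right)
    also have "\<dots> = (\<Sum>w\<in>B. \<Sum>i<N. c4n.scale (c i * c4n.p.representation B (v i) w) w)"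
      by (rule sum.swap)
    also have "\<dots> = (\<Sum>w\<in>B. c4n.scale (\<Sum>i<N. c i * c4n.p.representation B (v i) w) w)"
      by (simp add: c4n.p.scale_sum_left)
    also have "\<dots> = 0" using c2 by simp
    finally have z: "(\<Sum>i<N. c4n.scale (c i) (v i)) = 0" .
    have "snd (fst (\<Sum>i<N. c4n.scale (c i) (v i))) = (\<Sum>i<N. c i *s e i 0)"
      "snd (snd (\<Sum>i<N. c4n.scale (c i) (v i))) = (\<Sum>i<N. c i *s e i T)"
      by (simp_all add: fst_sum snd_sum v_def c4n.scale_def c2n.scale_def)
    then have "(\<Sum>i<N. c i *s e i 0) = 0" "(\<Sum>i<N. c i *s e i T) = 0" using z by simp_all
    then show False using c(1) c1 by (intro neg_system_transfer[OF L lagrangian_Lambda_D S k(1,2), of c]) auto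
  qed
  then obtain N where "spectral_index \<Lambda> = enat N" "N \<le> k + nu \<Lambda>"
    using bounded_systems[OF L] by metis
  then show ?thesis using k(3) by simp
qed simp

end

section \<open>Weak derivatives and second derivatives\<close>

lemma L2_on_absolutely_integrable:
  fixes g :: "real \<Rightarrow> 'a::euclidean_space"
  assumes "L2_on T g"
  shows "g absolutely_integrable_on {0..T}"
proof (rule set_integrable_bound)
  have "set_integrable lebesgue {0..T} (\<lambda>t. (norm (g t))\<^sup>2)" "set_borel_measurable lebesgue {0..T} g"
    using assms by (auto simp: L2_on_def)
  then show "set_integrable lebesgue {0..T} (\<lambda>t. 1 + (norm (g t))\<^sup>2)"
    by (intro set_integral_add) (auto intro: absolutely_integrable_continuous_real)
  show "set_borel_measurable lebesgue {0..T} g" by fact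
  have "norm (g t) \<le> 1 + (norm (g t))\<^sup>2" for t
    using zero_le_power2[of "norm (g t) - 1 / 2"] by (simp add: power2_eq_square algebra_simps)
  then show "AE t in lebesgue. t \<in> {0..T} \<longrightarrow> norm (g t) \<le> norm (1 + (norm (g t))\<^sup>2)"
    by (auto intro: order_trans[OF _ abs_ge_self])
qed

lemma has_weak_deriv_integral:
  fixes g :: "real \<Rightarrow> 'a::euclidean_space"
  assumes "has_weak_deriv T f g"
  shows "g integrable_on {0..T}" and "t \<in> {0..T} \<Longrightarrow> f t = f 0 + integral {0..t} g"
proof -
  have g: "g absolutely_integrable_on {0..T}"
    using assms L2_on_absolutely_integrable by (auto simp: has_weak_deriv_def)
  then show "g integrable_on {0..T}" by (rule set_lebesgue_integral_eq_integral)
  assume t: "t \<in> {0..T}"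
  then have "g absolutely_integrable_on {0..t}" by (intro set_integrable_subset[OF g]) auto
  then show "f t = f 0 + integral {0..t} g"
    using assms t set_lebesgue_integral_eq_integral(2) unfolding has_weak_deriv_def by metis
qed

text \<open>Lebesgue differentiation: the difference \<open>d\<close> has vanishing primitive, and
  at almost every point it is the limit of its averages over short intervals to the right.\<close>

lemma has_weak_deriv_unique:
  fixes g h :: "real \<Rightarrow> 'a::euclidean_space"
  assumes g: "has_weak_deriv T f g" and h: "has_weak_deriv T f h"
  shows "AE t\<in>{0..T} in lebesgue. g t = h t"
proof -
  define d where "d t = g t - h t" for t
  have d: "d integrable_on {0..T}"
    unfolding d_def by (intro integrable_diff has_weak_deriv_integral(1)[OF g] has_weak_deriv_integral(1)[OF h])
  have d0: "integral {0..t} d = 0" if "t \<in> {0..T}" for t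
  proof -
    have "g integrable_on {0..t}" "h integrable_on {0..t}"
      using that by (auto intro: integrable_subinterval_real has_weak_deriv_integral(1)[OF g] has_weak_deriv_integral(1)[OF h])
    then have "integral {0..t} d = integral {0..t} g - integral {0..t} h"
      unfolding d_def by (rule integral_diff)
    then show ?thesis using has_weak_deriv_integral(2)[OF g that] has_weak_deriv_integral(2)[OF h that] by simp
  qed
  \<comment> \<open>Extension by zero makes the differentiation theorem for functions on the whole
    line applicable.\<close>
  define D where "D t = (if t \<in> {0..T} then d t else 0)" for t
  have "D integrable_on UNIV" unfolding D_def using d by (simp only: integrable_restrict_UNIV)
  then have "D integrable_on cbox a b" for a b
    using integrable_on_subcbox by blast
  then obtain N where N: "negligible N"
    and lim: "\<And>x e. \<lbrakk>x \<notin> N; 0 < e\<rbrakk> \<Longrightarrow> \<exists>\<delta>>0. \<forall>s. 0 < s \<and> s < \<delta> \<longrightarrow>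
                norm (integral (cbox x (x + s *\<^sub>R One)) D /\<^sub>R s ^ DIM(real) - D x) < e"
    using integrable_ccontinuous_explicit[of D] by blast
  have "d x = 0" if x: "x \<notin> N" "0 \<le> x" "x < T" for x
  proof (rule ccontr)
    assume nz: "d x \<noteq> 0"
    then have "0 < norm (d x)" by simp
    from lim[OF x(1) this] obtain \<delta> where \<delta>: "\<delta> > 0"
      "\<And>s. 0 < s \<and> s < \<delta> \<Longrightarrow> norm (integral (cbox x (x + s *\<^sub>R One)) D /\<^sub>R s ^ DIM(real) - D x) < norm (d x)"
      by blast
    define s where "s = min (\<delta> / 2) (T - x)"
    have s: "0 < s" "s < \<delta>" "x + s \<le> T" using \<delta>(1) x by (auto simp: s_def min_def)
    have "integral {x..x + s} D = integral {x..x + s} d"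
      using s x by (intro integral_cong) (auto simp: D_def)
    also have "\<dots> = integral {0..x + s} d - integral {0..x} d"
    proof -
      have "d integrable_on {0..x + s}" using s x by (auto intro: integrable_subinterval_real[OF d])
      from Henstock_Kurzweil_Integration.integral_combine[OF _ _ this, of x] s x show ?thesis by (simp add: algebra_simps)
    qed
    also have "\<dots> = 0" using d0[of "x + s"] d0[of x] s x by simp
    finally show False using \<delta>(2)[of s] s x by (simp add: D_def)
  qed
  \<comment> \<open>The averages are taken to the right, so \<open>T\<close> has to join the
    exceptional set.\<close>
  then have "{t \<in> {0..T}. g t \<noteq> h t} \<subseteq> N \<union> {T}" unfolding d_def by force
  moreover have "negligible (N \<union> {T})" using N by simp
  ultimately have "{t \<in> {0..T}. g t \<noteq> h t} \<in> null_sets lebesgue"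
    using negligible_subset negligible_iff_null_sets by blast
  then have "AE t in lebesgue. t \<notin> {t \<in> {0..T}. g t \<noteq> h t}" by (rule AE_not_in)
  then show ?thesis by (auto elim: eventually_mono)
qed

lemma has_weak_derivI:
  fixes f h :: "real \<Rightarrow> 'a::euclidean_space"
  assumes "\<And>t. t \<in> {0..T} \<Longrightarrow> (f has_vector_derivative h t) (at t within {0..T})"
    and h: "continuous_on {0..T} h"
  shows "has_weak_deriv T f h"
  unfolding has_weak_deriv_def L2_on_def
proof (intro conjI ballI)
  have "h absolutely_integrable_on {0..T}" by (rule absolutely_integrable_continuous_real[OF h])
  then show "set_borel_measurable lebesgue {0..T} h"
    unfolding set_integrable_def set_borel_measurable_def by (rule borel_measurable_integrable)
  show "set_integrable lebesgue {0..T} (\<lambda>t. (norm (h t))\<^sup>2)"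
    by (intro absolutely_integrable_continuous_real continuous_intros h)
  fix t assume t: "t \<in> {0..T}"
  then have sub: "{0..t} \<subseteq> {0..T}" by auto
  have "(h has_integral f t - f 0) {0..t}"
  proof (rule fundamental_theorem_of_calculus)
    fix s assume "s \<in> {0..t}"
    then show "(f has_vector_derivative h s) (at s within {0..t})"
      using assms(1)[of s] sub has_vector_derivative_within_subset by blast
  qed (use t in auto)
  then have "integral {0..t} h = f t - f 0" by (rule integral_unique)
  moreover have "(LINT s:{0..t}|lebesgue. h s) = integral {0..t} h"
    by (intro set_lebesgue_integral_eq_integral absolutely_integrable_continuous_real continuous_on_subset[OF h sub])
  ultimately show "f t = f 0 + (LINT s:{0..t}|lebesgue. h s)" by simp
qed

text \<open>A function whose weak derivative equals a continuous \<open>h\<close> almost everywhere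
  is a constant plus the integral of \<open>h\<close>, hence classically differentiable. This is the
  passage from the operator on its domain to classical eigenfunctions.\<close>

lemma weak_deriv_AE_eq_iff:
  fixes f h :: "real \<Rightarrow> 'a::euclidean_space"
  assumes h: "continuous_on {0..T} h"
  shows "f \<in> W12 T \<and> (AE t\<in>{0..T} in lebesgue. weak_deriv T f t = h t) \<longleftrightarrow>
    (\<forall>t\<in>{0..T}. (f has_vector_derivative h t) (at t within {0..T}))" (is "?L \<longleftrightarrow> ?R")
proof
  assume ?R
  then have H: "has_weak_deriv T f h" using has_weak_derivI[OF _ h] by blast
  \<comment> \<open>\<open>weak_deriv\<close> is a choice, legitimate once some weak derivative
    exists; uniqueness almost everywhere identifies it with \<open>h\<close>.\<close>
  then have "has_weak_deriv T f (weak_deriv T f)"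
    unfolding weak_deriv_def using someI[of "has_weak_deriv T f" h] by simp
  then show ?L using has_weak_deriv_unique[OF _ H] H unfolding W12_def by blast
next
  assume L: ?L
  define g where "g = weak_deriv T f"
  have g: "has_weak_deriv T f g"
  proof -
    obtain k where "has_weak_deriv T f k" using L unfolding W12_def by blast
    then show ?thesis unfolding g_def weak_deriv_def using someI[of "has_weak_deriv T f" k] by simp
  qed
  have AE: "AE t in lebesgue. t \<in> {0..T} \<longrightarrow> g t = h t" using L by (simp add: g_def)
  then obtain N where N: "{t. \<not> (t \<in> {0..T} \<longrightarrow> g t = h t)} \<subseteq> N" "N \<in> null_sets lebesgue"
    by (auto simp: eventually_ae_filter)
  have f: "f t = f 0 + integral {0..t} h" if "t \<in> {0..T}" for t
  proof -
    have "integral {0..t} g = integral {0..t} h"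
      using N that by (intro integral_spike[of N]) (auto simp: negligible_iff_null_sets)
    then show ?thesis using has_weak_deriv_integral(2)[OF g that] by simp
  qed
  show ?R
  proof
    fix t assume t: "t \<in> {0..T}"
    have "((\<lambda>t. f 0 + integral {0..t} h) has_vector_derivative 0 + h t) (at t within {0..T})"
      by (intro has_vector_derivative_add has_vector_derivative_const integral_has_vector_derivative h t)
    then show "(f has_vector_derivative h t) (at t within {0..T})"
      using has_vector_derivative_transform[OF t f] by simp
  qed
qed

text \<open>
  Both sides are the limit of the second difference of \<open>g\<close> along \<open>a\<close> and \<open>b\<close>, divided by \<open>s\<^sup>2\<close>.
\<close>

lemma second_derivative_symmetric:
  fixes g :: "'a::real_normed_vector \<Rightarrow> real"
  assumes g: "\<And>w. (g has_derivative g' w) (at w)"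
    and a: "((\<lambda>w. g' w a) has_derivative (\<lambda>k. g'' k a)) (at w0)"
    and b: "((\<lambda>w. g' w b) has_derivative (\<lambda>k. g'' k b)) (at w0)"
  shows "g'' a b = g'' b a"
proof -
  \<comment> \<open>The mean value theorem in direction \<open>b\<close>, applied to the difference
    of \<open>g\<close> over the step \<open>s a\<close>, turns the second difference into s times a
    difference of \<open>g' _ b\<close>; differentiability of the latter at \<open>w0\<close>
    evaluates it. The second difference is symmetric in \<open>a\<close> and
    \<open>b\<close>.\<close>
  have half: "\<exists>d>0. \<forall>s. 0 < s \<and> s < d \<longrightarrow>
      \<bar>(g (w0 + s *\<^sub>R a + s *\<^sub>R b) - g (w0 + s *\<^sub>R b) - g (w0 + s *\<^sub>R a) + g w0) - s\<^sup>2 * g'' a b\<bar> \<le> e * s\<^sup>2"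
    if b: "((\<lambda>w. g' w b) has_derivative (\<lambda>k. g'' k b)) (at w0)" and e: "0 < e" for a b e
  proof -
    define n where "n = norm a + norm b + 1"
    have n: "n > 0" "norm a \<le> n" "norm b \<le> n" by (auto simp: n_def add_nonneg_pos)
    have bl: "bounded_linear (\<lambda>k. g'' k b)" using b by (rule has_derivative_bounded_linear)
    interpret L: bounded_linear "\<lambda>k. g'' k b" by (rule bl)
    \<comment> \<open>The points involved are within \<open>2 n s\<close> of \<open>w0\<close>, so
      this accuracy makes each of the two errors at most \<open>e s / 2\<close>.\<close>
    have "0 < e / (4 * n)" using e n by simp
    then obtain d where d: "d > 0" "\<And>w. norm (w - w0) < d \<Longrightarrow>
        norm (g' w b - g' w0 b - g'' (w - w0) b) \<le> e / (4 * n) * norm (w - w0)"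
      using b unfolding has_derivative_at_alt by blast
    show ?thesis
    proof (intro exI[of _ "d / (2 * n)"] conjI allI impI)
      show "0 < d / (2 * n)" using d n by simp
      fix s assume s: "0 < s \<and> s < d / (2 * n)"
      then have sd: "2 * n * s < d" using n by (simp add: field_simps)
      define \<phi> where "\<phi> r = g (w0 + s *\<^sub>R a + r *\<^sub>R b) - g (w0 + r *\<^sub>R b)" for r
      have D: "((\<lambda>r. g (u + r *\<^sub>R b)) has_derivative (\<lambda>k. k * g' (u + r *\<^sub>R b) b)) (at r within {0..s})" for u r
      proof -
        have "((\<lambda>r. u + r *\<^sub>R b) has_derivative (\<lambda>k. k *\<^sub>R b)) (at r within {0..s})"
          by (auto intro!: derivative_eq_intros)
        from has_derivative_compose[OF this g]
        have "((\<lambda>r. g (u + r *\<^sub>R b)) has_derivative (\<lambda>k. g' (u + r *\<^sub>R b) (k *\<^sub>R b))) (at r within {0..s})" .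
        then show ?thesis
          using linear_scale[OF has_derivative_linear[OF g[of "u + r *\<^sub>R b"]]] by simp
      qed
      have "\<exists>r\<in>{0<..<s}. \<phi> s - \<phi> 0 = (s - 0) * g' (w0 + s *\<^sub>R a + r *\<^sub>R b) b - (s - 0) * g' (w0 + r *\<^sub>R b) b"
        unfolding \<phi>_def using s by (intro mvt_simple has_derivative_diff D) auto
      then obtain r where r: "0 < r" "r < s"
        and eq: "\<phi> s - \<phi> 0 = s * (g' (w0 + s *\<^sub>R a + r *\<^sub>R b) b - g' (w0 + r *\<^sub>R b) b)"
        by (auto simp: algebra_simps)
      have le: "norm (c *\<^sub>R x) \<le> s * n" if "0 \<le> c" "c \<le> s" "norm x \<le> n" for c and x :: 'a
        using that by (simp add: mult_mono)
      have n1: "norm (s *\<^sub>R a + r *\<^sub>R b) \<le> 2 * n * s" and n2: "norm (r *\<^sub>R b) \<le> 2 * n * s"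
      proof -
        have "norm (s *\<^sub>R a) \<le> s * n" "norm (r *\<^sub>R b) \<le> s * n" using s r n by (intro le; simp)+
        moreover have "2 * n * s = s * n + s * n" "0 \<le> s * n" using s n by (simp_all add: algebra_simps)
        ultimately show "norm (s *\<^sub>R a + r *\<^sub>R b) \<le> 2 * n * s" "norm (r *\<^sub>R b) \<le> 2 * n * s"
          using norm_triangle_ineq[of "s *\<^sub>R a" "r *\<^sub>R b"] by linarith+
      qed
      have 1: "\<bar>g' (w0 + s *\<^sub>R a + r *\<^sub>R b) b - g' w0 b - g'' (s *\<^sub>R a + r *\<^sub>R b) b\<bar> \<le> e / (4 * n) * (2 * n * s)"
      proof -
        have "\<bar>g' (w0 + s *\<^sub>R a + r *\<^sub>R b) b - g' w0 b - g'' (s *\<^sub>R a + r *\<^sub>R b) b\<bar> \<le> e / (4 * n) * norm (s *\<^sub>R a + r *\<^sub>R b)"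
          using d(2)[of "w0 + s *\<^sub>R a + r *\<^sub>R b"] n1 sd by (simp add: add.assoc)
        also have "\<dots> \<le> e / (4 * n) * (2 * n * s)" using n1 e n by (intro mult_left_mono) auto
        finally show ?thesis .
      qed
      have 2: "\<bar>g' (w0 + r *\<^sub>R b) b - g' w0 b - g'' (r *\<^sub>R b) b\<bar> \<le> e / (4 * n) * (2 * n * s)"
      proof -
        have "\<bar>g' (w0 + r *\<^sub>R b) b - g' w0 b - g'' (r *\<^sub>R b) b\<bar> \<le> e / (4 * n) * norm (r *\<^sub>R b)"
          using d(2)[of "w0 + r *\<^sub>R b"] n2 sd by simp
        also have "\<dots> \<le> e / (4 * n) * (2 * n * s)" using n2 e n by (intro mult_left_mono) auto
        finally show ?thesis .
      qed
      have lin: "g'' (s *\<^sub>R a + r *\<^sub>R b) b = s * g'' a b + r * g'' b b" "g'' (r *\<^sub>R b) b = r * g'' b b"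
        by (simp_all add: L.add L.scaleR)
      have "e / (4 * n) * (2 * n * s) = e * s / 2" using n by (simp add: field_simps)
      then have "\<bar>(g' (w0 + s *\<^sub>R a + r *\<^sub>R b) b - g' (w0 + r *\<^sub>R b) b) - s * g'' a b\<bar> \<le> e * s"
        using 1 2 unfolding lin by linarith
      then have "s * \<bar>(g' (w0 + s *\<^sub>R a + r *\<^sub>R b) b - g' (w0 + r *\<^sub>R b) b) - s * g'' a b\<bar> \<le> s * (e * s)"
        using s by (intro mult_left_mono) auto
      moreover have "s * \<bar>(g' (w0 + s *\<^sub>R a + r *\<^sub>R b) b - g' (w0 + r *\<^sub>R b) b) - s * g'' a b\<bar> = \<bar>\<phi> s - \<phi> 0 - s\<^sup>2 * g'' a b\<bar>"
        unfolding eq using s by (simp add: abs_mult_pos' power2_eq_square right_diff_distrib mult.assoc)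
      ultimately show "\<bar>(g (w0 + s *\<^sub>R a + s *\<^sub>R b) - g (w0 + s *\<^sub>R b) - g (w0 + s *\<^sub>R a) + g w0) - s\<^sup>2 * g'' a b\<bar> \<le> e * s\<^sup>2"
        by (simp add: \<phi>_def power2_eq_square mult_ac algebra_simps)
    qed
  qed
  have small: "\<bar>g'' a b - g'' b a\<bar> \<le> e" if e: "0 < e" for e
  proof -
    have "0 < e / 2" using e by simp
    from half[OF b this, of a] obtain d1 where d1: "d1 > 0" "\<And>s. 0 < s \<Longrightarrow> s < d1 \<Longrightarrow>
      \<bar>(g (w0 + s *\<^sub>R a + s *\<^sub>R b) - g (w0 + s *\<^sub>R b) - g (w0 + s *\<^sub>R a) + g w0) - s\<^sup>2 * g'' a b\<bar> \<le> e / 2 * s\<^sup>2" by blast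
    from half[OF a \<open>0 < e / 2\<close>, of b] obtain d2 where d2: "d2 > 0" "\<And>s. 0 < s \<Longrightarrow> s < d2 \<Longrightarrow>
      \<bar>(g (w0 + s *\<^sub>R b + s *\<^sub>R a) - g (w0 + s *\<^sub>R a) - g (w0 + s *\<^sub>R b) + g w0) - s\<^sup>2 * g'' b a\<bar> \<le> e / 2 * s\<^sup>2" by blast
    define s where "s = min d1 d2 / 2"
    have s: "0 < s" "s < d1" "s < d2" using d1(1) d2(1) by (auto simp: s_def min_def)
    have sw: "w0 + s *\<^sub>R b + s *\<^sub>R a = w0 + s *\<^sub>R a + s *\<^sub>R b" by (simp add: algebra_simps)
    have "\<bar>s\<^sup>2 * g'' a b - s\<^sup>2 * g'' b a\<bar> \<le> e * s\<^sup>2"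
      using d1(2)[OF s(1,2)] d2(2)[OF s(1,3)] unfolding sw by (simp add: abs_if split: if_splits)
    moreover have "\<bar>s\<^sup>2 * g'' a b - s\<^sup>2 * g'' b a\<bar> = \<bar>g'' a b - g'' b a\<bar> * s\<^sup>2"
      unfolding right_diff_distrib[symmetric] abs_mult by simp
    ultimately show ?thesis using s(1) by simp
  qed
  show ?thesis
  proof (rule ccontr)
    assume "g'' a b \<noteq> g'' b a"
    then show False using small[of "\<bar>g'' a b - g'' b a\<bar> / 2"] by simp
  qed
qed

section \<open>Coefficients of the linearization\<close>

lemma jacobian_component:
  fixes f :: "real^'n::finite \<Rightarrow> real^'m::finite"
  assumes "\<And>i. ((\<lambda>v. f v $ i) has_derivative (\<lambda>k. d k i)) (at v)"
  shows "jacobian f (at v) $ i $ j = d (axis j 1) i"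
proof -
  have "(f has_derivative (\<lambda>k. \<chi> i. d k i)) (at v)"
    unfolding has_derivative_componentwise_within[of f]
    using assms by (auto simp: Basis_vec_def inner_axis)
  then have "frechet_derivative f (at v) = (\<lambda>k. \<chi> i. d k i)" using frechet_derivative_at by metis
  then show ?thesis by (simp add: jacobian_def matrix_def)
qed

text \<open>The entries of \<open>P\<close>, \<open>Q\<close>, \<open>R\<close> are values of the
  second derivative \<open>f''\<close> on pairs of basis vectors with zero time component.
  Continuity is inherited from \<open>f''\<close>, and symmetry holds at each fixed time, one-sided
  end times included.\<close>

lemma C2_coefficients:
  fixes L :: "'n::finite lagr" and x :: "real \<Rightarrow> real^'n"
  assumes C2: "C2_on ({0..T} \<times> UNIV) (\<lambda>(t, u, v). L t u v)" and x: "C1_path T x"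
  shows "continuous_on {0..T} (P_coeff T L x)" "continuous_on {0..T} (Q_coeff T L x)" "continuous_on {0..T} (R_coeff T L x)"
    and "t \<in> {0..T} \<Longrightarrow> transpose (P_coeff T L x t) = P_coeff T L x t"
    and "t \<in> {0..T} \<Longrightarrow> transpose (R_coeff T L x t) = R_coeff T L x t"
proof -
  let ?S = "{0..T} \<times> (UNIV :: ((real^'n) \<times> (real^'n)) set)"
  let ?F = "\<lambda>(t, u, v). L t u v"
  obtain f' :: "real \<times> (real^'n) \<times> (real^'n) \<Rightarrow> (real \<times> (real^'n) \<times> (real^'n)) \<Rightarrow>\<^sub>L real"
    and f'' :: "real \<times> (real^'n) \<times> (real^'n) \<Rightarrow> (real \<times> (real^'n) \<times> (real^'n)) \<Rightarrow>\<^sub>L ((real \<times> (real^'n) \<times> (real^'n)) \<Rightarrow>\<^sub>L real)"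
    where f': "\<And>p. p \<in> ?S \<Longrightarrow> (?F has_derivative blinfun_apply (f' p)) (at p within ?S)"
      and f'': "\<And>p. p \<in> ?S \<Longrightarrow> (f' has_derivative blinfun_apply (f'' p)) (at p within ?S)"
      and cont: "continuous_on ?S f''"
    using C2 unfolding C2_on_def by blast
  \<comment> \<open>For fixed t the slice is the whole (u, v)-space, so derivatives within the strip
    restrict to unrestricted ones there.\<close>
  have slice: "((\<lambda>w. h (t, w)) has_derivative (\<lambda>k. h' (0, k))) (at w)"
    if h: "(h has_derivative h') (at (t, w) within ?S)" and t: "t \<in> {0..T}"
    for h :: "real \<times> (real^'n) \<times> (real^'n) \<Rightarrow> 'b::real_normed_vector" and h' t w
  proof -
    have "((\<lambda>w. (t, w)) has_derivative (\<lambda>k. (0, k))) (at w)"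
      by (auto intro!: derivative_eq_intros)
    moreover have "(h has_derivative h') (at (t, w) within (\<lambda>w. (t, w)) ` UNIV)"
      by (rule has_derivative_subset[OF h]) (use t in auto)
    ultimately show ?thesis by (rule has_derivative_in_compose)
  qed
  have D1: "((\<lambda>w. L t (fst w) (snd w)) has_derivative (\<lambda>k. f' (t, w) (0, k))) (at w)" if "t \<in> {0..T}" for t w
    using slice[OF f' that, of w] that by (simp add: case_prod_beta)
  have D2: "((\<lambda>w. f' (t, w) (0, b)) has_derivative (\<lambda>k. f'' (t, w) (0, k) (0, b))) (at w)" if "t \<in> {0..T}" for t w b
    using bounded_linear.has_derivative[OF blinfun.bounded_linear_left slice[OF f'' that, of w]] that by simp
  have sym: "f'' (t, w) (0, a) (0, b) = f'' (t, w) (0, b) (0, a)" if "t \<in> {0..T}" for t w a b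
    using second_derivative_symmetric[of "\<lambda>w. L t (fst w) (snd w)" "\<lambda>w k. f' (t, w) (0, k)" a
        "\<lambda>k b. f'' (t, w) (0, k) (0, b)" w b] D1 D2 that by blast
  have inU: "((\<lambda>u. (u, v)) has_derivative (\<lambda>k. (k, 0))) (at u)" for u v :: "real^'n"
    by (auto intro!: derivative_eq_intros)
  have inV: "((\<lambda>v. (u, v)) has_derivative (\<lambda>k. (0, k))) (at v)" for u v :: "real^'n"
    by (auto intro!: derivative_eq_intros)
  have gu: "L_u L t u v $ i = f' (t, u, v) (0, axis i 1, 0)" if "t \<in> {0..T}" for t u v i
    using frechet_derivative_at[OF has_derivative_compose[OF inU D1[OF that]], of u v]
    by (simp add: L_u_def grad_def fun_eq_iff)
  have gv: "L_v L t u v $ i = f' (t, u, v) (0, 0, axis i 1)" if "t \<in> {0..T}" for t u v i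
    using frechet_derivative_at[OF has_derivative_compose[OF inV D1[OF that]], of u v]
    by (simp add: L_v_def grad_def fun_eq_iff)
  have vv: "L_vv L t u v $ i $ j = f'' (t, u, v) (0, 0, axis j 1) (0, 0, axis i 1)" if "t \<in> {0..T}" for t u v i j
    unfolding L_vv_def
    by (rule jacobian_component[where d = "\<lambda>k i. f'' (t, u, v) (0, 0, k) (0, 0, axis i 1)"])
       (simp only: gv[OF that] has_derivative_compose[OF inV D2[OF that]])
  have vu: "L_vu L t u v $ i $ j = f'' (t, u, v) (0, axis j 1, 0) (0, 0, axis i 1)" if "t \<in> {0..T}" for t u v i j
    unfolding L_vu_def
    by (rule jacobian_component[where d = "\<lambda>k i. f'' (t, u, v) (0, k, 0) (0, 0, axis i 1)"])
       (simp only: gv[OF that] has_derivative_compose[OF inU D2[OF that]])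
  have uu: "L_uu L t u v $ i $ j = f'' (t, u, v) (0, axis j 1, 0) (0, axis i 1, 0)" if "t \<in> {0..T}" for t u v i j
    unfolding L_uu_def
    by (rule jacobian_component[where d = "\<lambda>k i. f'' (t, u, v) (0, k, 0) (0, axis i 1, 0)"])
       (simp only: gu[OF that] has_derivative_compose[OF inU D2[OF that]])
  have c: "continuous_on {0..T} (\<lambda>t. f'' (t, x t, dot T x t) a b)" for a b
  proof -
    have "continuous_on {0..T} (\<lambda>t. (t, x t, dot T x t))"
      by (intro continuous_intros C1_path_continuous[OF x])
    then have "continuous_on {0..T} (\<lambda>t. f'' (t, x t, dot T x t))"
      by (rule continuous_on_compose2[OF cont]) auto
    then show ?thesis by (intro blinfun.continuous_on continuous_on_const)
  qed
  have entry: "continuous_on {0..T} A" if A: "\<And>t i j. t \<in> {0..T} \<Longrightarrow> A t $ i $ j = f'' (t, x t, dot T x t) (a j) (b i)"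
    for A :: "real \<Rightarrow> real^'n^'n" and a b
  proof -
    have "continuous_on {0..T} (\<lambda>t. \<chi> i j. f'' (t, x t, dot T x t) (a j) (b i))"
      by (intro continuous_on_vec_lambda c)
    then show ?thesis by (rule continuous_on_eq) (simp add: vec_eq_iff A)
  qed
  show "continuous_on {0..T} (P_coeff T L x)"
    by (rule entry[of _ "\<lambda>j. (0, 0, axis j 1)" "\<lambda>i. (0, 0, axis i 1)"]) (simp add: P_coeff_def vv)
  show "continuous_on {0..T} (Q_coeff T L x)"
    by (rule entry[of _ "\<lambda>j. (0, axis j 1, 0)" "\<lambda>i. (0, 0, axis i 1)"]) (simp add: Q_coeff_def vu)
  show "continuous_on {0..T} (R_coeff T L x)"
    by (rule entry[of _ "\<lambda>j. (0, axis j 1, 0)" "\<lambda>i. (0, axis i 1, 0)"]) (simp add: R_coeff_def uu)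
  assume t: "t \<in> {0..T}"
  show "transpose (P_coeff T L x t) = P_coeff T L x t" "transpose (R_coeff T L x t) = R_coeff T L x t"
    by (simp_all add: vec_eq_iff transpose_def P_coeff_def R_coeff_def vv[OF t] uu[OF t] sym[OF t])
qed

text \<open>The quadratic form attains a positive minimum on the compact product of [0,T] and the
  unit sphere; homogeneity does the rest.\<close>

lemma uniformly_positive:
  fixes A :: "real \<Rightarrow> real^'n::finite^'n"
  assumes A: "continuous_on {0..T} A" and T: "0 \<le> T"
    and pos: "\<And>t w. t \<in> {0..T} \<Longrightarrow> w \<noteq> 0 \<Longrightarrow> 0 < (A t *v w) \<bullet> w"
  obtains p where "0 < p" "\<And>t w. t \<in> {0..T} \<Longrightarrow> p * (norm w)\<^sup>2 \<le> (A t *v w) \<bullet> w"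
proof -
  let ?K = "{0..T} \<times> sphere (0 :: real^'n) 1"
  have "compact ?K" by (intro compact_Times compact_Icc compact_sphere)
  moreover have "?K \<noteq> {}" using T by (auto simp: sphere_eq_empty)
  moreover have "continuous_on ?K (\<lambda>z. (A (fst z) *v snd z) \<bullet> snd z)"
    by (intro continuous_intros continuous_on_compose2[OF A]) auto
  ultimately obtain z where z: "z \<in> ?K" "\<And>y. y \<in> ?K \<Longrightarrow> (A (fst z) *v snd z) \<bullet> snd z \<le> (A (fst y) *v snd y) \<bullet> snd y"
    using continuous_attains_inf[of ?K "\<lambda>z. (A (fst z) *v snd z) \<bullet> snd z"] by blast
  define p where "p = (A (fst z) *v snd z) \<bullet> snd z"
  have "snd z \<noteq> 0" "fst z \<in> {0..T}" using z(1) by auto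
  then have "0 < p" unfolding p_def by (intro pos)
  moreover have "p * (norm w)\<^sup>2 \<le> (A t *v w) \<bullet> w" if t: "t \<in> {0..T}" for t w
  proof (cases "w = 0")
    case False
    define u where "u = (1 / norm w) *\<^sub>R w"
    have w: "w = norm w *\<^sub>R u" using False by (simp add: u_def)
    have "norm u = 1" using False by (simp add: u_def)
    then have "p \<le> (A t *v u) \<bullet> u" using z(2)[of "(t, u)"] t by (simp add: p_def)
    then have "p * (norm w)\<^sup>2 \<le> (A t *v u) \<bullet> u * (norm w)\<^sup>2" by (rule mult_right_mono) simp
    also have "\<dots> = (A t *v (norm w *\<^sub>R u)) \<bullet> (norm w *\<^sub>R u)"
      by (simp add: matrix_vector_mult_scaleR power2_eq_square mult_ac)
    finally show ?thesis using w by simp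
  qed simp
  ultimately show thesis by (rule that)
qed

lemma hinner_cmat: "hinner (cmat A *v a) b = hinner a (cmat (transpose A) *v b)"
proof -
  have "hinner (cmat A *v a) b = (\<Sum>i\<in>UNIV. \<Sum>j\<in>UNIV. complex_of_real (A $ i $ j) * a $ j * cnj (b $ i))"
    by (simp add: hinner_def matrix_vector_mult_def sum_distrib_right)
  also have "\<dots> = (\<Sum>j\<in>UNIV. \<Sum>i\<in>UNIV. complex_of_real (A $ i $ j) * a $ j * cnj (b $ i))" by (rule sum.swap)
  also have "\<dots> = hinner a (cmat (transpose A) *v b)"
    by (simp add: hinner_def matrix_vector_mult_def transpose_def sum_distrib_left mult_ac)
  finally show ?thesis .
qed

text \<open>A real matrix acts separately on real and imaginary parts, so positivity on real vectors
  extends to complex ones with the same constant.\<close>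

lemma cmat_quadratic:
  fixes A :: "real^'n::finite^'n" and a :: "complex^'n"
  defines "r \<equiv> \<chi> i. Re (a $ i)" and "s \<equiv> \<chi> i. Im (a $ i)"
  shows "(cmat A *v a) \<bullet> a = (A *v r) \<bullet> r + (A *v s) \<bullet> s" and "(norm a)\<^sup>2 = (norm r)\<^sup>2 + (norm s)\<^sup>2"
proof -
  have "Re ((cmat A *v a) $ i) = (A *v r) $ i" "Im ((cmat A *v a) $ i) = (A *v s) $ i" for i
    by (simp_all add: matrix_vector_mult_def r_def s_def)
  then show "(cmat A *v a) \<bullet> a = (A *v r) \<bullet> r + (A *v s) \<bullet> s"
    by (simp add: inner_vec_def inner_complex_def sum.distrib r_def s_def)
  show "(norm a)\<^sup>2 = (norm r)\<^sup>2 + (norm s)\<^sup>2"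
    unfolding power2_norm_eq_inner by (simp add: inner_vec_def inner_complex_def sum.distrib r_def s_def)
qed

lemma continuous_on_cmat:
  fixes A :: "real \<Rightarrow> real^'n::finite^'n"
  assumes "continuous_on S A" shows "continuous_on S (\<lambda>t. cmat (A t))"
  unfolding map_matrix_def by (intro continuous_intros assms)

theorem corollary1p2:
  fixes L :: "real \<Rightarrow> real^'n \<Rightarrow> real^'n \<Rightarrow> real"
    and x :: "real \<Rightarrow> real^'n"
    and T :: real
    and \<Lambda>\<^sub>0 :: "('n c4n) set"
  assumes "0 < T"
    and "C2_on ({0..T} \<times> UNIV) (\<lambda>(t, u, v). L t u v)"
    and "legendre_convex T L"
    and "critical_point T L x"
    and "lagrangian \<Lambda>\<^sub>0"
  shows "morse_index T L x Lambda_D \<le> morse_index T L x \<Lambda>\<^sub>0 \<and>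
         morse_index T L x \<Lambda>\<^sub>0 \<le> morse_index T L x Lambda_D + enat (nu \<Lambda>\<^sub>0)"
proof -
  have x: "C1_path T x" using assms(4) by (simp add: critical_point_def)
  note coeff = C2_coefficients[OF assms(2) x]
  have pos: "0 < (P_coeff T L x t *v w) \<bullet> w" if "t \<in> {0..T}" "w \<noteq> 0" for t w
    using assms(3) that by (simp add: legendre_convex_def P_coeff_def)
  obtain p where p: "0 < p" "\<And>t w. t \<in> {0..T} \<Longrightarrow> p * (norm w)\<^sup>2 \<le> (P_coeff T L x t *v w) \<bullet> w"
    using uniformly_positive[OF coeff(1) less_imp_le[OF assms(1)] pos] by blast
  interpret sturm T "\<lambda>t. cmat (P_coeff T L x t)" "\<lambda>t. cmat (Q_coeff T L x t)"
      "\<lambda>t. cmat (transpose (Q_coeff T L x t))" "\<lambda>t. cmat (R_coeff T L x t)" p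
  proof
    show "continuous_on {0..T} (\<lambda>t. cmat (transpose (Q_coeff T L x t)))"
      unfolding transpose_def by (intro continuous_on_cmat continuous_on_vec_lambda continuous_on_component coeff)
    fix t a b assume t: "t \<in> {0..T}"
    show "hinner (cmat (P_coeff T L x t) *v a) b = hinner a (cmat (P_coeff T L x t) *v b)"
      "hinner (cmat (R_coeff T L x t) *v a) b = hinner a (cmat (R_coeff T L x t) *v b)"
      using hinner_cmat coeff(4,5)[OF t] by metis+
    show "p * (norm a)\<^sup>2 \<le> (cmat (P_coeff T L x t) *v a) \<bullet> a"
      unfolding cmat_quadratic distrib_left by (intro add_mono p t)
  qed (auto intro: continuous_on_cmat coeff assms p hinner_cmat)
  have mom: "momentum T L x \<xi> = mom \<xi>" for \<xi>
    by (rule ext) (simp add: momentum_def mom_def)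
  \<comment> \<open>The eigenvalue equation prescribes the weak derivative of the momentum as
    \<open>low \<xi> - \<mu> \<xi>\<close>, which is continuous for a C1 path; so it holds
    everywhere, and the two indices agree term by term.\<close>
  have "eigenspace T L x \<Lambda> \<mu> = {\<xi>. eigen \<Lambda> \<mu> \<xi>}" for \<Lambda> \<mu>
  proof -
    have "(mom \<xi> \<in> W12 T \<and> (AE t\<in>{0..T} in lebesgue. A_op T L x \<xi> t = complex_of_real \<mu> *s \<xi> t)) \<longleftrightarrow>
       (\<forall>t\<in>{0..T}. (mom \<xi> has_vector_derivative low \<xi> t - complex_of_real \<mu> *s \<xi> t) (at t within {0..T}))"
      if "C1_path T \<xi>" for \<xi>
    proof -
      have "A_op T L x \<xi> t = complex_of_real \<mu> *s \<xi> t \<longleftrightarrow> weak_deriv T (mom \<xi>) t = low \<xi> t - complex_of_real \<mu> *s \<xi> t" for t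
        unfolding A_op_def mom low_def by (auto simp: algebra_simps)
      moreover have "continuous_on {0..T} (\<lambda>t. low \<xi> t - complex_of_real \<mu> *s \<xi> t)"
        by (intro continuous_intros continuous_low C1_path_continuous that)
      ultimately show ?thesis using weak_deriv_AE_eq_iff by simp
    qed
    then show ?thesis
      unfolding eigenspace_def E_dom_def eigen_def sol_def mom bd_def by blast
  qed
  then have "morse_index T L x \<Lambda> = spectral_index \<Lambda>" for \<Lambda>
    by (simp add: morse_index_def spectral_index_def)
  then show ?thesis
    using spectral_index_Dirichlet_le[OF assms(5)] spectral_index_le_Dirichlet[OF assms(5)] by simp
qed

end
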